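(* Let $T>0$, $f\in C_b(X)$, $g\in C_b([0,T]\times X)$, and let $$v(t,x)=P_tf(x)+\int_0^tP_{t-s}g(s,\cdot)(x)\,ds,\qquad t\in[0,T],\ x\in X.$$ The following statements hold. (i) If $1/\theta=k\in\mathbb{N}$ and $f\in Z^k_H(X)$, then $v\in Z^{0,k}_H([0,T]\times X)$, and there exists $C=C(T)>0$, independent of $f$ and $g$, such that $\|v\|_{Z^{0,k}_H([0,T]\times X)}\le C(\|f\|_{Z^k_H(X)}+\|g\|_\infty)$. (ii) If $\alpha\in(0,1)$, $\alpha+1/\theta=k\in\mathbb{N}$, $f\in Z^k_H(X)$ and $g\in C^{0,\alpha}_H([0,T]\times X)$, then $v\in Z^{0,k}_H([0,T]\times X)$, and there exists $C=C(T,\alpha)>0$, independent of $f$ and $g$, such that $\|v\|_{Z^{0,k}_H([0,T]\times X)}\le C(\|f\|_{Z^k_H(X)}+\|g\|_{C^{0,\alpha}_H([0,T]\times X)})$.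
   Context: Setting. $X$ is a real separable Banach space; for Banach spaces, $H\subset X$ means that $H$ is contained in $X$ with continuous embedding. For a Banach space $Y$, $C_b(X;Y)$ is the space of bounded functions $X\to Y$ that are continuous with respect to the norm of $Y$, with the sup norm $\|\cdot\|_\infty$; $C_b(X)=C_b(X;\mathbb{R})$, and $C_b([0,T]\times X)$ is the space of bounded continuous real functions on $[0,T]\times X$ with the sup norm. $(T_t)_{t\ge0}$ is a strongly continuous semigroup of bounded linear operators on $X$, and $(\mu_t)_{t\ge0}$ are Borel probability measures on $X$ with $\mu_0=\delta_0$, $t\mapsto\mu_t$ weakly continuous on $[0,\infty)$, and $\mu_{t+s}=(\mu_t\circ T_s^{-1})*\mu_s$ for $t,s>0$. The generalized Mehler semigroup is $P_tf(x)=\int_Xf(T_tx+y)\,\mu_t(dy)$, $t\ge0$, $f\in C_b(X)$. Fomin differentiability. A Borel probability measure $\mu$ on $X$ is Fomin differentiable along $v\in X$ if $\lim_{t\to0}(\mu(A+tv)-\mu(A))/t$ exists and is finite for every Borel set $A$. The limit is then a signed measure $d_v\mu$, absolutely continuous with respect to $\mu$, with density $\beta^\mu_v\in L^1(X,\mu)$. Equivalently, there is $\beta^\mu_v\in L^1(X,\mu)$ with $\int_X\frac{\partial f}{\partial v}\,d\mu=-\int_X\beta^\mu_vf\,d\mu$ for all $f\in C^1_b(X)$ (the space $C^1_H(X)$ defined below, with $H=X$). Standing hypotheses. (1) For every $t>0$ there is a subspace $\{0\}\ne H_t\subset X$ such that $\mu_t$ is Fomin differentiable along every $h\in H_t$.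 (2) There exist a Banach space $H\subset X$ and constants $M,C,\theta>0$, $\omega\in\mathbb{R}$ such that for all $t>0$, $h\in H$: $T_t(H)\subset H$ and $\|T_th\|_H\le Me^{\omega t}\|h\|_H$; $T_t(H)\subset H_t$ and $\|\beta^{\mu_t}_{T_th}\|_{L^1(X,\mu_t)}\le Ce^{\omega t}t^{-\theta}\|h\|_H$. Function spaces. For a Banach space $Y$, $F:X\to Y$ is $H$-Gateaux differentiable at $x$ if $\partial F/\partial h(x)=\lim_{t\to0}(F(x+th)-F(x))/t$ exists for all $h\in H$ and $D_HF(x):h\mapsto\partial F/\partial h(x)$ belongs to the space $\mathcal{L}(H,Y)$ of bounded linear operators. $\mathcal{L}^n(H)$ is the space of continuous $n$-linear maps $H^n\to\mathbb{R}$ with norm $\|T\|_{\mathcal{L}^n(H)}=\sup\{|T(h_1,\dots,h_n)|/(\|h_1\|_H\cdots\|h_n\|_H):h_i\in H\setminus\{0\}\}$, identified with $\mathcal{L}(H,\mathcal{L}^{n-1}(H))$; $D^n_Hf(x)\in\mathcal{L}^n(H)$ is the $H$-Gateaux derivative at $x$ of $D^{n-1}_Hf:X\to\mathcal{L}^{n-1}(H)$. $C^n_H(X)$ ($n\in\mathbb{N}=\{1,2,\dots\}$) is the set of $f\in C_b(X)$ having $H$-Gateaux derivatives up to order $n$ at every point such that $x\mapsto D^k_Hf(x)(h_1,\dots,h_k)$ is continuous and bounded for all $k\le n$ and $h_i\in H$, with norm $\|f\|_\infty+\sum_{k=1}^n\sup_x\|D^k_Hf(x)\|_{\mathcal{L}^k(H)}$.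 For $\alpha\in(0,1)$, $C^\alpha_H(X)=\{f\in C_b(X):[f]_{C^\alpha_H(X)}:=\sup_{x\in X,h\in H\setminus\{0\}}|f(x+h)-f(x)|/\|h\|_H^\alpha<\infty\}$ with norm $\|f\|_\infty+[f]_{C^\alpha_H(X)}$. For a Banach space $Y$, $Z^1_H(X,Y)=\{F\in C_b(X;Y):[F]_{Z^1_H(X,Y)}:=\sup_{x\in X,h\in H\setminus\{0\}}\|F(x+2h)-2F(x+h)+F(x)\|_Y/\|h\|_H<\infty\}$ with norm $\|F\|_\infty+[F]_{Z^1_H(X,Y)}$, and $Z^1_H(X)=Z^1_H(X,\mathbb{R})$. For $n\ge2$, $Z^n_H(X)=\{f\in C^{n-1}_H(X):D^{n-1}_Hf\in Z^1_H(X,\mathcal{L}^{n-1}(H))\}$ with norm $\|f\|_{C^{n-1}_H(X)}+[D^{n-1}_Hf]_{Z^1_H(X,\mathcal{L}^{n-1}(H))}$. For $\alpha\in(0,1)$, $C^{0,\alpha}_H([0,T]\times X)$ is the space of bounded continuous $g:[0,T]\times X\to\mathbb{R}$ with $g(t,\cdot)\in C^\alpha_H(X)$ for every $t\in[0,T]$ and $\|g\|_{C^{0,\alpha}_H([0,T]\times X)}:=\sup_{t\in[0,T]}\|g(t,\cdot)\|_{C^\alpha_H(X)}<\infty$. For $m\in\mathbb{N}$, $C^{0,m}_H([0,T]\times X)$ is the space of bounded continuous $g:[0,T]\times X\to\mathbb{R}$ with $g(t,\cdot)\in C^m_H(X)$ for every $t\in[0,T]$, $\sup_{t\in[0,T]}\|g(t,\cdot)\|_{C^m_H(X)}<\infty$,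 and $(t,x)\mapsto\frac{\partial^jg}{\partial h_1\cdots\partial h_j}(t,x)$ continuous on $[0,T]\times X$ for all $j\le m$, $h_i\in H$. For $k\in\mathbb{N}$, $Z^{0,k}_H([0,T]\times X)$ is the space of bounded continuous $g:[0,T]\times X\to\mathbb{R}$ with $g(t,\cdot)\in Z^k_H(X)$ for every $t\in[0,T]$, $\|g\|_{Z^{0,k}_H([0,T]\times X)}:=\sup_{t\in[0,T]}\|g(t,\cdot)\|_{Z^k_H(X)}<\infty$, and, if $k\ge2$, $g\in C^{0,k-1}_H([0,T]\times X)$. *)

theory Defs
  imports "HOL-Probability.Probability"
begin

text \<open>
  The Banach space \<open>H \<subset> X\<close> is a type \<open>'h::banach\<close> together with an injective bounded linear map
  \<open>\<iota> :: 'h \<Rightarrow> 'x\<close>, the inclusion.  Norms and seminorms take values in \<open>ennreal\<close>, so that a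
  supremum is finite exactly when it is \<open>< \<infinity>\<close>, and the supremum of an empty family
  (which occurs for \<open>H = {0}\<close>) is \<open>0\<close>.
\<close>

section \<open>Generalized Mehler semigroups\<close>

definition Cb :: "('a::topological_space \<Rightarrow> real) set" where
  "Cb = {f. continuous_on UNIV f \<and> bounded (range f)}"

definition sup_norm :: "('a \<Rightarrow> real) \<Rightarrow> ennreal" where
  "sup_norm f = (SUP x. ennreal \<bar>f x\<bar>)"

text \<open>The library's convolution is restricted to ordered Euclidean spaces.\<close>

definition conv_measure :: "'x::real_normed_vector measure \<Rightarrow> 'x measure \<Rightarrow> 'x measure" where
  "conv_measure M N = distr (M \<Otimes>\<^sub>M N) borel (\<lambda>(x, y). x + y)"

locale mehler_semigroup =
  fixes S :: "real \<Rightarrow> ('x::{banach, second_countable_topology}) \<Rightarrow>\<^sub>L 'x"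
    and \<mu> :: "real \<Rightarrow> 'x measure"
  assumes S_0: "S 0 = id_blinfun"
    and S_add: "\<And>t s. t \<ge> 0 \<Longrightarrow> s \<ge> 0 \<Longrightarrow> S (t + s) = S t o\<^sub>L S s"
    and S_cont: "\<And>x. continuous_on {0..} (\<lambda>t. S t x)"
    and \<mu>_prob: "\<And>t. t \<ge> 0 \<Longrightarrow> prob_space (\<mu> t)"
    and \<mu>_sets: "\<And>t. t \<ge> 0 \<Longrightarrow> sets (\<mu> t) = sets borel"
    and \<mu>_0: "\<mu> 0 = return borel 0"
    and \<mu>_cont: "\<And>f. f \<in> Cb \<Longrightarrow> continuous_on {0..} (\<lambda>t. LINT x|\<mu> t. f x)"
    and \<mu>_add: "\<And>t s. t > 0 \<Longrightarrow> s > 0 \<Longrightarrow>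
      \<mu> (t + s) = conv_measure (distr (\<mu> t) borel (S s)) (\<mu> s)"

definition mehler ::
  "(real \<Rightarrow> 'x::real_normed_vector \<Rightarrow>\<^sub>L 'x) \<Rightarrow> (real \<Rightarrow> 'x measure) \<Rightarrow> real \<Rightarrow> ('x \<Rightarrow> real) \<Rightarrow> 'x \<Rightarrow> real"
  where "mehler S \<mu> t f x = (LINT y|\<mu> t. f (S t x + y))"

definition mild_solution ::
  "(real \<Rightarrow> 'x::real_normed_vector \<Rightarrow>\<^sub>L 'x) \<Rightarrow> (real \<Rightarrow> 'x measure) \<Rightarrow>
    ('x \<Rightarrow> real) \<Rightarrow> (real \<Rightarrow> 'x \<Rightarrow> real) \<Rightarrow> real \<Rightarrow> 'x \<Rightarrow> real"
  where "mild_solution S \<mu> f g t x =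
    mehler S \<mu> t f x + (LINT s:{0..t}|lborel. mehler S \<mu> (t - s) (g s) x)"

section \<open>Fomin differentiability\<close>

definition fomin_quotient :: "'x::real_normed_vector measure \<Rightarrow> 'x \<Rightarrow> 'x set \<Rightarrow> real \<Rightarrow> real" where
  "fomin_quotient \<mu> v A t = (measure \<mu> ((\<lambda>x. x + t *\<^sub>R v) ` A) - measure \<mu> A) / t"

definition fomin_differentiable :: "'x::real_normed_vector measure \<Rightarrow> 'x \<Rightarrow> bool" where
  "fomin_differentiable \<mu> v \<longleftrightarrow> (\<forall>A\<in>sets borel. \<exists>l. (fomin_quotient \<mu> v A \<longlongrightarrow> l) (at 0))"

text \<open>
  \<open>\<beta>\<close> is the density with respect to \<open>\<mu>\<close> of the signed measure \<open>d\<^sub>v\<mu>\<close>; it is unique \<open>\<mu>\<close>-almost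
  everywhere, so its \<open>L\<^sup>1\<close> norm does not depend on the choice.
\<close>

definition fomin_density :: "'x::real_normed_vector measure \<Rightarrow> 'x \<Rightarrow> ('x \<Rightarrow> real) \<Rightarrow> bool" where
  "fomin_density \<mu> v \<beta> \<longleftrightarrow> integrable \<mu> \<beta> \<and>
    (\<forall>A\<in>sets borel. (fomin_quotient \<mu> v A \<longlongrightarrow> (LINT x:A|\<mu>. \<beta> x)) (at 0))"

locale fomin_mehler_semigroup = mehler_semigroup S \<mu>
  for S :: "real \<Rightarrow> ('x::{banach, second_countable_topology}) \<Rightarrow>\<^sub>L 'x"
    and \<mu> :: "real \<Rightarrow> 'x measure" +
  fixes \<iota> :: "'h::banach \<Rightarrow> 'x"
    and Ht :: "real \<Rightarrow> 'x set"
    and M C \<theta> \<omega> :: real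
  assumes Ht_subspace: "\<And>t. t > 0 \<Longrightarrow> subspace (Ht t)"
    and Ht_nontrivial: "\<And>t. t > 0 \<Longrightarrow> Ht t \<noteq> {0}"
    and Ht_fomin: "\<And>t h. t > 0 \<Longrightarrow> h \<in> Ht t \<Longrightarrow> fomin_differentiable (\<mu> t) h"
    and incl_bounded_linear: "bounded_linear \<iota>"
    and incl_inj: "inj \<iota>"
    and constants_pos: "M > 0" "C > 0" "\<theta> > 0"
    and S_H: "\<And>t h. t > 0 \<Longrightarrow>
      \<exists>h'. \<iota> h' = S t (\<iota> h) \<and> norm h' \<le> M * exp (\<omega> * t) * norm h"
    and S_Ht: "\<And>t h. t > 0 \<Longrightarrow> S t (\<iota> h) \<in> Ht t"
    and density_bound: "\<And>t h. t > 0 \<Longrightarrow>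
      \<exists>\<beta>. fomin_density (\<mu> t) (S t (\<iota> h)) \<beta> \<and>
          (LINT x|\<mu> t. \<bar>\<beta> x\<bar>) \<le> C * exp (\<omega> * t) * t powr (- \<theta>) * norm h"

section \<open>Continuous multilinear forms\<close>

text \<open>
  An element of \<open>\<L>\<^sup>n(H)\<close> is a function of a sequence \<open>h :: nat \<Rightarrow> 'h\<close> that depends on
  \<open>h 0, \<dots>, h (n - 1)\<close> only; continuity is meant for the product topology.  The identification of
  \<open>\<L>\<^sup>n\<^sup>+\<^sup>1(H)\<close> with \<open>\<L>(H, \<L>\<^sup>n(H))\<close> sends \<open>D\<close> to \<open>\<lambda>h u. D (case_nat h u)\<close>, where \<open>case_nat h u\<close>
  is the sequence \<open>h, u 0, u 1, \<dots>\<close>.  The space \<open>\<L>\<^sup>0(H)\<close> is \<open>\<real>\<close> (constant functions) with the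
  absolute value as norm.
\<close>

definition multilinear_forms :: "nat \<Rightarrow> ((nat \<Rightarrow> 'h::real_normed_vector) \<Rightarrow> real) set" where
  "multilinear_forms n = {A.
     (\<forall>h h'. (\<forall>i<n. h i = h' i) \<longrightarrow> A h = A h') \<and>
     (\<forall>h. \<forall>i<n. linear (\<lambda>u. A (h(i := u)))) \<and>
     continuous_on UNIV A}"

definition form_norm :: "nat \<Rightarrow> ((nat \<Rightarrow> 'h::real_normed_vector) \<Rightarrow> real) \<Rightarrow> ennreal" where
  "form_norm n A = (SUP h\<in>{h. \<forall>i<n. h i \<noteq> 0}. ennreal (\<bar>A h\<bar> / (\<Prod>i<n. norm (h i))))"

section \<open>Gateaux derivatives along \<open>H\<close>\<close>

definition has_H_gateaux_derivative ::
  "('h::real_normed_vector \<Rightarrow> 'x::real_normed_vector) \<Rightarrow> nat \<Rightarrow> ('x \<Rightarrow> (nat \<Rightarrow> 'h) \<Rightarrow> real) \<Rightarrow> 'x \<Rightarrow>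
    ((nat \<Rightarrow> 'h) \<Rightarrow> real) \<Rightarrow> bool"
  where "has_H_gateaux_derivative \<iota> n F x D \<longleftrightarrow>
    D \<in> multilinear_forms (Suc n) \<and>
    (\<forall>h. ((\<lambda>t. form_norm n (\<lambda>u. (F (x + t *\<^sub>R \<iota> h) u - F x u) / t - D (case_nat h u))) \<longlongrightarrow> 0) (at 0))"

fun DH :: "('h::real_normed_vector \<Rightarrow> 'x::real_normed_vector) \<Rightarrow> nat \<Rightarrow> ('x \<Rightarrow> real) \<Rightarrow> 'x \<Rightarrow>
    (nat \<Rightarrow> 'h) \<Rightarrow> real"
  where
    "DH \<iota> 0 f x = (\<lambda>_. f x)"
  | "DH \<iota> (Suc n) f x = (THE D. has_H_gateaux_derivative \<iota> n (DH \<iota> n f) x D)"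

definition H_gateaux_differentiable ::
  "('h::real_normed_vector \<Rightarrow> 'x::real_normed_vector) \<Rightarrow> nat \<Rightarrow> ('x \<Rightarrow> real) \<Rightarrow> bool"
  where "H_gateaux_differentiable \<iota> n f \<longleftrightarrow>
    (\<forall>k<n. \<forall>x. \<exists>D. has_H_gateaux_derivative \<iota> k (DH \<iota> k f) x D)"

section \<open>Function spaces on \<open>X\<close>\<close>

text \<open>With \<open>n = 0\<close> this is \<open>C\<^sub>b(X)\<close> with the supremum norm.\<close>

definition CH :: "('h::real_normed_vector \<Rightarrow> 'x::real_normed_vector) \<Rightarrow> nat \<Rightarrow> ('x \<Rightarrow> real) set" where
  "CH \<iota> n = {f \<in> Cb. H_gateaux_differentiable \<iota> n f \<and>
     (\<forall>k\<le>n. \<forall>h. (\<lambda>x. DH \<iota> k f x h) \<in> Cb)}"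

definition CH_norm ::
  "('h::real_normed_vector \<Rightarrow> 'x::real_normed_vector) \<Rightarrow> nat \<Rightarrow> ('x \<Rightarrow> real) \<Rightarrow> ennreal" where
  "CH_norm \<iota> n f = sup_norm f + (\<Sum>k=1..n. SUP x. form_norm k (DH \<iota> k f x))"

definition CHalpha_seminorm ::
  "('h::real_normed_vector \<Rightarrow> 'x::real_normed_vector) \<Rightarrow> real \<Rightarrow> ('x \<Rightarrow> real) \<Rightarrow> ennreal" where
  "CHalpha_seminorm \<iota> \<alpha> f =
     (SUP x. SUP h\<in>-{0}. ennreal (\<bar>f (x + \<iota> h) - f x\<bar> / norm h powr \<alpha>))"

definition CHalpha ::
  "('h::real_normed_vector \<Rightarrow> 'x::real_normed_vector) \<Rightarrow> real \<Rightarrow> ('x \<Rightarrow> real) set" where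
  "CHalpha \<iota> \<alpha> = {f \<in> Cb. CHalpha_seminorm \<iota> \<alpha> f < \<infinity>}"

definition CHalpha_norm ::
  "('h::real_normed_vector \<Rightarrow> 'x::real_normed_vector) \<Rightarrow> real \<Rightarrow> ('x \<Rightarrow> real) \<Rightarrow> ennreal" where
  "CHalpha_norm \<iota> \<alpha> f = sup_norm f + CHalpha_seminorm \<iota> \<alpha> f"

text \<open>The spaces \<open>C\<^sub>b(X; \<L>\<^sup>m(H))\<close> and \<open>Z\<^sup>1\<^sub>H(X, \<L>\<^sup>m(H))\<close>.\<close>

definition Cb_form :: "nat \<Rightarrow> ('x::real_normed_vector \<Rightarrow> (nat \<Rightarrow> 'h::real_normed_vector) \<Rightarrow> real) set" where
  "Cb_form m = {F. (\<forall>x. F x \<in> multilinear_forms m) \<and>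
     (\<forall>x. ((\<lambda>y. form_norm m (\<lambda>u. F y u - F x u)) \<longlongrightarrow> 0) (at x)) \<and>
     (SUP x. form_norm m (F x)) < \<infinity>}"

definition Z1_seminorm ::
  "('h::real_normed_vector \<Rightarrow> 'x::real_normed_vector) \<Rightarrow> nat \<Rightarrow> ('x \<Rightarrow> (nat \<Rightarrow> 'h) \<Rightarrow> real) \<Rightarrow> ennreal"
  where "Z1_seminorm \<iota> m F =
    (SUP x. SUP h\<in>-{0}.
       form_norm m (\<lambda>u. F (x + 2 *\<^sub>R \<iota> h) u - 2 * F (x + \<iota> h) u + F x u) / ennreal (norm h))"

definition Z1 ::
  "('h::real_normed_vector \<Rightarrow> 'x::real_normed_vector) \<Rightarrow> nat \<Rightarrow> ('x \<Rightarrow> (nat \<Rightarrow> 'h) \<Rightarrow> real) set"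
  where "Z1 \<iota> m = {F \<in> Cb_form m. Z1_seminorm \<iota> m F < \<infinity>}"

text \<open>
  Used for \<open>n \<ge> 1\<close>.  For \<open>n = 1\<close> these are \<open>Z\<^sup>1\<^sub>H(X, \<real>)\<close> and its norm, since \<open>\<L>\<^sup>0(H) = \<real>\<close> and
  \<open>D\<^sup>0\<^sub>H f = f\<close>.
\<close>

definition ZH :: "('h::real_normed_vector \<Rightarrow> 'x::real_normed_vector) \<Rightarrow> nat \<Rightarrow> ('x \<Rightarrow> real) set" where
  "ZH \<iota> n = {f \<in> CH \<iota> (n - 1). DH \<iota> (n - 1) f \<in> Z1 \<iota> (n - 1)}"

definition ZH_norm ::
  "('h::real_normed_vector \<Rightarrow> 'x::real_normed_vector) \<Rightarrow> nat \<Rightarrow> ('x \<Rightarrow> real) \<Rightarrow> ennreal" where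
  "ZH_norm \<iota> n f = CH_norm \<iota> (n - 1) f + Z1_seminorm \<iota> (n - 1) (DH \<iota> (n - 1) f)"

section \<open>Function spaces on \<open>[0,T] \<times> X\<close>\<close>

text \<open>
  Functions on \<open>[0,T] \<times> X\<close> are functions on \<open>real \<times> X\<close> (in curried form) of which only the values
  at times in \<open>{0..T}\<close> matter.
\<close>

definition sup_norm_T :: "real \<Rightarrow> (real \<Rightarrow> 'x \<Rightarrow> real) \<Rightarrow> ennreal" where
  "sup_norm_T T g = (SUP t\<in>{0..T}. sup_norm (g t))"

definition Cb_T :: "real \<Rightarrow> (real \<Rightarrow> 'x::topological_space \<Rightarrow> real) set" where
  "Cb_T T = {g. continuous_on ({0..T} \<times> UNIV) (\<lambda>(t, x). g t x) \<and>
     bounded ((\<lambda>(t, x). g t x) ` ({0..T} \<times> UNIV))}"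

definition CHalpha_T_norm ::
  "('h::real_normed_vector \<Rightarrow> 'x::real_normed_vector) \<Rightarrow> real \<Rightarrow> real \<Rightarrow> (real \<Rightarrow> 'x \<Rightarrow> real) \<Rightarrow> ennreal"
  where "CHalpha_T_norm \<iota> T \<alpha> g = (SUP t\<in>{0..T}. CHalpha_norm \<iota> \<alpha> (g t))"

definition CHalpha_T ::
  "('h::real_normed_vector \<Rightarrow> 'x::real_normed_vector) \<Rightarrow> real \<Rightarrow> real \<Rightarrow> (real \<Rightarrow> 'x \<Rightarrow> real) set"
  where "CHalpha_T \<iota> T \<alpha> = {g \<in> Cb_T T.
    (\<forall>t\<in>{0..T}. g t \<in> CHalpha \<iota> \<alpha>) \<and> CHalpha_T_norm \<iota> T \<alpha> g < \<infinity>}"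

text \<open>
  The iterated partial derivative \<open>\<partial>\<^sup>jg/\<partial>h\<^sub>1\<dots>\<partial>h\<^sub>j(t, x)\<close> is \<open>D\<^sup>j\<^sub>H g(t, \<cdot>)(x)(h\<^sub>1, \<dots>, h\<^sub>j)\<close>.
\<close>

definition CH_T ::
  "('h::real_normed_vector \<Rightarrow> 'x::real_normed_vector) \<Rightarrow> real \<Rightarrow> nat \<Rightarrow> (real \<Rightarrow> 'x \<Rightarrow> real) set"
  where "CH_T \<iota> T m = {g \<in> Cb_T T.
    (\<forall>t\<in>{0..T}. g t \<in> CH \<iota> m) \<and>
    (SUP t\<in>{0..T}. CH_norm \<iota> m (g t)) < \<infinity> \<and>
    (\<forall>j\<le>m. \<forall>h. continuous_on ({0..T} \<times> UNIV) (\<lambda>(t, x). DH \<iota> j (g t) x h))}"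

definition ZH_T_norm ::
  "('h::real_normed_vector \<Rightarrow> 'x::real_normed_vector) \<Rightarrow> real \<Rightarrow> nat \<Rightarrow> (real \<Rightarrow> 'x \<Rightarrow> real) \<Rightarrow> ennreal"
  where "ZH_T_norm \<iota> T k g = (SUP t\<in>{0..T}. ZH_norm \<iota> k (g t))"

definition ZH_T ::
  "('h::real_normed_vector \<Rightarrow> 'x::real_normed_vector) \<Rightarrow> real \<Rightarrow> nat \<Rightarrow> (real \<Rightarrow> 'x \<Rightarrow> real) set"
  where "ZH_T \<iota> T k = {g \<in> Cb_T T.
    (\<forall>t\<in>{0..T}. g t \<in> ZH \<iota> k) \<and> ZH_T_norm \<iota> T k g < \<infinity> \<and>
    (k \<ge> 2 \<longrightarrow> g \<in> CH_T \<iota> T (k - 1))}"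

end

(*
  P_t g is differentiated along H by moving the derivative onto the measure (Fomin
  differentiability); halving the time repeatedly gives ||D^n P_t g|| <= c t^(-n theta) ||g||.
  For P_t f with f in Z^k_H nothing is gained or lost.  The time integral of P_(t-s) g(s) can be
  differentiated k - 1 times, because (k - 1) theta < 1.  Its derivative of order k - 1 is in the
  Zygmund class: the second difference with step h is estimated by the derivatives of order k - 1
  for t - s < |h|^(1/theta) and by those of order k + 1 (respectively of order k, if g is
  alpha-Hoelder, using that differences of P_s g are P_s applied to differences of g) for
  t - s > |h|^(1/theta), and both parts are of order |h|.

  Norm continuity of D^n P_t g: X -> L^n(H) is the delicate point, because H is an arbitrary Banach
  space and the densities beta are bounded in L^1 only.  It follows from Landau's inequality: for
  f >= 0 the first derivative of P_t f at a point is small, uniformly over the unit ball of H, if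
  P_t f is small there and the second derivative is bounded.
*)

theory Submission
  imports Defs
begin

section \<open>Iterated directional derivatives\<close>

text \<open>Limits in the norm of L^n(H) do not pass easily through integrals: \<open>H\<close> need
  not be separable, and the densities come separately for each time and direction, without joint
  measurability. The analysis is therefore done with iterated derivatives in fixed directions
  (\<open>dirds\<close>), where dominated convergence suffices. The operator norm enters only
  through bounds uniform over directions (\<open>derivs_bounded\<close>) and through norm continuity
  of the top order (\<open>norm_cont\<close>), which is tested on sequences of points and
  directions. The translation from and to \<open>DH\<close> takes place at the two ends.

  Two obstacles remain. Members of \<open>CH\<close> have derivatives that are bounded for each
  fixed choice of directions, so that finiteness of the norm of f rests on a Baire category argument
  in the Banach space \<open>H\<close>. And the derivatives of v must be jointly continuous in time
  and space, although v is controlled only at each fixed time; here the Zygmund condition itself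
  provides a modulus of continuity that is uniform in time.\<close>

definition dird :: "('h \<Rightarrow> 'x::real_normed_vector) \<Rightarrow> 'h \<Rightarrow> ('x \<Rightarrow> real) \<Rightarrow> 'x \<Rightarrow> real" where
  "dird \<iota> h f x = deriv (\<lambda>r. f (x + r *\<^sub>R \<iota> h)) 0"

text \<open>
  In line with the identification of \<open>\<L>\<^sup>n\<^sup>+\<^sup>1(H)\<close> with \<open>\<L>(H, \<L>\<^sup>n(H))\<close> in \<^const>\<open>DH\<close>, the direction
  \<open>u 0\<close> is the one in which the last derivative is taken.
\<close>

primrec dirds ::
  "('h \<Rightarrow> 'x::real_normed_vector) \<Rightarrow> nat \<Rightarrow> (nat \<Rightarrow> 'h) \<Rightarrow> ('x \<Rightarrow> real) \<Rightarrow> 'x \<Rightarrow> real" where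
  "dirds \<iota> 0 u f = f"
| "dirds \<iota> (Suc n) u f = dirds \<iota> n u (dird \<iota> (u n) f)"

text \<open>Only fixed directions are considered: each iterated derivative is bounded and continuous
  on the whole space, with a bound that may depend on the directions. Uniformity over directions is
  expressed separately by \<open>derivs_bounded\<close> and \<open>norm_cont\<close>.\<close>

primrec smooth_along :: "('h \<Rightarrow> 'x::real_normed_vector) \<Rightarrow> nat \<Rightarrow> ('x \<Rightarrow> real) \<Rightarrow> bool" where
  "smooth_along \<iota> 0 f \<longleftrightarrow> f \<in> Cb"
| "smooth_along \<iota> (Suc n) f \<longleftrightarrow> f \<in> Cb \<and>
     (\<forall>h x. ((\<lambda>r. f (x + r *\<^sub>R \<iota> h)) has_real_derivative dird \<iota> h f x) (at 0)) \<and>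
     (\<forall>h. smooth_along \<iota> n (dird \<iota> h f))"

abbreviation norm_prod :: "nat \<Rightarrow> (nat \<Rightarrow> 'h::real_normed_vector) \<Rightarrow> real" where
  "norm_prod n u \<equiv> \<Prod>i<n. norm (u i)"

text \<open>A bound for the norm in L^n(H), uniform in the point. Multiplying out, instead of
  dividing as in \<open>form_norm\<close>, lets zero directions take part.\<close>

definition derivs_bounded ::
  "('h::real_normed_vector \<Rightarrow> 'x::real_normed_vector) \<Rightarrow> nat \<Rightarrow> ('x \<Rightarrow> real) \<Rightarrow> real \<Rightarrow> bool" where
  "derivs_bounded \<iota> n f B \<longleftrightarrow> (\<forall>u x. \<bar>dirds \<iota> n u f x\<bar> \<le> B * norm_prod n u)"

lemma CbD:
  fixes f :: "'a::t2_space \<Rightarrow> real"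
  assumes "f \<in> Cb"
  shows "continuous_on UNIV f" "isCont f x" "\<exists>B\<ge>0. \<forall>x. \<bar>f x\<bar> \<le> B"
proof -
  show c: "continuous_on UNIV f" using assms by (simp add: Cb_def)
  then show "isCont f x" by (simp add: continuous_on_eq_continuous_at)
  obtain B where "\<And>x. \<bar>f x\<bar> \<le> B"
    using assms by (auto simp: Cb_def bounded_iff)
  then show "\<exists>B\<ge>0. \<forall>x. \<bar>f x\<bar> \<le> B" by (meson abs_ge_zero order_trans)
qed

lemma CbI:
  assumes "continuous_on UNIV f" "\<And>x. \<bar>f x\<bar> \<le> B"
  shows "f \<in> Cb"
  using assms by (auto simp: Cb_def bounded_iff)

lemma CbI_isCont:
  fixes f :: "'a::t2_space \<Rightarrow> real"
  assumes "\<And>x. isCont f x" "\<And>x. \<bar>f x\<bar> \<le> B"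
  shows "f \<in> Cb"
  by (rule CbI[OF _ assms(2)]) (simp add: continuous_at_imp_continuous_on assms(1))

lemma Cb_borel: "f \<in> Cb \<Longrightarrow> f \<in> borel_measurable borel"
  by (rule borel_measurable_continuous_onI) (simp add: Cb_def)

lemma dird_eqI:
  "((\<lambda>r. f (x + r *\<^sub>R \<iota> h)) has_real_derivative D) (at 0) \<Longrightarrow> dird \<iota> h f x = D"
  by (simp add: dird_def DERIV_imp_deriv)

text \<open>The recursion of \<open>dirds\<close> splits off the innermost derivative, which suits
  inductions over \<open>smooth_along\<close>; \<open>DH\<close> splits off the outermost one. This
  lemma mediates between the two.\<close>

lemma dirds_Suc_newest:
  "dirds \<iota> (Suc n) u f = dird \<iota> (u 0) (dirds \<iota> n (\<lambda>i. u (Suc i)) f)"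
  by (induction n arbitrary: f) auto

lemma dirds_Suc_case_nat:
  "dirds \<iota> (Suc n) (case_nat h u) f = dird \<iota> h (dirds \<iota> n u f)"
  by (simp only: dirds_Suc_newest) simp

lemma dirds_cong: "(\<And>i. i < n \<Longrightarrow> u i = u' i) \<Longrightarrow> dirds \<iota> n u f = dirds \<iota> n u' f"
  by (induction n arbitrary: f) auto

lemma smooth_along_Cb: "smooth_along \<iota> n f \<Longrightarrow> f \<in> Cb"
  by (cases n) auto

lemma smooth_along_SucD: "smooth_along \<iota> (Suc n) f \<Longrightarrow> smooth_along \<iota> n f"
  by (induction n arbitrary: f) (auto simp: smooth_along_Cb)

lemma smooth_along_mono: "smooth_along \<iota> n f \<Longrightarrow> m \<le> n \<Longrightarrow> smooth_along \<iota> m f"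
proof (induction n)
  case 0
  then show ?case by simp
next
  case (Suc n)
  then show ?case
    using smooth_along_SucD le_Suc_eq by metis
qed

lemma smooth_along_dirds:
  "smooth_along \<iota> (m + n) f \<Longrightarrow> smooth_along \<iota> m (dirds \<iota> n u f)"
  by (induction n arbitrary: f) auto

lemma dirds_Cb: "smooth_along \<iota> n f \<Longrightarrow> j \<le> n \<Longrightarrow> dirds \<iota> j u f \<in> Cb"
  by (metis smooth_along_mono add_0 smooth_along.simps(1) smooth_along_dirds)

lemma smooth_along_DERIV:
  assumes "smooth_along \<iota> (Suc n) f"
  shows "((\<lambda>r. f (x + r *\<^sub>R \<iota> h)) has_real_derivative dird \<iota> h f (x + r *\<^sub>R \<iota> h)) (at r)"
proof -
  have "((\<lambda>s. f ((x + r *\<^sub>R \<iota> h) + s *\<^sub>R \<iota> h)) has_real_derivative dird \<iota> h f (x + r *\<^sub>R \<iota> h)) (at 0)"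
    using assms by auto
  then have "((\<lambda>s. f (x + (s + r) *\<^sub>R \<iota> h)) has_real_derivative dird \<iota> h f (x + r *\<^sub>R \<iota> h)) (at 0)"
    by (simp add: scaleR_add_left add_ac)
  then show ?thesis
    using DERIV_shift[of "\<lambda>s. f (x + s *\<^sub>R \<iota> h)" "dird \<iota> h f (x + r *\<^sub>R \<iota> h)" 0 r] by simp
qed

lemma dirds_DERIV:
  assumes "smooth_along \<iota> n f" "j < n"
  shows "((\<lambda>r. dirds \<iota> j u f (x + r *\<^sub>R \<iota> h)) has_real_derivative
           dirds \<iota> (Suc j) (case_nat h u) f (x + r *\<^sub>R \<iota> h)) (at r)"
proof -
  have "smooth_along \<iota> (Suc 0 + j) f" using assms by (intro smooth_along_mono[OF assms(1)]) simp
  then have "smooth_along \<iota> (Suc 0) (dirds \<iota> j u f)" by (rule smooth_along_dirds)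
  from smooth_along_DERIV[OF this] show ?thesis by (simp only: dirds_Suc_case_nat)
qed

lemma smooth_alongI:
  assumes "\<And>j u. j \<le> n \<Longrightarrow> dirds \<iota> j u f \<in> Cb"
    and "\<And>j u h x. j < n \<Longrightarrow> ((\<lambda>r. dirds \<iota> j u f (x + r *\<^sub>R \<iota> h)) has_real_derivative
           dird \<iota> h (dirds \<iota> j u f) x) (at 0)"
  shows "smooth_along \<iota> n f"
  using assms
proof (induction n arbitrary: f)
  case 0
  then show ?case using 0(1)[of 0] by simp
next
  case (Suc n)
  \<comment> \<open>\<open>dirds\<close> reads the innermost direction at index \<open>j\<close>, so
    overwriting \<open>u\<close> there makes \<open>h\<close> the first direction of differentiation
    and leaves the other \<open>j\<close> directions alone.\<close>
  have *: "dirds \<iota> j u (dird \<iota> h f) = dirds \<iota> (Suc j) (u(j := h)) f" for j u h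
    using dirds_cong[of j u "u(j := h)" \<iota> "dird \<iota> h f"] by simp
  have "smooth_along \<iota> n (dird \<iota> h f)" for h
  proof (rule Suc.IH)
    fix j u assume "j \<le> n"
    then show "dirds \<iota> j u (dird \<iota> h f) \<in> Cb"
      unfolding * by (intro Suc.prems(1)) simp
  next
    fix j u h' x assume "j < n"
    then show "((\<lambda>r. dirds \<iota> j u (dird \<iota> h f) (x + r *\<^sub>R \<iota> h')) has_real_derivative
        dird \<iota> h' (dirds \<iota> j u (dird \<iota> h f)) x) (at 0)"
      unfolding * by (intro Suc.prems(2)) simp
  qed
  then show ?case
    using Suc.prems(1)[of 0] Suc.prems(2)[of 0] by simp
qed

lemma smooth_along_diff_le:
  assumes "smooth_along \<iota> (Suc n) f" "\<And>r. 0 \<le> r \<Longrightarrow> r \<le> s \<Longrightarrow> \<bar>dird \<iota> h f (x + r *\<^sub>R \<iota> h)\<bar> \<le> B" "s \<ge> 0"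
  shows "\<bar>f (x + s *\<^sub>R \<iota> h) - f x\<bar> \<le> B * s"
proof (cases "s = 0")
  case False
  then have "\<exists>z>0. z < s \<and> f (x + s *\<^sub>R \<iota> h) - f (x + 0 *\<^sub>R \<iota> h) = (s - 0) * dird \<iota> h f (x + z *\<^sub>R \<iota> h)"
    using assms(3) by (intro MVT2[where f="\<lambda>r. f (x + r *\<^sub>R \<iota> h)"]) (auto intro!: smooth_along_DERIV[OF assms(1)])
  then show ?thesis
    using assms(2,3) by (auto simp: abs_mult mult.commute intro!: mult_right_mono)
qed simp

section \<open>Homogeneity and additivity in the direction\<close>

lemma dird_scaleR:
  assumes "bounded_linear \<iota>" "smooth_along \<iota> (Suc n) f"
  shows "dird \<iota> (c *\<^sub>R h) f x = c * dird \<iota> h f x"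
proof (rule dird_eqI)
  interpret bounded_linear \<iota> by fact
  have "((\<lambda>r. f (x + r *\<^sub>R \<iota> h)) has_real_derivative dird \<iota> h f x) (at (c * 0))"
    using assms by auto
  moreover have "((\<lambda>r. c * r) has_real_derivative c) (at 0)"
    by (rule DERIV_cmult_Id)
  ultimately have "((\<lambda>r. f (x + (c * r) *\<^sub>R \<iota> h)) has_real_derivative dird \<iota> h f x * c) (at 0)"
    by (rule DERIV_chain'[where g="\<lambda>r. f (x + r *\<^sub>R \<iota> h)", rotated])
  then show "((\<lambda>r. f (x + r *\<^sub>R \<iota> (c *\<^sub>R h))) has_real_derivative c * dird \<iota> h f x) (at 0)"
    by (simp add: scaleR mult_ac)
qed

lemma mvt_symmetric:
  assumes "\<And>r. (F has_real_derivative D r) (at r)"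
  obtains z where "\<bar>z\<bar> \<le> \<bar>t\<bar>" "F t - F 0 = t * D z"
proof -
  consider "t = 0" | "t > 0" | "t < 0" by linarith
  then show ?thesis
  proof cases
    case 1
    then show ?thesis using that[of 0] by simp
  next
    case 2
    then obtain z where "z > 0" "z < t" "F t - F 0 = (t - 0) * D z"
      using MVT2[of 0 t F D] assms by blast
    then show ?thesis using that[of z] by simp
  next
    case 3
    then obtain z where "z > t" "z < 0" "F 0 - F t = (0 - t) * D z"
      using MVT2[of t 0 F D] assms by blast
    then show ?thesis using that[of z] by (simp add: algebra_simps)
  qed
qed

lemma DERIV_at_0I:
  assumes "((\<lambda>r. (F r - F 0) / r) \<longlongrightarrow> D) (at (0::real))"
  shows "(F has_real_derivative D) (at 0)"
  using assms by (simp add: DERIV_def)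

text \<open>Linearity in the direction need not be required: it follows from the continuity of the derivatives.\<close>

lemma dird_add:
  assumes \<iota>: "bounded_linear \<iota>" and f: "smooth_along \<iota> (Suc n) f"
  shows "dird \<iota> (h + h') f x = dird \<iota> h f x + dird \<iota> h' f x"
proof (rule dird_eqI, rule DERIV_at_0I)
  interpret bounded_linear \<iota> by fact
  \<comment> \<open>A step along \<open>h + h'\<close> is a step along \<open>h\<close> followed by
    one along \<open>h'\<close>. \<open>G r\<close> is the second one; by the mean value theorem it
    is \<open>r\<close> times a derivative along \<open>h'\<close> at a point that tends to
    \<open>x\<close>.\<close>
  define G where "G = (\<lambda>r. f (x + r *\<^sub>R \<iota> h + r *\<^sub>R \<iota> h') - f (x + r *\<^sub>R \<iota> h))"
  have c: "isCont (dird \<iota> h' f) y" for y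
    using f smooth_along_Cb[of \<iota> n "dird \<iota> h' f"] by (auto dest: CbD(2))
  have "\<exists>z. \<bar>z\<bar> \<le> \<bar>r\<bar> \<and> G r = r * dird \<iota> h' f (x + r *\<^sub>R \<iota> h + z *\<^sub>R \<iota> h')" for r
  proof -
    obtain z where "\<bar>z\<bar> \<le> \<bar>r\<bar>"
      "f (x + r *\<^sub>R \<iota> h + r *\<^sub>R \<iota> h') - f (x + r *\<^sub>R \<iota> h + 0 *\<^sub>R \<iota> h') =
        r * dird \<iota> h' f (x + r *\<^sub>R \<iota> h + z *\<^sub>R \<iota> h')"
      by (rule mvt_symmetric[OF smooth_along_DERIV[OF f, of "x + r *\<^sub>R \<iota> h" h']])
    then show ?thesis by (intro exI[of _ z]) (simp add: G_def)
  qed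
  then obtain z where z: "\<And>r. \<bar>z r\<bar> \<le> \<bar>r\<bar>" "\<And>r. G r = r * dird \<iota> h' f (x + r *\<^sub>R \<iota> h + z r *\<^sub>R \<iota> h')"
    by metis
  have z0: "(z \<longlongrightarrow> 0) (at 0)"
    by (rule Lim_null_comparison[where g="\<lambda>r. \<bar>r\<bar>"]) (auto simp: z intro!: tendsto_eq_intros)
  have "((\<lambda>r. x + r *\<^sub>R \<iota> h + z r *\<^sub>R \<iota> h') \<longlongrightarrow> x + 0 *\<^sub>R \<iota> h + 0 *\<^sub>R \<iota> h') (at 0)"
    by (intro tendsto_intros z0)
  then have "((\<lambda>r. dird \<iota> h' f (x + r *\<^sub>R \<iota> h + z r *\<^sub>R \<iota> h')) \<longlongrightarrow> dird \<iota> h' f x) (at 0)"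
    using isCont_tendsto_compose[OF c] by simp
  moreover have "((\<lambda>r. (f (x + r *\<^sub>R \<iota> h) - f x) / r) \<longlongrightarrow> dird \<iota> h f x) (at 0)"
    using f by (auto simp: DERIV_def)
  ultimately have "((\<lambda>r. (f (x + r *\<^sub>R \<iota> h) - f x) / r + dird \<iota> h' f (x + r *\<^sub>R \<iota> h + z r *\<^sub>R \<iota> h'))
      \<longlongrightarrow> dird \<iota> h f x + dird \<iota> h' f x) (at 0)"
    by (intro tendsto_intros)
  then show "((\<lambda>r. (f (x + r *\<^sub>R \<iota> (h + h')) - f (x + 0 *\<^sub>R \<iota> (h + h'))) / r) \<longlongrightarrow>
      dird \<iota> h f x + dird \<iota> h' f x) (at 0)"
  proof (rule Lim_transform_eventually)
    show "\<forall>\<^sub>F r in at 0. (f (x + r *\<^sub>R \<iota> h) - f x) / r + dird \<iota> h' f (x + r *\<^sub>R \<iota> h + z r *\<^sub>R \<iota> h') =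
       (f (x + r *\<^sub>R \<iota> (h + h')) - f (x + 0 *\<^sub>R \<iota> (h + h'))) / r"
    proof (rule eventually_at_topological[THEN iffD2], intro exI conjI ballI impI)
      fix r :: real assume "r \<noteq> 0"
      then have "dird \<iota> h' f (x + r *\<^sub>R \<iota> h + z r *\<^sub>R \<iota> h') = G r / r" by (simp add: z(2))
      then show "(f (x + r *\<^sub>R \<iota> h) - f x) / r + dird \<iota> h' f (x + r *\<^sub>R \<iota> h + z r *\<^sub>R \<iota> h') =
         (f (x + r *\<^sub>R \<iota> (h + h')) - f (x + 0 *\<^sub>R \<iota> (h + h'))) / r"
        by (simp add: G_def add scaleR_add_right add_divide_distrib[symmetric] add_ac)
    qed (rule open_UNIV, simp)
  qed
qed

section \<open>Linear combinations, affine substitutions and translates\<close>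

lemma Cb_linear:
  fixes f :: "'a::t2_space \<Rightarrow> real"
  shows "f \<in> Cb \<Longrightarrow> g \<in> Cb \<Longrightarrow> (\<lambda>x. a * f x + b * g x) \<in> Cb"
proof -
  assume f: "f \<in> Cb" and g: "g \<in> Cb"
  obtain B where B: "\<And>x. \<bar>f x\<bar> \<le> B" using CbD(3)[OF f] by auto
  obtain B' where B': "\<And>x. \<bar>g x\<bar> \<le> B'" using CbD(3)[OF g] by auto
  have "\<bar>a * f x + b * g x\<bar> \<le> \<bar>a\<bar> * B + \<bar>b\<bar> * B'" for x
    by (rule order_trans[OF abs_triangle_ineq]) (auto simp: abs_mult intro!: add_mono mult_left_mono B B')
  moreover have "continuous_on UNIV (\<lambda>x. a * f x + b * g x)"
    by (intro continuous_on_add continuous_on_mult_left CbD(1) f g)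
  ultimately show ?thesis by (intro CbI)
qed

lemma smooth_along_linear:
  assumes "smooth_along \<iota> n f" "smooth_along \<iota> n g"
  shows "smooth_along \<iota> n (\<lambda>x. a * f x + b * g x)"
    and "j \<le> n \<Longrightarrow> dirds \<iota> j u (\<lambda>x. a * f x + b * g x) = (\<lambda>x. a * dirds \<iota> j u f x + b * dirds \<iota> j u g x)"
proof -
  have d: "((\<lambda>r. a * f (x + r *\<^sub>R \<iota> h) + b * g (x + r *\<^sub>R \<iota> h)) has_real_derivative
      a * dird \<iota> h f x + b * dird \<iota> h g x) (at 0)"
    if "smooth_along \<iota> (Suc m) f" "smooth_along \<iota> (Suc m) g" for m f g x h
    using DERIV_add[OF DERIV_cmult[OF smooth_along_DERIV[OF that(1), of x h 0], of a]
        DERIV_cmult[OF smooth_along_DERIV[OF that(2), of x h 0], of b]]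
    by (simp only: scaleR_zero_left add_0_right)
  have e: "dird \<iota> h (\<lambda>x. a * f x + b * g x) = (\<lambda>x. a * dird \<iota> h f x + b * dird \<iota> h g x)"
    if "smooth_along \<iota> (Suc m) f" "smooth_along \<iota> (Suc m) g" for m f g h
    by (rule ext, rule dird_eqI, rule d[OF that])
  show "smooth_along \<iota> n (\<lambda>x. a * f x + b * g x)"
    using assms
  proof (induction n arbitrary: f g)
    case 0
    then show ?case by (simp add: Cb_linear)
  next
    case (Suc n)
    have "smooth_along \<iota> n (\<lambda>x. a * dird \<iota> h f x + b * dird \<iota> h g x)" for h
      by (rule Suc.IH) (use Suc.prems in auto)
    then show ?case
      unfolding smooth_along.simps e[OF Suc.prems]
      by (intro conjI allI d[OF Suc.prems] Cb_linear smooth_along_Cb[OF Suc.prems(1)]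
          smooth_along_Cb[OF Suc.prems(2)])
  qed
  show "j \<le> n \<Longrightarrow> dirds \<iota> j u (\<lambda>x. a * f x + b * g x) = (\<lambda>x. a * dirds \<iota> j u f x + b * dirds \<iota> j u g x)"
    using assms
  proof (induction j arbitrary: f g n)
    case (Suc j)
    then obtain m where m: "n = Suc m" by (cases n) auto
    have s: "smooth_along \<iota> (Suc m) f" "smooth_along \<iota> (Suc m) g" using Suc.prems m by auto
    have "dirds \<iota> j u (\<lambda>x. a * dird \<iota> (u j) f x + b * dird \<iota> (u j) g x) =
        (\<lambda>x. a * dirds \<iota> j u (dird \<iota> (u j) f) x + b * dirds \<iota> j u (dird \<iota> (u j) g) x)"
      by (rule Suc.IH[of m]) (use Suc.prems(1) m s in auto)
    then show ?case by (simp only: dirds.simps e[OF s])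
  qed simp
qed

text \<open>The chain rule when the linear part \<open>A\<close> carries the direction
  \<open>\<kappa> h\<close> to the direction \<open>\<iota> (L h)\<close>. It is used with
  \<open>A = S t\<close> and its restriction to \<open>H\<close>, with the identity for translates,
  and at order 0 for mere continuity.\<close>

lemma smooth_along_affine:
  fixes A :: "'y::real_normed_vector \<Rightarrow> 'x::real_normed_vector"
  assumes f: "smooth_along \<iota> n f" and A: "bounded_linear A" and AL: "\<And>h. A (\<kappa> h) = \<iota> (L h)"
  shows "smooth_along \<kappa> n (\<lambda>x. f (A x + z))"
    and "j \<le> n \<Longrightarrow> dirds \<kappa> j u (\<lambda>x. f (A x + z)) = (\<lambda>x. dirds \<iota> j (\<lambda>i. L (u i)) f (A x + z))"
proof -
  interpret bounded_linear A by fact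
  have c: "(\<lambda>x. f (A x + z)) \<in> Cb" if "f \<in> Cb" for f
  proof -
    have "continuous_on UNIV (\<lambda>x. A x + z)" by (intro continuous_intros continuous_on)
    then have "continuous_on UNIV (\<lambda>x. f (A x + z))"
      by (rule continuous_on_compose2[OF CbD(1)[OF that]]) simp
    then show ?thesis using that by (auto simp: Cb_def bounded_iff)
  qed
  have d: "((\<lambda>r. f (A (x + r *\<^sub>R \<kappa> h) + z)) has_real_derivative dird \<iota> (L h) f (A x + z)) (at 0)"
    if "smooth_along \<iota> (Suc m) f" for m f x h
  proof -
    have "((\<lambda>r. f ((A x + z) + r *\<^sub>R \<iota> (L h))) has_real_derivative dird \<iota> (L h) f (A x + z)) (at 0)"
      using that by auto
    then show ?thesis by (simp add: add scaleR AL add_ac)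
  qed
  have e: "dird \<kappa> h (\<lambda>x. f (A x + z)) = (\<lambda>x. dird \<iota> (L h) f (A x + z))"
    if "smooth_along \<iota> (Suc m) f" for m f h
    by (rule ext, rule dird_eqI, rule d[OF that])
  show "smooth_along \<kappa> n (\<lambda>x. f (A x + z))"
    using f
  proof (induction n arbitrary: f)
    case 0
    then show ?case by (simp add: c)
  next
    case (Suc n)
    have "smooth_along \<kappa> n (\<lambda>x. dird \<iota> (L h) f (A x + z))" for h
      by (rule Suc.IH) (use Suc.prems in auto)
    then show ?case
      unfolding smooth_along.simps e[OF Suc.prems]
      by (intro conjI allI d[OF Suc.prems] c smooth_along_Cb[OF Suc.prems])
  qed
  show "j \<le> n \<Longrightarrow> dirds \<kappa> j u (\<lambda>x. f (A x + z)) = (\<lambda>x. dirds \<iota> j (\<lambda>i. L (u i)) f (A x + z))"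
    using f
  proof (induction j arbitrary: f n)
    case (Suc j)
    then obtain m where m: "n = Suc m" by (cases n) auto
    have s: "smooth_along \<iota> (Suc m) f" using Suc.prems m by auto
    have "dirds \<kappa> j u (\<lambda>x. dird \<iota> (L (u j)) f (A x + z)) =
        (\<lambda>x. dirds \<iota> j (\<lambda>i. L (u i)) (dird \<iota> (L (u j)) f) (A x + z))"
      by (rule Suc.IH[of m]) (use Suc.prems(1) m s in auto)
    then show ?case by (simp only: dirds.simps e[OF s])
  qed simp
qed

lemma smooth_along_shift:
  assumes "smooth_along \<iota> n f"
  shows "smooth_along \<iota> n (\<lambda>x. f (x + z))"
    and "j \<le> n \<Longrightarrow> dirds \<iota> j u (\<lambda>x. f (x + z)) = (\<lambda>x. dirds \<iota> j u f (x + z))"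
  using smooth_along_affine[OF assms bounded_linear_ident, of \<iota> id] by auto

lemma smooth_along_diff:
  assumes "smooth_along \<iota> n f"
  shows "smooth_along \<iota> n (\<lambda>x. f (x + z) - f x)"
    and "j \<le> n \<Longrightarrow> dirds \<iota> j u (\<lambda>x. f (x + z) - f x) = (\<lambda>x. dirds \<iota> j u f (x + z) - dirds \<iota> j u f x)"
  using smooth_along_linear[OF smooth_along_shift(1)[OF assms] assms, where a=1 and b="-1"]
    smooth_along_shift(2)[OF assms] by auto

lemma derivs_bounded_nonneg_const:
  assumes "derivs_bounded \<iota> n f B" "B \<le> B'"
  shows "derivs_bounded \<iota> n f B'"
  using assms unfolding derivs_bounded_def
  by (meson mult_right_mono order_trans prod_nonneg norm_ge_zero)

lemma derivs_bounded_diff: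
  assumes "smooth_along \<iota> n f" "derivs_bounded \<iota> n f B"
  shows "derivs_bounded \<iota> n (\<lambda>x. f (x + z) - f x) (2 * B)"
  unfolding derivs_bounded_def smooth_along_diff(2)[OF assms(1) order_refl]
proof (intro allI)
  fix u x
  have "\<bar>dirds \<iota> n u f y\<bar> \<le> B * norm_prod n u" for y
    using assms(2) by (auto simp: derivs_bounded_def)
  from this[of x] this[of "x + z"]
  show "\<bar>dirds \<iota> n u f (x + z) - dirds \<iota> n u f x\<bar> \<le> 2 * B * norm_prod n u" by argo
qed

lemma prod_case_nat: "(\<Prod>i<Suc n. norm (case_nat h u i)) = norm h * norm_prod n u"
  by (simp only: prod.lessThan_Suc_shift) simp

lemma dirds_diff_le:
  assumes "smooth_along \<iota> (Suc n) f" "derivs_bounded \<iota> (Suc n) f B" "s \<ge> 0"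
  shows "\<bar>dirds \<iota> n u f (x + s *\<^sub>R \<iota> h) - dirds \<iota> n u f x\<bar> \<le> B * (norm h * norm_prod n u) * s"
proof (rule smooth_along_diff_le[where n=0 and f="dirds \<iota> n u f" and \<iota>=\<iota> and h=h])
  show "smooth_along \<iota> (Suc 0) (dirds \<iota> n u f)"
    by (rule smooth_along_dirds) (use assms in simp)
  fix r
  show "\<bar>dird \<iota> h (dirds \<iota> n u f) (x + r *\<^sub>R \<iota> h)\<bar> \<le> B * (norm h * norm_prod n u)"
    using assms(2) unfolding derivs_bounded_def dirds_Suc_case_nat[symmetric] prod_case_nat[symmetric]
    by blast
qed fact

lemma derivs_bounded_diff_Suc:
  assumes "smooth_along \<iota> (Suc n) f" "derivs_bounded \<iota> (Suc n) f B"
  shows "derivs_bounded \<iota> n (\<lambda>x. f (x + \<iota> h) - f x) (B * norm h)"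
  unfolding derivs_bounded_def smooth_along_diff(2)[OF smooth_along_SucD[OF assms(1)] order_refl]
  using dirds_diff_le[OF assms, of 1] by (auto simp: mult_ac)

section \<open>Integrals of families of smooth functions\<close>

text \<open>Continuity at \<open>x\<close> of the derivative of order \<open>n\<close> in the norm
  of L^n(H). It is asked of the highest order only: below it, continuity along lines in
  \<open>H\<close> is what matters, and the bound on the next derivative gives that.\<close>

definition norm_cont ::
  "('h::real_normed_vector \<Rightarrow> 'x::real_normed_vector) \<Rightarrow> nat \<Rightarrow> ('x \<Rightarrow> real) \<Rightarrow> 'x \<Rightarrow> bool" where
  "norm_cont \<iota> n f x \<longleftrightarrow> (\<forall>e>0. \<forall>\<^sub>F y in nhds x. \<forall>u.
     \<bar>dirds \<iota> n u f y - dirds \<iota> n u f x\<bar> \<le> e * norm_prod n u)"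

lemma dirds_scaleR:
  assumes \<iota>: "bounded_linear \<iota>" and f: "smooth_along \<iota> n f"
  shows "dirds \<iota> n (\<lambda>i. c i *\<^sub>R u i) f x = (\<Prod>i<n. c i) * dirds \<iota> n u f x"
  using f
proof (induction n arbitrary: f)
  case (Suc n)
  have s: "smooth_along \<iota> n (dird \<iota> (u n) f)" using Suc.prems by simp
  have "dird \<iota> (c n *\<^sub>R u n) f = (\<lambda>x. c n * dird \<iota> (u n) f x + 0 * dird \<iota> (u n) f x)"
    using dird_scaleR[OF \<iota> Suc.prems] by auto
  moreover have "smooth_along \<iota> n (\<lambda>x. c n * dird \<iota> (u n) f x + 0 * dird \<iota> (u n) f x)"
    by (rule smooth_along_linear[OF s s])
  ultimately show ?case
    using Suc.IH[of "\<lambda>x. c n * dird \<iota> (u n) f x + 0 * dird \<iota> (u n) f x"]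
      smooth_along_linear(2)[OF s s order_refl, of u "c n" 0]
    by (simp del: add_0_right)
qed simp

lemma homogeneous_bound:
  fixes Q :: "(nat \<Rightarrow> 'h::real_normed_vector) \<Rightarrow> real"
  assumes "\<And>c u. Q (\<lambda>i. c i *\<^sub>R u i) = (\<Prod>i<n. c i) * Q u"
    and "\<And>u. (\<And>i. norm (u i) \<le> 1) \<Longrightarrow> \<bar>Q u\<bar> \<le> e"
  shows "\<bar>Q u\<bar> \<le> e * norm_prod n u"
proof -
  \<comment> \<open>With \<open>inverse 0 = 0\<close> a zero direction stays zero, so
    \<open>u i = norm (u i) *\<^sub>R v i\<close> holds for every \<open>i\<close>.\<close>
  define v where "v = (\<lambda>i. inverse (norm (u i)) *\<^sub>R u i)"
  have v: "norm (v i) \<le> 1" for i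
    by (cases "u i = 0") (auto simp: v_def)
  have "norm (u i) *\<^sub>R v i = u i" for i by (cases "u i = 0") (auto simp: v_def)
  then have "u = (\<lambda>i. norm (u i) *\<^sub>R v i)" by simp
  then have "Q u = norm_prod n u * Q v" using assms(1) by metis
  then have "\<bar>Q u\<bar> = norm_prod n u * \<bar>Q v\<bar>"
    by (simp add: abs_mult abs_of_nonneg prod_nonneg)
  also have "\<dots> \<le> norm_prod n u * e"
    by (intro mult_left_mono assms(2) v prod_nonneg) auto
  finally show ?thesis by (simp add: mult.commute)
qed

lemma prod_norm_le: "(\<And>i. norm (u i) \<le> R) \<Longrightarrow> norm_prod n u \<le> R ^ n"
  using prod_mono[of "{..<n}" "\<lambda>i. norm (u i)" "\<lambda>_. R"] by simp

text \<open>The directions may change along the sequence; a common bound \<open>R\<close> is enough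
  because the estimate in \<open>norm_cont\<close> is uniform over directions.\<close>

lemma norm_cont_sequentially:
  assumes "norm_cont \<iota> n f x" "X \<longlonglongrightarrow> x" "\<And>m i. norm (U m i) \<le> R"
  shows "(\<lambda>m. dirds \<iota> n (U m) f (X m) - dirds \<iota> n (U m) f x) \<longlonglongrightarrow> 0"
proof (rule LIMSEQ_I)
  fix r :: real assume "r > 0"
  have R: "R \<ge> 0" using assms(3)[of 0 0] norm_ge_zero order_trans by blast
  define e where "e = r / (2 * (R ^ n + 1))"
  have "R ^ n \<ge> 0" using R by simp
  then have e: "e > 0" "e * R ^ n < r"
    using \<open>r > 0\<close> by (auto simp: e_def field_simps add_pos_nonneg)
  have "\<forall>\<^sub>F y in nhds x. \<forall>u. \<bar>dirds \<iota> n u f y - dirds \<iota> n u f x\<bar> \<le> e * norm_prod n u"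
    using assms(1) e(1) unfolding norm_cont_def by blast
  from eventually_compose_filterlim[OF this assms(2)]
  have "\<forall>\<^sub>F m in sequentially. \<forall>u. \<bar>dirds \<iota> n u f (X m) - dirds \<iota> n u f x\<bar> \<le> e * norm_prod n u" .
  then show "\<exists>N. \<forall>m\<ge>N. norm (dirds \<iota> n (U m) f (X m) - dirds \<iota> n (U m) f x - 0) < r"
    unfolding eventually_sequentially
  proof (elim exE, intro exI allI impI)
    fix N m assume N: "\<forall>m\<ge>N. \<forall>u. \<bar>dirds \<iota> n u f (X m) - dirds \<iota> n u f x\<bar> \<le> e * norm_prod n u" "N \<le> m"
    then have "\<bar>dirds \<iota> n (U m) f (X m) - dirds \<iota> n (U m) f x\<bar> \<le> e * (\<Prod>i<n. norm (U m i))" by blast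
    also have "\<dots> \<le> e * R ^ n"
      by (intro mult_left_mono prod_norm_le assms(3)) (use e in auto)
    finally show "norm (dirds \<iota> n (U m) f (X m) - dirds \<iota> n (U m) f x - 0) < r" using e by simp
  qed
qed

text \<open>A failure of uniformity over the unit ball is witnessed by one bad direction for each
  index. Passing to sequences thus replaces a supremum over an uncountable set by countably many
  directions, which makes dominated convergence available.\<close>

lemma norm_contI_sequentially:
  assumes \<iota>: "bounded_linear \<iota>" and f: "smooth_along \<iota> n f"
    and lim: "\<And>X U. X \<longlonglongrightarrow> x \<Longrightarrow> (\<And>m i. norm (U m i) \<le> 1) \<Longrightarrow>
      (\<lambda>m. dirds \<iota> n (U m) f (X m) - dirds \<iota> n (U m) f x) \<longlonglongrightarrow> 0"
  shows "norm_cont \<iota> n f x"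
  unfolding norm_cont_def eventually_nhds_iff_sequentially
proof (intro allI impI)
  fix e :: real and X assume e: "e > 0" and X: "X \<longlonglongrightarrow> x"
  define bad where "bad = (\<lambda>m u. (\<forall>i. norm (u i) \<le> 1) \<and> \<bar>dirds \<iota> n u f (X m) - dirds \<iota> n u f x\<bar> > e)"
  \<comment> \<open>Where no bad direction exists the zero sequence is taken, which keeps
    \<open>U\<close> in the unit ball.\<close>
  define U where "U = (\<lambda>m. if \<exists>u. bad m u then SOME u. bad m u else (\<lambda>_. 0))"
  have U: "bad m u \<Longrightarrow> bad m (U m)" for m u
    unfolding U_def using someI[of "bad m" u] by auto
  have "norm (U m i) \<le> 1" for m i
    using U[of m] by (cases "\<exists>u. bad m u") (auto simp: bad_def U_def)
  from order_tendstoD(2)[OF tendsto_rabs_zero[OF lim[OF X this]] e]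
  show "\<forall>\<^sub>F m in sequentially. \<forall>u. \<bar>dirds \<iota> n u f (X m) - dirds \<iota> n u f x\<bar> \<le> e * norm_prod n u"
  proof (rule eventually_mono, intro allI)
    fix m u assume "\<bar>dirds \<iota> n (U m) f (X m) - dirds \<iota> n (U m) f x\<bar> < e"
    then have "\<not> bad m u" for u using U[of m u] by (auto simp: bad_def)
    then have "\<bar>dirds \<iota> n u f (X m) - dirds \<iota> n u f x\<bar> \<le> e" if "\<And>i. norm (u i) \<le> 1" for u
      using \<open>\<And>u. \<not> bad m u\<close>[of u] that by (auto simp: bad_def not_less)
    then show "\<bar>dirds \<iota> n u f (X m) - dirds \<iota> n u f x\<bar> \<le> e * norm_prod n u"
      by (intro homogeneous_bound[where Q="\<lambda>u. dirds \<iota> n u f (X m) - dirds \<iota> n u f x"])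
        (auto simp: dirds_scaleR[OF \<iota> f] right_diff_distrib)
  qed
qed

section \<open>Differentiation under the integral sign\<close>

lemma integrable_real_bound:
  fixes f c :: "'s \<Rightarrow> real"
  assumes "f \<in> borel_measurable m" "integrable m c" "\<And>s. \<bar>f s\<bar> \<le> c s"
  shows "integrable m f" "\<bar>LINT s|m. f s\<bar> \<le> (LINT s|m. c s)"
proof -
  have c: "norm (f s) \<le> norm (c s)" for s using assms(3)[of s] by simp
  show i: "integrable m f"
    by (rule Bochner_Integration.integrable_bound[OF assms(2,1)]) (intro AE_I2 c)
  show "\<bar>LINT s|m. f s\<bar> \<le> (LINT s|m. c s)"
    by (rule order_trans[OF integral_abs_bound integral_mono[OF integrable_abs[OF i] assms(2,3)]])
qed

lemma Cb_integral:
  fixes \<Phi> :: "'s \<Rightarrow> 'x::real_normed_vector \<Rightarrow> real"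
  assumes cont: "\<And>s. \<Phi> s \<in> Cb" and meas: "\<And>x. (\<lambda>s. \<Phi> s x) \<in> borel_measurable m"
    and c: "integrable m c" "\<And>s x. \<bar>\<Phi> s x\<bar> \<le> c s"
  shows "(\<lambda>x. LINT s|m. \<Phi> s x) \<in> Cb"
proof (rule CbI_isCont)
  show "isCont (\<lambda>x. LINT s|m. \<Phi> s x) x" for x
    unfolding continuous_at_sequentially comp_def
  proof (intro allI impI)
    fix X assume X: "X \<longlonglongrightarrow> x"
    show "(\<lambda>n. LINT s|m. \<Phi> s (X n)) \<longlonglongrightarrow> (LINT s|m. \<Phi> s x)"
    proof (rule integral_dominated_convergence[where w=c])
      show "AE s in m. (\<lambda>n. \<Phi> s (X n)) \<longlonglongrightarrow> \<Phi> s x"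
        by (intro AE_I2 isCont_tendsto_compose[OF CbD(2)[OF cont] X])
    qed (use c meas in simp_all)
  qed
  show "\<bar>LINT s|m. \<Phi> s x\<bar> \<le> (LINT s|m. c s)" for x
    by (rule integrable_real_bound(2)[OF meas c])
qed

text \<open>Measurability in \<open>s\<close> of the derivative comes for free, as a limit of
  difference quotients with the steps \<open>inverse (real (Suc i))\<close>. The mean value theorem
  bounds all difference quotients by \<open>c s\<close>, so that dominated convergence
  applies.\<close>

lemma dird_integral:
  fixes \<Phi> :: "'s \<Rightarrow> 'x::real_normed_vector \<Rightarrow> real"
  assumes sm: "\<And>s. smooth_along \<iota> (Suc n) (\<Phi> s)"
    and int: "\<And>x. integrable m (\<lambda>s. \<Phi> s x)"
    and c: "integrable m c" "\<And>s x. \<bar>dird \<iota> h (\<Phi> s) x\<bar> \<le> c s"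
  shows "(\<lambda>s. dird \<iota> h (\<Phi> s) x) \<in> borel_measurable m"
    and "((\<lambda>r. LINT s|m. \<Phi> s (x + r *\<^sub>R \<iota> h)) has_real_derivative (LINT s|m. dird \<iota> h (\<Phi> s) x)) (at 0)"
proof -
  have lim: "(\<lambda>k. (\<Phi> s (x + R k *\<^sub>R \<iota> h) - \<Phi> s x) / R k) \<longlonglongrightarrow> dird \<iota> h (\<Phi> s) x"
    if "R \<longlonglongrightarrow> 0" "\<And>k. R k \<noteq> 0" for s R x
  proof -
    have "((\<lambda>r. (\<Phi> s (x + r *\<^sub>R \<iota> h) - \<Phi> s x) / r) \<longlongrightarrow> dird \<iota> h (\<Phi> s) x) (at 0)"
      using sm by (auto simp: DERIV_def)
    from this[unfolded tendsto_at_iff_sequentially, rule_format, of R] that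
    show ?thesis by (auto simp: comp_def)
  qed
  show meas: "(\<lambda>s. dird \<iota> h (\<Phi> s) x) \<in> borel_measurable m" for x
  proof (rule borel_measurable_LIMSEQ_real[OF lim[OF LIMSEQ_inverse_real_of_nat]])
    show "(\<lambda>s. (\<Phi> s (x + inverse (real (Suc i)) *\<^sub>R \<iota> h) - \<Phi> s x) / inverse (real (Suc i))) \<in> borel_measurable m" for i
      by (intro borel_measurable_divide borel_measurable_diff borel_measurable_integrable int borel_measurable_const)
  qed simp
  show "((\<lambda>r. LINT s|m. \<Phi> s (x + r *\<^sub>R \<iota> h)) has_real_derivative (LINT s|m. dird \<iota> h (\<Phi> s) x)) (at 0)"
  proof (rule DERIV_at_0I, unfold tendsto_at_iff_sequentially comp_def, intro allI impI)
    fix R :: "nat \<Rightarrow> real" assume "\<forall>i. R i \<in> UNIV - {0}" and R0: "R \<longlonglongrightarrow> 0"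
    then have R: "R k \<noteq> 0" for k by auto
    have "(\<lambda>k. LINT s|m. (\<Phi> s (x + R k *\<^sub>R \<iota> h) - \<Phi> s x) / R k) \<longlonglongrightarrow> (LINT s|m. dird \<iota> h (\<Phi> s) x)"
    proof (rule integral_dominated_convergence[where w=c])
      have "\<bar>(\<Phi> s (x + r *\<^sub>R \<iota> h) - \<Phi> s x) / r\<bar> \<le> c s" if "r \<noteq> 0" for s r
      proof -
        have le: "\<bar>\<Phi> s (x + r *\<^sub>R \<iota> h) - \<Phi> s x\<bar> \<le> c s * r" if "r \<ge> 0" for x r
          by (rule smooth_along_diff_le[OF sm c(2) that])
        have "\<bar>\<Phi> s (x + r *\<^sub>R \<iota> h) - \<Phi> s x\<bar> \<le> c s * \<bar>r\<bar>"
          using le[of r x] le[of "-r" "x + r *\<^sub>R \<iota> h"] by (cases "r \<ge> 0") (auto simp: abs_minus_commute)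
        then show ?thesis using that by (simp add: field_simps)
      qed
      then show "AE s in m. norm ((\<Phi> s (x + R k *\<^sub>R \<iota> h) - \<Phi> s x) / R k) \<le> c s" for k using R by auto
    qed (use c int meas lim[OF R0 R] in auto)
    then show "(\<lambda>k. ((LINT s|m. \<Phi> s (x + R k *\<^sub>R \<iota> h)) - (LINT s|m. \<Phi> s (x + 0 *\<^sub>R \<iota> h))) / R k)
      \<longlonglongrightarrow> (LINT s|m. dird \<iota> h (\<Phi> s) x)"
      by (simp add: int)
  qed
qed

text \<open>The dominating function may depend on the directions, so domination can be checked for
  one tuple at a time. The induction takes the innermost derivative under the integral
  first.\<close>

lemma smooth_along_integral:
  fixes \<Phi> :: "'s \<Rightarrow> 'x::real_normed_vector \<Rightarrow> real"
  assumes sm: "\<And>s. smooth_along \<iota> n (\<Phi> s)"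
    and meas: "\<And>x. (\<lambda>s. \<Phi> s x) \<in> borel_measurable m"
    and dom: "\<And>j u. j \<le> n \<Longrightarrow> \<exists>c. integrable m c \<and> (\<forall>s x. \<bar>dirds \<iota> j u (\<Phi> s) x\<bar> \<le> c s)"
  shows "smooth_along \<iota> n (\<lambda>x. LINT s|m. \<Phi> s x)"
    and "j \<le> n \<Longrightarrow> dirds \<iota> j u (\<lambda>x. LINT s|m. \<Phi> s x) = (\<lambda>x. LINT s|m. dirds \<iota> j u (\<Phi> s) x)"
    and "j \<le> n \<Longrightarrow> integrable m (\<lambda>s. dirds \<iota> j u (\<Phi> s) x)"
proof -
  have "smooth_along \<iota> n (\<lambda>x. LINT s|m. \<Phi> s x) \<and>
    (\<forall>j\<le>n. \<forall>u x. dirds \<iota> j u (\<lambda>x. LINT s|m. \<Phi> s x) = (\<lambda>x. LINT s|m. dirds \<iota> j u (\<Phi> s) x) \<and>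
      integrable m (\<lambda>s. dirds \<iota> j u (\<Phi> s) x))"
    using assms
  proof (induction n arbitrary: \<Phi>)
    case 0
    obtain c where c: "integrable m c" "\<And>s x. \<bar>\<Phi> s x\<bar> \<le> c s" using 0(3)[of 0] by auto
    show ?case
      using Cb_integral[OF 0(1)[simplified] 0(2) c] integrable_real_bound(1)[OF 0(2) c] by simp
  next
    case (Suc n)
    obtain c where c: "integrable m c" "\<And>s x. \<bar>\<Phi> s x\<bar> \<le> c s" using Suc.prems(3)[of 0] by auto
    have int: "integrable m (\<lambda>s. \<Phi> s x)" for x
      by (rule integrable_real_bound(1)[OF Suc.prems(2) c])
    have d: "\<exists>c. integrable m c \<and> (\<forall>s x. \<bar>dirds \<iota> j u (dird \<iota> h (\<Phi> s)) x\<bar> \<le> c s)" if "j \<le> n" for j u h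
    proof -
      have "dirds \<iota> (Suc j) (u(j := h)) f = dirds \<iota> j u (dird \<iota> h f)" for f
        using dirds_cong[of j u "u(j := h)" \<iota> "dird \<iota> h f"] by simp
      moreover have "\<exists>c. integrable m c \<and> (\<forall>s x. \<bar>dirds \<iota> (Suc j) (u(j := h)) (\<Phi> s) x\<bar> \<le> c s)"
        by (rule Suc.prems(3)) (use that in simp)
      ultimately show ?thesis by (simp only:)
    qed
    have "\<exists>c. integrable m c \<and> (\<forall>s x. \<bar>dird \<iota> h (\<Phi> s) x\<bar> \<le> c s)" for h using d[of 0] by simp
    then have di: "(\<lambda>s. dird \<iota> h (\<Phi> s) x) \<in> borel_measurable m"
      "((\<lambda>r. LINT s|m. \<Phi> s (x + r *\<^sub>R \<iota> h)) has_real_derivative (LINT s|m. dird \<iota> h (\<Phi> s) x)) (at 0)" for x h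
      using dird_integral[OF Suc.prems(1) int] by blast+
    have e: "dird \<iota> h (\<lambda>x. LINT s|m. \<Phi> s x) = (\<lambda>x. LINT s|m. dird \<iota> h (\<Phi> s) x)" for h
      by (rule ext, rule dird_eqI, rule di)
    have IH: "smooth_along \<iota> n (\<lambda>x. LINT s|m. dird \<iota> h (\<Phi> s) x) \<and>
      (\<forall>j\<le>n. \<forall>u x. dirds \<iota> j u (\<lambda>x. LINT s|m. dird \<iota> h (\<Phi> s) x) = (\<lambda>x. LINT s|m. dirds \<iota> j u (dird \<iota> h (\<Phi> s)) x) \<and>
      integrable m (\<lambda>s. dirds \<iota> j u (dird \<iota> h (\<Phi> s)) x))" for h
      by (rule Suc.IH[OF _ di(1) d]) (use Suc.prems(1) in auto)
    have Cb: "(\<lambda>x. LINT s|m. \<Phi> s x) \<in> Cb"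
      by (rule Cb_integral[OF smooth_along_Cb[OF Suc.prems(1)] Suc.prems(2) c])
    have "dirds \<iota> j u (\<lambda>x. LINT s|m. \<Phi> s x) = (\<lambda>x. LINT s|m. dirds \<iota> j u (\<Phi> s) x) \<and>
      integrable m (\<lambda>s. dirds \<iota> j u (\<Phi> s) x)" if "j \<le> Suc n" for j u x
    proof (cases j)
      case 0
      then show ?thesis using int by simp
    next
      case (Suc i)
      then show ?thesis using IH[of "u i"] that by (simp add: e)
    qed
    then show ?case
      using IH Cb di(2) by (simp add: e)
  qed
  then show "smooth_along \<iota> n (\<lambda>x. LINT s|m. \<Phi> s x)"
    and "j \<le> n \<Longrightarrow> dirds \<iota> j u (\<lambda>x. LINT s|m. \<Phi> s x) = (\<lambda>x. LINT s|m. dirds \<iota> j u (\<Phi> s) x)"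
    and "j \<le> n \<Longrightarrow> integrable m (\<lambda>s. dirds \<iota> j u (\<Phi> s) x)"
    by auto
qed

text \<open>Points and directions move together here, so domination for fixed directions does not
  suffice: the integrable function \<open>c\<close> has to bound the whole operator norm. Along
  sequences in the unit ball the integrand is then dominated by
  \<open>2 * \<bar>c s\<bar>\<close>.\<close>

lemma norm_cont_integral:
  fixes \<Phi> :: "'s \<Rightarrow> 'x::real_normed_vector \<Rightarrow> real" and \<iota> :: "'h::real_normed_vector \<Rightarrow> 'x"
  assumes \<iota>: "bounded_linear \<iota>"
    and sm: "\<And>s. smooth_along \<iota> n (\<Phi> s)"
    and meas: "\<And>x. (\<lambda>s. \<Phi> s x) \<in> borel_measurable m"
    and dom: "\<And>j u. j \<le> n \<Longrightarrow> \<exists>c. integrable m c \<and> (\<forall>s x. \<bar>dirds \<iota> j u (\<Phi> s) x\<bar> \<le> c s)"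
    and c: "integrable m c" "\<And>s. derivs_bounded \<iota> n (\<Phi> s) (c s)"
    and nc: "\<And>s. norm_cont \<iota> n (\<Phi> s) x"
  shows "norm_cont \<iota> n (\<lambda>x. LINT s|m. \<Phi> s x) x"
proof (rule norm_contI_sequentially[OF \<iota>])
  show "smooth_along \<iota> n (\<lambda>x. LINT s|m. \<Phi> s x)"
    by (rule smooth_along_integral(1)[OF sm meas dom])
  have int2: "dirds \<iota> n u (\<lambda>x. LINT s|m. \<Phi> s x) = (\<lambda>x. LINT s|m. dirds \<iota> n u (\<Phi> s) x)" for u
    by (rule smooth_along_integral(2)[OF sm meas dom]) simp_all
  have int3: "integrable m (\<lambda>s. dirds \<iota> n u (\<Phi> s) x)" for u x
    by (rule smooth_along_integral(3)[OF sm meas dom]) simp_all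
  fix X and U :: "nat \<Rightarrow> nat \<Rightarrow> 'h" assume X: "X \<longlonglongrightarrow> x" and U: "\<And>m i. norm (U m i) \<le> 1"
  have "(\<lambda>k. LINT s|m. dirds \<iota> n (U k) (\<Phi> s) (X k) - dirds \<iota> n (U k) (\<Phi> s) x) \<longlonglongrightarrow> (LINT s|m. 0)"
  proof (rule integral_dominated_convergence[where w="\<lambda>s. 2 * \<bar>c s\<bar>"])
    show "AE s in m. norm (dirds \<iota> n (U k) (\<Phi> s) (X k) - dirds \<iota> n (U k) (\<Phi> s) x) \<le> 2 * \<bar>c s\<bar>" for k
    proof (rule AE_I2)
      fix s
      have "\<bar>dirds \<iota> n (U k) (\<Phi> s) y\<bar> \<le> \<bar>c s\<bar> * (\<Prod>i<n. norm (U k i))" for y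
        using derivs_bounded_nonneg_const[OF c(2) abs_ge_self] by (auto simp: derivs_bounded_def)
      also have "\<dots> \<le> \<bar>c s\<bar> * 1"
        using prod_norm_le[of "U k" 1 n] U by (intro mult_left_mono) auto
      finally have "\<bar>dirds \<iota> n (U k) (\<Phi> s) y\<bar> \<le> \<bar>c s\<bar>" for y by simp
      from this[of x] this[of "X k"]
      show "norm (dirds \<iota> n (U k) (\<Phi> s) (X k) - dirds \<iota> n (U k) (\<Phi> s) x) \<le> 2 * \<bar>c s\<bar>" by simp
    qed
    show "AE s in m. (\<lambda>k. dirds \<iota> n (U k) (\<Phi> s) (X k) - dirds \<iota> n (U k) (\<Phi> s) x) \<longlonglongrightarrow> 0"
      by (intro AE_I2 norm_cont_sequentially[OF nc X U])
  qed (use c int3 in auto)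
  then show "(\<lambda>k. dirds \<iota> n (U k) (\<lambda>x. LINT s|m. \<Phi> s x) (X k) - dirds \<iota> n (U k) (\<lambda>x. LINT s|m. \<Phi> s x) x) \<longlonglongrightarrow> 0"
    using int3 by (simp add: int2)
qed

section \<open>Uniform boundedness, weak limits and Fomin derivatives\<close>

text \<open>Baire category argument. The formulation with subadditive, absolutely homogeneous
  functions covers both uses: the norms of \<open>S t x\<close> for \<open>t\<close> in a bounded
  interval, and the absolute values of multilinear forms as functions of one argument.\<close>

theorem uniform_boundedness:
  fixes q :: "'i \<Rightarrow> 'a::banach \<Rightarrow> real"
  assumes cont: "\<And>i. i \<in> I \<Longrightarrow> continuous_on UNIV (q i)"
    and tri: "\<And>i x y. i \<in> I \<Longrightarrow> q i (x - y) \<le> q i x + q i y"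
    and hom: "\<And>i c x. i \<in> I \<Longrightarrow> q i (c *\<^sub>R x) = \<bar>c\<bar> * q i x"
    and bdd: "\<And>x. \<exists>B. \<forall>i\<in>I. q i x \<le> B"
  shows "\<exists>B\<ge>0. \<forall>i\<in>I. \<forall>x. q i x \<le> B * norm x"
proof -
  define E where "E = (\<lambda>n::nat. {x. \<forall>i\<in>I. q i x \<le> real n})"
  have closed: "closed (E n)" for n
  proof -
    have "E n = (\<Inter>i\<in>I. {x. q i x \<le> real n})" by (auto simp: E_def)
    then show ?thesis
      by (auto intro!: closed_INT closed_Collect_le cont continuous_on_const)
  qed
  have "\<exists>n. interior (E n) \<noteq> {}"
  proof (rule ccontr)
    assume "\<not> ?thesis"
    then have "euclidean interior_of \<Union> (range E) = {}"
      by (intro Baire_category_alt) (auto simp: completely_metrizable_space_euclidean closed)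
    moreover have "\<Union> (range E) = UNIV"
    proof -
      have "\<exists>n. x \<in> E n" for x
      proof -
        obtain B where B: "\<And>i. i \<in> I \<Longrightarrow> q i x \<le> B" using bdd by blast
        have "q i x \<le> real (nat \<lceil>B\<rceil>)" if "i \<in> I" for i
          using B[OF that] real_nat_ceiling_ge[of B] by linarith
        then show ?thesis by (auto simp: E_def)
      qed
      then show ?thesis by auto
    qed
    ultimately show False by simp
  qed
  then obtain n a where "a \<in> interior (E n)" by blast
  then obtain r where r: "r > 0" "cball a r \<subseteq> E n"
    by (meson mem_interior_cball)
  have "q i x \<le> (2 * real n / r) * norm x" if i: "i \<in> I" for i x
  proof (cases "x = 0")
    case True
    then show ?thesis using hom[OF i, of 0 x] by simp
  next
    case False
    have qb: "q i y \<le> real n" if "dist a y \<le> r" for y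
      using r(2) that i by (auto simp: E_def)
    \<comment> \<open>A multiple of \<open>x\<close> of norm \<open>r\<close>. It is the difference
      of two points of the ball, \<open>a + ?y\<close> and \<open>a\<close>, at which the whole
      family is at most \<open>n\<close>.\<close>
    let ?y = "(r / norm x) *\<^sub>R x"
    have "q i ?y = q i ((a + ?y) - a)" by simp
    also have "\<dots> \<le> q i (a + ?y) + q i a" by (rule tri[OF i])
    also have "\<dots> \<le> 2 * real n"
      using qb[of "a + ?y"] qb[of a] r(1) False by (simp add: dist_norm)
    finally have "(r / norm x) * q i x \<le> 2 * real n" using r(1) False by (simp add: hom[OF i])
    then show ?thesis using r(1) False by (simp add: field_simps)
  qed
  then show ?thesis using r(1) by (intro exI[of _ "2 * real n / r"]) simp
qed

text \<open>
  The integrands \<open>F (z n)\<close> are bounded below by the Lipschitz functions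
  \<open>G m y = inf {F z' y' + m dist(y, y')}\<close>, with \<open>z'\<close> within \<open>1/m\<close> of the limit point.
  This avoids the tightness of weakly convergent sequences.
\<close>

lemma weak_limit_lower:
  fixes F :: "'z::metric_space \<Rightarrow> 'x::real_normed_vector \<Rightarrow> real"
  assumes cont: "continuous_on (A \<times> UNIV) (\<lambda>(z, y). F z y)"
    and bdd: "\<And>z y. z \<in> A \<Longrightarrow> \<bar>F z y\<bar> \<le> B"
    and z: "\<And>n. z n \<in> A" "w \<in> A" "z \<longlonglongrightarrow> w"
    and \<nu>: "\<And>n. prob_space (\<nu> n)" "\<And>n. sets (\<nu> n) = sets borel" "prob_space \<nu>'" "sets \<nu>' = sets borel"
    and weak: "\<And>f. f \<in> Cb \<Longrightarrow> (\<lambda>n. LINT y|\<nu> n. f y) \<longlonglongrightarrow> (LINT y|\<nu>'. f y)"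
    and e: "e > 0"
  shows "\<forall>\<^sub>F n in sequentially. (LINT y|\<nu> n. F (z n) y) > (LINT y|\<nu>'. F w y) - e"
proof -
  define D where "D = (\<lambda>m::nat. {z' \<in> A. dist z' w \<le> 1 / Suc m})"
  define G where "G = (\<lambda>m y. INF p\<in>D m \<times> UNIV. F (fst p) (snd p) + Suc m * dist y (snd p))"
  have Fcont: "F z' \<in> Cb" if "z' \<in> A" for z'
  proof (rule CbI[OF _ bdd[OF that]])
    have "continuous_on UNIV (\<lambda>y. (\<lambda>(z, y). F z y) (z', y))"
      by (rule continuous_on_compose2[OF cont]) (use that in \<open>auto intro: continuous_intros\<close>)
    then show "continuous_on UNIV (F z')" by simp
  qed
  have wD: "w \<in> D m" for m by (simp add: D_def z)
  have bb: "bdd_below ((\<lambda>p. F (fst p) (snd p) + Suc m * dist y (snd p)) ` (D m \<times> UNIV))" for m y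
  proof (rule bdd_belowI2[of _ "- B"])
    fix p assume "p \<in> D m \<times> (UNIV :: 'x set)"
    then have "F (fst p) (snd p) \<ge> - B" using bdd[of "fst p" "snd p"] by (auto simp: D_def)
    moreover have "Suc m * dist y (snd p) \<ge> 0" by (intro mult_nonneg_nonneg) auto
    ultimately show "- B \<le> F (fst p) (snd p) + Suc m * dist y (snd p)" by linarith
  qed
  have G_le: "G m y \<le> F z' y' + Suc m * dist y y'" if "z' \<in> D m" for m y z' y'
    unfolding G_def using cINF_lower[OF bb, of "(z', y')" m y] that by simp
  have G_ge: "c \<le> G m y" if "\<And>z' y'. z' \<in> D m \<Longrightarrow> c \<le> F z' y' + Suc m * dist y y'" for m y c
    unfolding G_def using wD[of m] that by (intro cINF_greatest) fastforce+
  have GB: "\<bar>G m y\<bar> \<le> B" for m y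
  proof -
    have "G m y \<le> F w y" using G_le[OF wD, of m y y] by simp
    also have "\<dots> \<le> B" using bdd[OF z(2), of y] by simp
    finally have "G m y \<le> B" .
    moreover have "- B \<le> G m y"
    proof (rule G_ge)
      fix z' y' assume "z' \<in> D m"
      then have "F z' y' \<ge> - B" using bdd[of z' y'] by (auto simp: D_def)
      moreover have "Suc m * dist y y' \<ge> 0" by (intro mult_nonneg_nonneg) auto
      ultimately show "- B \<le> F z' y' + Suc m * dist y y'" by linarith
    qed
    ultimately show ?thesis by simp
  qed
  have lip: "G m y1 - Suc m * dist y1 y2 \<le> G m y2" for m y1 y2
  proof (rule G_ge)
    fix z' y' assume "z' \<in> D m"
    then have "G m y1 \<le> F z' y' + Suc m * dist y1 y'" by (rule G_le)
    also have "\<dots> \<le> F z' y' + Suc m * (dist y1 y2 + dist y2 y')"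
      by (intro add_left_mono mult_left_mono dist_triangle) auto
    finally show "G m y1 - Suc m * dist y1 y2 \<le> F z' y' + Suc m * dist y2 y'"
      by (simp add: algebra_simps)
  qed
  have GCb: "G m \<in> Cb" for m
  proof (rule CbI[OF _ GB])
    have "\<bar>G m y1 - G m y2\<bar> \<le> Suc m * dist y1 y2" for y1 y2
      using lip[of m y1 y2] lip[of m y2 y1] by (simp add: dist_commute abs_le_iff)
    then have "(Suc m)-lipschitz_on UNIV (G m)"
      by (intro lipschitz_onI) (auto simp: dist_real_def)
    then show "continuous_on UNIV (G m)" by (rule lipschitz_on_continuous_on)
  qed
  have Glim: "(\<lambda>m. G m y) \<longlonglongrightarrow> F w y" for y
  proof (rule LIMSEQ_I)
    fix r :: real assume r: "r > 0"
    have "\<forall>\<^sub>F p in at (w, y) within A \<times> UNIV. dist ((\<lambda>(z, y). F z y) p) (F w y) < r / 2"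
    proof (rule tendstoD)
      show "((\<lambda>(z, y). F z y) \<longlongrightarrow> F w y) (at (w, y) within A \<times> UNIV)"
        using cont z(2) unfolding continuous_on_def by auto
    qed (use r in simp)
    then obtain d where d: "d > 0"
      "\<And>p. p \<in> A \<times> UNIV \<Longrightarrow> p \<noteq> (w, y) \<Longrightarrow> dist p (w, y) < d \<Longrightarrow> dist ((\<lambda>(z, y). F z y) p) (F w y) < r / 2"
      unfolding eventually_at by auto
    have d': "F z' y' > F w y - r / 2" if "z' \<in> A" "dist z' w < d / 2" "dist y y' < d / 2" for z' y'
    proof (cases "(z', y') = (w, y)")
      case False
      have "dist (z', y') (w, y) \<le> dist z' w + dist y' y"
        unfolding dist_prod_def by (simp add: sqrt_sum_squares_le_sum)
      also have "\<dots> < d" using that by (simp add: dist_commute)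
      finally have "dist (F z' y') (F w y) < r / 2" using d(2)[of "(z', y')"] False that by auto
      then show ?thesis unfolding dist_real_def by linarith
    qed (use r in auto)
    \<comment> \<open>The first bound brings every point of \<open>D m\<close> within
      \<open>d / 2\<close> of \<open>w\<close>. By the second, for \<open>y'\<close> farther than
      \<open>d / 2\<close> from \<open>y\<close>, the penalty \<open>Suc m * dist y y'\<close>
      exceeds \<open>2 * \<bar>B\<bar>\<close>, the largest possible oscillation of
      \<open>F\<close>.\<close>
    obtain N :: nat where N: "real N > 2 / d" "real N > 4 * \<bar>B\<bar> / d"
      using reals_Archimedean2[of "max (2 / d) (4 * \<bar>B\<bar> / d)"] by auto
    have "norm (G m y - F w y) < r" if "m \<ge> N" for m
    proof -
      have "F w y - r / 2 \<le> G m y"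
      proof (rule G_ge)
        fix z' y' assume z': "z' \<in> D m"
        have m: "real (Suc m) > 2 / d" "real (Suc m) > 4 * \<bar>B\<bar> / d" using N that by linarith+
        have "1 / real (Suc m) < d / 2" using m(1) d(1) by (simp add: field_simps)
        then have z'': "z' \<in> A" "dist z' w < d / 2" using z' by (auto simp: D_def)
        show "F w y - r / 2 \<le> F z' y' + Suc m * dist y y'"
        proof (cases "dist y y' < d / 2")
          case True
          moreover have "real (Suc m) * dist y y' \<ge> 0" by simp
          ultimately show ?thesis using d'[OF z'' True] by linarith
        next
          case False
          have "2 * \<bar>B\<bar> < Suc m * (d / 2)" using m(2) d(1) by (simp add: field_simps)
          also have "\<dots> \<le> Suc m * dist y y'" using False by (intro mult_left_mono) auto
          finally show ?thesis using bdd[OF z''(1), of y'] bdd[OF z(2), of y] r by linarith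
        qed
      qed
      moreover have "G m y \<le> F w y" using G_le[OF wD, of m y y] by simp
      ultimately show ?thesis using r by simp
    qed
    then show "\<exists>N. \<forall>m\<ge>N. norm (G m y - F w y) < r" by blast
  qed
  interpret \<nu>': prob_space \<nu>' by fact
  have meas: "f \<in> borel_measurable N" if "f \<in> Cb" "sets N = sets borel" for f :: "'x \<Rightarrow> real" and N
    using Cb_borel[OF that(1)] that(2) by (simp cong: measurable_cong_sets)
  have "(\<lambda>m. LINT y|\<nu>'. G m y) \<longlonglongrightarrow> (LINT y|\<nu>'. F w y)"
    by (rule integral_dominated_convergence[where w="\<lambda>_. B"])
      (use Glim GB meas[OF GCb \<nu>(4)] meas[OF Fcont[OF z(2)] \<nu>(4)] in auto)
  then have "\<forall>\<^sub>F m in sequentially. (LINT y|\<nu>'. G m y) > (LINT y|\<nu>'. F w y) - e / 2"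
    using e by (intro order_tendstoD(1)) auto
  \<comment> \<open>The order of the limits matters: \<open>m\<close> is fixed by means of the limit
    measure alone, and \<open>n\<close> grows only afterwards, because weak convergence applies to
    one test function at a time.\<close>
  then obtain m where m: "(LINT y|\<nu>'. G m y) > (LINT y|\<nu>'. F w y) - e / 2"
    by (auto simp: eventually_sequentially)
  have "\<forall>\<^sub>F n in sequentially. (LINT y|\<nu> n. G m y) > (LINT y|\<nu>'. G m y) - e / 2"
    using e by (intro order_tendstoD(1)[OF weak[OF GCb]]) auto
  moreover have "\<forall>\<^sub>F n in sequentially. dist (z n) w < 1 / Suc m"
    using z(3) by (intro tendstoD) auto
  ultimately show ?thesis
  proof eventually_elim
    case (elim n)
    interpret n: prob_space "\<nu> n" by fact
    have "(LINT y|\<nu> n. G m y) \<le> (LINT y|\<nu> n. F (z n) y)"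
    proof (rule integral_mono)
      show "integrable (\<nu> n) (G m)"
        by (rule n.integrable_const_bound[where B=B]) (use GB meas[OF GCb \<nu>(2)] in auto)
      show "integrable (\<nu> n) (F (z n))"
        by (rule n.integrable_const_bound[where B=B]) (use bdd[OF z(1)] meas[OF Fcont[OF z(1)] \<nu>(2)] in auto)
      have "z n \<in> D m" using elim(2) z(1) by (simp add: D_def)
      then show "G m y \<le> F (z n) y" for y using G_le[of "z n" m y y] by simp
    qed
    then show ?case using elim(1) m by linarith
  qed
qed

text \<open>The lower bound, applied to \<open>F\<close> and to \<open>- F\<close>. Integrand and
  measure vary together, as they do for \<open>Pt\<close> when time, source and point change at
  once.\<close>

lemma weak_limit:
  fixes F :: "'z::metric_space \<Rightarrow> 'x::real_normed_vector \<Rightarrow> real"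
  assumes cont: "continuous_on (A \<times> UNIV) (\<lambda>(z, y). F z y)"
    and bdd: "\<And>z y. z \<in> A \<Longrightarrow> \<bar>F z y\<bar> \<le> B"
    and z: "\<And>n. z n \<in> A" "w \<in> A" "z \<longlonglongrightarrow> w"
    and \<nu>: "\<And>n. prob_space (\<nu> n)" "\<And>n. sets (\<nu> n) = sets borel" "prob_space \<nu>'" "sets \<nu>' = sets borel"
    and weak: "\<And>f. f \<in> Cb \<Longrightarrow> (\<lambda>n. LINT y|\<nu> n. f y) \<longlonglongrightarrow> (LINT y|\<nu>'. f y)"
  shows "(\<lambda>n. LINT y|\<nu> n. F (z n) y) \<longlonglongrightarrow> (LINT y|\<nu>'. F w y)"
proof (rule order_tendstoI)
  fix a assume "a < (LINT y|\<nu>'. F w y)"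
  then show "\<forall>\<^sub>F n in sequentially. a < (LINT y|\<nu> n. F (z n) y)"
    using weak_limit_lower[OF cont bdd z \<nu> weak, of "(LINT y|\<nu>'. F w y) - a"] by simp
next
  fix a assume a: "a > (LINT y|\<nu>'. F w y)"
  have "continuous_on (A \<times> UNIV) (\<lambda>(z, y). - F z y)"
    using continuous_on_minus[OF cont] by (simp add: case_prod_unfold)
  then show "\<forall>\<^sub>F n in sequentially. a > (LINT y|\<nu> n. F (z n) y)"
    using weak_limit_lower[of A "\<lambda>z y. - F z y" B z w \<nu> \<nu>' "a - (LINT y|\<nu>'. F w y)"]
      bdd z \<nu> weak a by simp
qed


section \<open>Fomin derivatives of integrals of bounded Borel functions\<close>

lemma image_translation_borel:
  fixes v :: "'x::real_normed_vector"
  assumes "A \<in> sets borel"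
  shows "(\<lambda>x. x + v) ` A \<in> sets borel"
proof -
  have "(\<lambda>x. x + v) ` A = (\<lambda>x. x - v) -` A \<inter> space borel"
    by (auto simp: image_iff) (metis diff_add_cancel)
  moreover have "(\<lambda>x. x - v) \<in> borel \<rightarrow>\<^sub>M borel"
    by (intro borel_measurable_continuous_onI continuous_intros)
  ultimately show ?thesis using assms by (metis measurable_sets)
qed

text \<open>The density represents the derivative at 0 for every Borel set, in particular for the
  translates of \<open>A\<close>; the derivative at 0 for a translate is the derivative at
  \<open>r\<close> for \<open>A\<close>.\<close>

lemma fomin_translate_DERIV:
  fixes \<nu> :: "'x::real_normed_vector measure"
  assumes sets: "sets \<nu> = sets borel" and \<beta>: "fomin_density \<nu> v \<beta>" and A: "A \<in> sets borel"
  shows "((\<lambda>r. measure \<nu> ((\<lambda>x. x + r *\<^sub>R v) ` A)) has_real_derivative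
      (LINT x:(\<lambda>x. x + r *\<^sub>R v) ` A|\<nu>. \<beta> x)) (at r)"
proof -
  let ?A = "(\<lambda>x. x + r *\<^sub>R v) ` A"
  have "(fomin_quotient \<nu> v ?A \<longlongrightarrow> (LINT x:?A|\<nu>. \<beta> x)) (at 0)"
    using \<beta> image_translation_borel[OF A] by (auto simp: fomin_density_def)
  moreover have "(\<lambda>x. x + s *\<^sub>R v) ` ?A = (\<lambda>x. x + (r + s) *\<^sub>R v) ` A" for s
    by (simp add: image_image scaleR_add_left add_ac)
  ultimately show ?thesis
    by (simp add: DERIV_def fomin_quotient_def[abs_def])
qed

text \<open>Since the derivative is known at every translate, the mean value inequality gives a
  Lipschitz constant that does not depend on the set. It later dominates the difference quotients of
  all superlevel sets at once.\<close>

lemma fomin_translate_lipschitz: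
  fixes \<nu> :: "'x::real_normed_vector measure"
  assumes sets: "sets \<nu> = sets borel" and \<beta>: "fomin_density \<nu> v \<beta>" and A: "A \<in> sets borel"
  shows "\<bar>measure \<nu> ((\<lambda>x. x + r *\<^sub>R v) ` A) - measure \<nu> A\<bar> \<le> (LINT x|\<nu>. \<bar>\<beta> x\<bar>) * \<bar>r\<bar>"
proof -
  let ?G = "\<lambda>r. measure \<nu> ((\<lambda>x. x + r *\<^sub>R v) ` A)"
  let ?D = "\<lambda>r. LINT x:(\<lambda>x. x + r *\<^sub>R v) ` A|\<nu>. \<beta> x"
  have int: "integrable \<nu> \<beta>" using \<beta> by (simp add: fomin_density_def)
  have "norm (?G r - ?G 0) \<le> (LINT x|\<nu>. \<bar>\<beta> x\<bar>) * norm (r - 0)"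
  proof (rule field_differentiable_bound[where S=UNIV and f'="?D"])
    show "(?G has_field_derivative ?D r) (at r within UNIV)" for r
      using fomin_translate_DERIV[OF assms] by simp
    show "norm (?D r) \<le> (LINT x|\<nu>. \<bar>\<beta> x\<bar>)" for r
    proof -
      have m: "(\<lambda>x. x + r *\<^sub>R v) ` A \<in> sets \<nu>" using image_translation_borel[OF A] sets by simp
      have "integrable \<nu> (\<lambda>x. indicat_real ((\<lambda>x. x + r *\<^sub>R v) ` A) x *\<^sub>R \<beta> x)"
        by (rule integrable_mult_indicator[OF m int])
      then show ?thesis
        unfolding set_lebesgue_integral_def
        by (intro integrable_real_bound(2)[THEN order_trans[OF eq_refl[OF real_norm_def]]] integrable_abs int)
          (auto simp: indicator_def)
    qed
  qed auto
  then show ?thesis by simp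
qed

text \<open>The layer-cake formula reduces integrals of \<open>f\<close> to measures of its superlevel sets.\<close>

lemma layer_cake:
  fixes f w :: "'a \<Rightarrow> real"
  assumes N: "prob_space N" and f[measurable]: "f \<in> borel_measurable N" and f01: "\<And>y. 0 \<le> f y" "\<And>y. f y \<le> 1"
    and w: "integrable N w"
  defines "U \<equiv> uniform_measure lborel {0..1::real}"
  shows "integrable U (\<lambda>l. LINT y|N. indicator {y. l < f y} y * w y)"
    and "(LINT l|U. LINT y|N. indicator {y. l < f y} y * w y) = (LINT y|N. f y * w y)"
proof -
  interpret N: prob_space N by fact
  interpret U: prob_space U unfolding U_def by (rule prob_space_uniform_measure) auto
  interpret P: pair_sigma_finite N U ..
  have [measurable]: "w \<in> borel_measurable N" using w by auto
  have U_sets[measurable_cong]: "sets U = sets borel" by (simp add: U_def)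
  let ?F = "\<lambda>y l. indicator {y. l < f y} y * w y"
  have meas[measurable]: "(\<lambda>(y, l). ?F y l) \<in> borel_measurable (N \<Otimes>\<^sub>M U)"
  proof -
    have "(\<lambda>p. (if snd p < f (fst p) then 1 else 0) * w (fst p)) \<in> borel_measurable (N \<Otimes>\<^sub>M U)"
      by measurable
    then show ?thesis by (simp add: case_prod_unfold indicator_def of_bool_def)
  qed
  have bd: "\<bar>?F y l\<bar> \<le> \<bar>w y\<bar>" for y l by (auto simp: indicator_def)
  have int: "integrable (N \<Otimes>\<^sub>M U) (\<lambda>(y, l). ?F y l)"
  proof (rule P.Fubini_integrable[OF meas])
    show "AE y in N. integrable U (\<lambda>l. (\<lambda>(y, l). ?F y l) (y, l))"
    proof (rule AE_I2)
      fix y assume "y \<in> space N"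
      then have "(\<lambda>l. (\<lambda>(y, l). ?F y l) (y, l)) \<in> borel_measurable U"
        by (rule measurable_compose[OF measurable_Pair1' meas])
      then show "integrable U (\<lambda>l. (\<lambda>(y, l). ?F y l) (y, l))"
        using bd by (intro U.integrable_const_bound[where B="\<bar>w y\<bar>"]) auto
    qed
    show "integrable N (\<lambda>y. LINT l|U. norm ((\<lambda>(y, l). ?F y l) (y, l)))"
    proof (rule Bochner_Integration.integrable_bound[OF w])
      show "AE y in N. norm (LINT l|U. norm ((\<lambda>(y, l). ?F y l) (y, l))) \<le> norm (w y)"
      proof (rule AE_I2)
        fix y assume y: "y \<in> space N"
        then have m: "(\<lambda>l. (\<lambda>(y, l). ?F y l) (y, l)) \<in> borel_measurable U"
          by (rule measurable_compose[OF measurable_Pair1' meas])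
        have "\<bar>LINT l|U. norm (?F y l)\<bar> \<le> (LINT l|U. \<bar>w y\<bar>)"
          by (rule integrable_real_bound(2)) (use m bd in auto)
        then show "norm (LINT l|U. norm ((\<lambda>(y, l). ?F y l) (y, l))) \<le> norm (w y)"
          by (simp add: U.prob_space)
      qed
    qed measurable
  qed
  show "integrable U (\<lambda>l. LINT y|N. ?F y l)" using P.integrable_snd[OF int] by simp
  have "(LINT l|U. indicator {y. l < f y} y) = f y" for y
  proof -
    have "{0..1} \<inter> {..<f y} = {0..<f y}" using f01[of y] by auto
    then have "measure U {..<f y} = f y"
      unfolding U_def using f01[of y] by (subst measure_uniform_measure) auto
    moreover have "(LINT l|U. indicator {..<f y} l) = measure U ({..<f y} \<inter> space U)"
      by simp
    moreover have "indicator {y. l < f y} y = (indicator {..<f y} l :: real)" for l by (auto simp: indicator_def)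
    ultimately show ?thesis by (simp add: U_def)
  qed
  then have "(LINT y|N. LINT l|U. ?F y l) = (LINT y|N. f y * w y)" by simp
  then show "(LINT l|U. LINT y|N. ?F y l) = (LINT y|N. f y * w y)"
    using P.Fubini_integral[OF int] by simp
qed


text \<open>Fomin differentiability speaks of sets; integrating over the superlevel sets of
  \<open>f\<close> turns this into a statement on functions. Shifting the argument of
  \<open>f\<close> by \<open>r *\<^sub>R v\<close> shifts these sets by the opposite vector, whence
  the minus sign.\<close>

lemma fomin_DERIV_01:
  fixes \<nu> :: "'x::real_normed_vector measure"
  assumes \<nu>: "prob_space \<nu>" "sets \<nu> = sets borel" and \<beta>: "fomin_density \<nu> v \<beta>"
    and f: "f \<in> borel_measurable borel" "\<And>y. 0 \<le> f y" "\<And>y. f y \<le> 1"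
  shows "((\<lambda>r. LINT y|\<nu>. f (y + r *\<^sub>R v)) has_real_derivative - (LINT y|\<nu>. f y * \<beta> y)) (at 0)"
proof -
  interpret prob_space \<nu> by fact
  define U where "U = uniform_measure lborel {0..1::real}"
  define A where "A = (\<lambda>l. {y. l < f y})"
  have space: "space \<nu> = UNIV" using sets_eq_imp_space_eq[OF \<nu>(2)] by simp
  have A: "A l \<in> sets borel" for l
    using borel_measurable_less[OF measurable_const f(1), of l] by (auto simp: A_def pred_def)
  have \<beta>i: "integrable \<nu> \<beta>" using \<beta> by (simp add: fomin_density_def)
  interpret U: prob_space U unfolding U_def by (rule prob_space_uniform_measure) auto
  let ?m = "\<lambda>r l. measure \<nu> ((\<lambda>x. x + r *\<^sub>R v) ` A l)"
  have trans: "integrable U (?m (- r))" "(LINT l|U. ?m (- r) l) = (LINT y|\<nu>. f (y + r *\<^sub>R v))" for r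
  proof -
    have m: "(\<lambda>y. f (y + r *\<^sub>R v)) \<in> borel_measurable \<nu>"
      unfolding measurable_cong_sets[OF \<nu>(2) refl]
      by (rule measurable_compose[OF _ f(1)]) (intro borel_measurable_continuous_onI continuous_intros)
    have "(LINT y|\<nu>. indicator {y. l < f (y + r *\<^sub>R v)} y * 1) = ?m (- r) l" for l
    proof -
      have "(\<lambda>x. x + (- r) *\<^sub>R v) ` A l = {y. l < f (y + r *\<^sub>R v)}"
      proof (intro subset_antisym subsetI)
        fix y assume "y \<in> {y. l < f (y + r *\<^sub>R v)}"
        then show "y \<in> (\<lambda>x. x + (- r) *\<^sub>R v) ` A l"
          by (intro image_eqI[of _ _ "y + r *\<^sub>R v"]) (auto simp: A_def)
      qed (auto simp: A_def)
      then show ?thesis by (simp add: space)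
    qed
    then show "integrable U (?m (- r))" "(LINT l|U. ?m (- r) l) = (LINT y|\<nu>. f (y + r *\<^sub>R v))"
      using layer_cake[OF \<nu>(1) m, of "\<lambda>_. 1"] f(2,3) by (simp_all add: U_def)
  qed
  have lc: "integrable U (\<lambda>l. LINT y:A l|\<nu>. \<beta> y)" "(LINT l|U. (LINT y:A l|\<nu>. \<beta> y)) = (LINT y|\<nu>. f y * \<beta> y)"
    using layer_cake[OF \<nu>(1) _ f(2,3) \<beta>i] f(1)
    by (simp_all add: U_def A_def set_lebesgue_integral_def measurable_cong_sets[OF \<nu>(2) refl])
  show ?thesis
  proof (rule DERIV_at_0I, unfold tendsto_at_iff_sequentially comp_def, intro allI impI)
    fix R :: "nat \<Rightarrow> real" assume "\<forall>i. R i \<in> UNIV - {0}" and R0: "R \<longlonglongrightarrow> 0"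
    then have R: "R k \<noteq> 0" for k by auto
    have "(\<lambda>k. LINT l|U. (?m (- R k) l - ?m (- 0) l) / R k) \<longlonglongrightarrow> (LINT l|U. - (LINT y:A l|\<nu>. \<beta> y))"
    proof (rule integral_dominated_convergence[where w="\<lambda>_. LINT x|\<nu>. \<bar>\<beta> x\<bar>"])
      have "(\<lambda>k. (?m (- R k) l - ?m (- 0) l) / R k) \<longlonglongrightarrow> - (LINT y:A l|\<nu>. \<beta> y)" for l
      proof -
        have "((\<lambda>r. (?m r l - ?m 0 l) / r) \<longlongrightarrow> (LINT y:A l|\<nu>. \<beta> y)) (at 0)"
          using fomin_translate_DERIV[OF \<nu>(2) \<beta> A, of l 0] by (simp add: DERIV_def)
        from this[unfolded tendsto_at_iff_sequentially, rule_format, of "\<lambda>k. - R k"]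
        have "(\<lambda>k. (?m (- R k) l - ?m 0 l) / (- R k)) \<longlonglongrightarrow> (LINT y:A l|\<nu>. \<beta> y)"
          using R tendsto_minus[OF R0] by (auto simp: comp_def)
        from tendsto_minus[OF this] show ?thesis by simp
      qed
      then show "AE l in U. (\<lambda>k. (?m (- R k) l - ?m (- 0) l) / R k) \<longlonglongrightarrow> - (LINT y:A l|\<nu>. \<beta> y)" by simp
      show "AE l in U. norm ((?m (- R k) l - ?m (- 0) l) / R k) \<le> (LINT x|\<nu>. \<bar>\<beta> x\<bar>)" for k
      proof (rule AE_I2)
        fix l
        show "norm ((?m (- R k) l - ?m (- 0) l) / R k) \<le> (LINT x|\<nu>. \<bar>\<beta> x\<bar>)"
          using fomin_translate_lipschitz[OF \<nu>(2) \<beta> A[of l], of "- R k"] R[of k]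
          by (simp add: field_simps abs_divide)
      qed
      show "(\<lambda>l. (?m (- R k) l - ?m (- 0) l) / R k) \<in> borel_measurable U" for k
        using trans(1)[of "R k"] trans(1)[of 0]
        by (intro borel_measurable_divide borel_measurable_diff borel_measurable_integrable) auto
    qed (use lc(1) in auto)
    moreover have "(LINT l|U. (?m (- R k) l - ?m (- 0) l) / R k) =
        ((LINT y|\<nu>. f (y + R k *\<^sub>R v)) - (LINT y|\<nu>. f (y + 0 *\<^sub>R v))) / R k" for k
      unfolding trans(2)[symmetric] using trans(1)[of "R k"] trans(1)[of 0] by simp
    moreover have "(LINT l|U. - (LINT y:A l|\<nu>. \<beta> y)) = - (LINT y|\<nu>. f y * \<beta> y)"
      using lc by simp
    ultimately show "(\<lambda>k. ((LINT y|\<nu>. f (y + R k *\<^sub>R v)) - (LINT y|\<nu>. f (y + 0 *\<^sub>R v))) / R k)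
        \<longlonglongrightarrow> - (LINT y|\<nu>. f y * \<beta> y)"
      by (simp only:)
  qed
qed

lemma fomin_DERIV:
  fixes \<nu> :: "'x::real_normed_vector measure"
  assumes \<nu>: "prob_space \<nu>" "sets \<nu> = sets borel" and \<beta>: "fomin_density \<nu> v \<beta>"
    and f: "f \<in> borel_measurable borel" "\<And>y. \<bar>f y\<bar> \<le> B"
  shows "((\<lambda>r. LINT y|\<nu>. f (y + r *\<^sub>R v)) has_real_derivative - (LINT y|\<nu>. f y * \<beta> y)) (at 0)"
proof -
  interpret prob_space \<nu> by fact
  define K where "K = \<bar>B\<bar> + 1"
  have K: "K > 0" "\<bar>f y\<bar> \<le> K" for y using f(2)[of y] by (auto simp: K_def)
  define g where "g = (\<lambda>y. (f y + K) / (2 * K))"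
  have g: "g \<in> borel_measurable borel" "0 \<le> g y" "g y \<le> 1" for y
    using f(1) K(1) K(2)[of y] by (auto simp: g_def field_simps abs_le_iff)
  have fg: "f y = 2 * K * g y - K" for y using K(1) by (simp add: g_def)
  have \<beta>i: "integrable \<nu> \<beta>" using \<beta> by (simp add: fomin_density_def)
  have gi: "integrable \<nu> (\<lambda>y. g (y + r *\<^sub>R v))" for r
  proof (rule integrable_const_bound[where B=1])
    show "(\<lambda>y. g (y + r *\<^sub>R v)) \<in> borel_measurable \<nu>"
      unfolding measurable_cong_sets[OF \<nu>(2) refl]
      by (rule measurable_compose[OF _ g(1)]) (intro borel_measurable_continuous_onI continuous_intros)
  qed (use g in auto)
  have g\<beta>: "integrable \<nu> (\<lambda>y. g y * \<beta> y)"
  proof (rule Bochner_Integration.integrable_bound[OF \<beta>i])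
    show "(\<lambda>y. g y * \<beta> y) \<in> borel_measurable \<nu>"
    proof (intro borel_measurable_times borel_measurable_integrable[OF \<beta>i])
      show "g \<in> borel_measurable \<nu>" unfolding measurable_cong_sets[OF \<nu>(2) refl] by (rule g(1))
    qed
    show "AE y in \<nu>. norm (g y * \<beta> y) \<le> norm (\<beta> y)"
      using g(2,3) by (intro AE_I2) (auto simp: abs_mult mult_left_le_one_le)
  qed
  \<comment> \<open>Translations preserve the total mass, so differentiating the constant function 1
    shows that the density has mean zero. The additive constant in \<open>fg\<close> therefore drops
    out of the derivative.\<close>
  have one: "(LINT y|\<nu>. \<beta> y) = 0"
  proof -
    have "((\<lambda>r. LINT y|\<nu>. 1) has_real_derivative - (LINT y|\<nu>. 1 * \<beta> y)) (at 0)"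
      by (rule fomin_DERIV_01[OF \<nu> \<beta>]) auto
    from DERIV_unique[OF this DERIV_const] show ?thesis by simp
  qed
  have "((\<lambda>r. 2 * K * (LINT y|\<nu>. g (y + r *\<^sub>R v)) - K) has_real_derivative
      2 * K * (- (LINT y|\<nu>. g y * \<beta> y)) - 0) (at 0)"
    by (intro DERIV_diff DERIV_cmult DERIV_const fomin_DERIV_01[OF \<nu> \<beta> g])
  moreover have "(LINT y|\<nu>. f (y + r *\<^sub>R v)) = 2 * K * (LINT y|\<nu>. g (y + r *\<^sub>R v)) - K" for r
    unfolding fg using gi[of r] by (simp add: prob_space)
  moreover have "(LINT y|\<nu>. f y * \<beta> y) = 2 * K * (LINT y|\<nu>. g y * \<beta> y)"
  proof -
    have "(LINT y|\<nu>. f y * \<beta> y) = (LINT y|\<nu>. 2 * K * (g y * \<beta> y) - K * \<beta> y)"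
      by (simp add: fg algebra_simps)
    also have "\<dots> = 2 * K * (LINT y|\<nu>. g y * \<beta> y) - K * (LINT y|\<nu>. \<beta> y)"
      using g\<beta> \<beta>i by simp
    finally show ?thesis by (simp add: one)
  qed
  ultimately show ?thesis by simp
qed

section \<open>The semigroup on bounded continuous functions\<close>

lemma Cb_shift:
  fixes f :: "'x::real_normed_vector \<Rightarrow> real"
  assumes "f \<in> Cb"
  shows "(\<lambda>y. f (a + y)) \<in> Cb" "(\<lambda>y. f (y + a)) \<in> Cb"
  using smooth_along_shift(1)[of undefined 0 f a] assms by (auto simp: add.commute)

lemma Cb_const: "(\<lambda>_. c) \<in> Cb"
  by (auto simp: Cb_def)

lemma Cb_abs: "f \<in> Cb \<Longrightarrow> (\<lambda>x. \<bar>f x\<bar>) \<in> Cb"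
  by (auto simp: Cb_def bounded_iff intro: continuous_intros)

context mehler_semigroup
begin

abbreviation Pt :: "real \<Rightarrow> ('x \<Rightarrow> real) \<Rightarrow> 'x \<Rightarrow> real" where
  "Pt \<equiv> mehler S \<mu>"

lemma measurable_\<mu>: "t \<ge> 0 \<Longrightarrow> borel_measurable (\<mu> t) = borel_measurable borel"
  by (rule measurable_cong_sets[OF \<mu>_sets refl])

lemma Cb_measurable_\<mu>:
  assumes "t \<ge> 0" "f \<in> Cb"
  shows "f \<in> borel_measurable (\<mu> t)"
  unfolding measurable_\<mu>[OF assms(1)] by (rule Cb_borel[OF assms(2)])

lemma Cb_integrable_\<mu>:
  assumes t: "t \<ge> 0" and f: "f \<in> Cb"
  shows "integrable (\<mu> t) f"
proof -
  interpret prob_space "\<mu> t" by (rule \<mu>_prob[OF t])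
  obtain B where "\<And>x. \<bar>f x\<bar> \<le> B" using CbD(3)[OF f] by auto
  then show ?thesis
    by (intro integrable_const_bound[where B=B] Cb_measurable_\<mu> t f) auto
qed

lemma mehler_integrable:
  assumes "t \<ge> 0" "f \<in> Cb"
  shows "integrable (\<mu> t) (\<lambda>y. f (S t x + y))"
  by (intro Cb_integrable_\<mu> Cb_shift assms)

lemma mehler_mono:
  assumes "t \<ge> 0" "f \<in> Cb" "g \<in> Cb" "\<And>x. f x \<le> g x"
  shows "Pt t f x \<le> Pt t g x"
  unfolding mehler_def by (intro integral_mono mehler_integrable assms)

lemma mehler_const: "t \<ge> 0 \<Longrightarrow> Pt t (\<lambda>_. c) x = c"
  using prob_space.prob_space[OF \<mu>_prob] by (simp add: mehler_def)

lemma mehler_linear: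
  assumes "t \<ge> 0" "f \<in> Cb" "g \<in> Cb"
  shows "Pt t (\<lambda>x. a * f x + b * g x) x = a * Pt t f x + b * Pt t g x"
  unfolding mehler_def using mehler_integrable assms by simp

lemma mehler_abs_le:
  assumes "t \<ge> 0" "f \<in> Cb"
  shows "\<bar>Pt t f x\<bar> \<le> Pt t (\<lambda>x. \<bar>f x\<bar>) x"
  unfolding mehler_def by (rule integral_abs_bound)

lemma mehler_bound:
  assumes "t \<ge> 0" "f \<in> Cb" "\<And>x. \<bar>f x\<bar> \<le> b"
  shows "\<bar>Pt t f x\<bar> \<le> b"
proof -
  have "\<bar>Pt t f x\<bar> \<le> Pt t (\<lambda>x. \<bar>f x\<bar>) x" by (rule mehler_abs_le[OF assms(1,2)])
  also have "\<dots> \<le> Pt t (\<lambda>x. b) x"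
    by (intro mehler_mono Cb_abs Cb_const assms)
  finally show ?thesis using mehler_const[OF assms(1)] by simp
qed

lemma mehler_shift:
  assumes "t \<ge> 0" "f \<in> Cb"
  shows "Pt t (\<lambda>w. f (w + S t a) - f w) x = Pt t f (x + a) - Pt t f x"
proof -
  have "(\<lambda>y. f (S t (x + a) + y)) = (\<lambda>y. f (S t x + y + S t a))"
    by (simp add: blinfun.add_right add_ac)
  then show ?thesis
    unfolding mehler_def
    using mehler_integrable[OF assms, of x] mehler_integrable[OF assms, of "x + a"] by simp
qed

text \<open>The convolution law of the measures is the semigroup law in disguise: the factor
  \<open>\<mu> s\<close> yields the inner operator \<open>Pt s\<close>, and the image of
  \<open>\<mu> t\<close> under \<open>S s\<close> yields the outer operator \<open>Pt t\<close>.
  Fubini's theorem separates them.\<close>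

lemma mehler_add:
  assumes t: "t > 0" and s: "s > 0" and f: "f \<in> Cb"
  shows "Pt (t + s) f = Pt t (Pt s f)"
proof
  fix x
  have ts: "t \<ge> 0" "s \<ge> 0" "t + s \<ge> 0" using t s by auto
  interpret t: prob_space "\<mu> t" by (rule \<mu>_prob[OF ts(1)])
  interpret s: prob_space "\<mu> s" by (rule \<mu>_prob[OF ts(2)])
  define N where "N = distr (\<mu> t) borel (S s)"
  have Ss: "blinfun_apply (S s) \<in> \<mu> t \<rightarrow>\<^sub>M borel"
    unfolding measurable_cong_sets[OF \<mu>_sets[OF ts(1)] refl]
    by (intro borel_measurable_continuous_onI continuous_intros)
  interpret N: prob_space N unfolding N_def by (rule t.prob_space_distr[OF Ss])
  interpret P: pair_prob_space N "\<mu> s" ..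
  \<comment> \<open>Second countability identifies the product of the two Borel sigma-algebras with
    the Borel sigma-algebra of the product space, for which addition is measurable by
    continuity.\<close>
  have NS: "sets (N \<Otimes>\<^sub>M \<mu> s) = sets (borel :: ('x \<times> 'x) measure)"
    unfolding borel_prod[symmetric] by (rule sets_pair_measure_cong) (simp_all add: N_def \<mu>_sets[OF ts(2)])
  let ?a = "S (t + s) x"
  have fa: "(\<lambda>y. f (?a + y)) \<in> borel_measurable borel" by (intro Cb_borel Cb_shift f)
  have plus: "(\<lambda>(x, y). x + y) \<in> N \<Otimes>\<^sub>M \<mu> s \<rightarrow>\<^sub>M (borel :: 'x measure)"
    unfolding measurable_cong_sets[OF NS refl] case_prod_unfold
    by (intro borel_measurable_continuous_onI continuous_intros)
  obtain B where B: "\<And>x. \<bar>f x\<bar> \<le> B" using CbD(3)[OF f] by auto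
  have int: "integrable (N \<Otimes>\<^sub>M \<mu> s) (\<lambda>(u, z). f (?a + (u + z)))"
    by (rule P.integrable_const_bound[where B=B])
      (use B measurable_compose[OF plus fa] in \<open>auto simp: case_prod_unfold\<close>)
  have "Pt (t + s) f x = (LINT p|(N \<Otimes>\<^sub>M \<mu> s). f (?a + (case p of (u, z) \<Rightarrow> u + z)))"
    unfolding mehler_def \<mu>_add[OF t s] conv_measure_def N_def[symmetric]
    by (subst integral_distr[OF plus fa]) simp
  also have "\<dots> = (LINT u|N. LINT z|\<mu> s. f (?a + (u + z)))"
    using P.integral_fst'[OF int] by (simp add: case_prod_unfold)
  also have "\<dots> = (LINT y|\<mu> t. LINT z|\<mu> s. f (?a + (S s y + z)))"
    unfolding N_def
  proof (rule integral_distr[OF Ss])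
    have "(\<lambda>u. LINT z|\<mu> s. f (?a + (u + z))) \<in> borel_measurable N"
      using s.borel_measurable_lebesgue_integral[OF borel_measurable_integrable[OF int]] by simp
    then show "(\<lambda>u. LINT z|\<mu> s. f (?a + (u + z))) \<in> borel_measurable borel"
      by (simp add: N_def)
  qed
  also have "\<dots> = Pt t (Pt s f) x"
    using S_add[OF ts(2,1)] by (simp add: mehler_def add.commute[of t s] blinfun.add_right add_ac)
  finally show "Pt (t + s) f x = Pt t (Pt s f) x" .
qed

lemma mehler_Cb:
  assumes "t \<ge> 0" "f \<in> Cb"
  shows "Pt t f \<in> Cb"
proof -
  obtain B where B: "\<And>x. \<bar>f x\<bar> \<le> B" using CbD(3)[OF assms(2)] by auto
  interpret prob_space "\<mu> t" by (rule \<mu>_prob[OF assms(1)])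
  have "(\<lambda>x. LINT y|\<mu> t. f (S t x + y)) \<in> Cb"
  proof (rule Cb_integral[where c="\<lambda>_. B"])
    show "(\<lambda>x. f (S t x + y)) \<in> Cb" for y
      \<comment> \<open>At order 0 only continuity and boundedness are transported; the unit type
        and the zero maps are placeholders for directions.\<close>
      using smooth_along_affine(1)[OF _ blinfun.bounded_linear_right[of "S t"],
          of "\<lambda>_::unit. 0" 0 f "\<lambda>_. 0" id y] assms(2)
      by (simp add: blinfun.zero_right)
  qed (use B Cb_measurable_\<mu>[OF assms(1) Cb_shift(1)[OF assms(2)]] in auto)
  then show ?thesis by (simp add: mehler_def[abs_def])
qed

text \<open>An orbit over a compact time interval is compact, hence bounded, and the uniform
  boundedness principle does the rest.\<close>

lemma S_bounded: "\<exists>K\<ge>0. \<forall>t\<in>{0..T}. \<forall>x. norm (S t x) \<le> K * norm x"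
proof (rule uniform_boundedness)
  fix x
  have "compact ((\<lambda>t. S t x) ` {0..T})"
    by (intro compact_continuous_image continuous_on_subset[OF S_cont]) auto
  then have "bounded ((\<lambda>t. S t x) ` {0..T})" by (rule compact_imp_bounded)
  then show "\<exists>B. \<forall>t\<in>{0..T}. norm (S t x) \<le> B" by (simp add: bounded_iff)
qed (auto intro!: continuous_intros simp: blinfun.diff_right blinfun.scaleR_right norm_triangle_ineq4)

lemma S_tendsto:
  assumes t: "\<And>n. t n \<ge> 0" "t \<longlonglongrightarrow> t'" and x: "x \<longlonglongrightarrow> x'"
  shows "(\<lambda>n. S (t n) (x n)) \<longlonglongrightarrow> S t' x'"
proof -
  have t': "t' \<ge> 0" using LIMSEQ_le_const[OF t(2)] t(1) by blast
  obtain T where T: "\<And>n. t n \<in> {0..T}"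
    using Bseq_bdd_above[OF convergent_imp_Bseq[OF convergentI[OF t(2)]]] t(1)
    by (auto simp: bdd_above_def)
  obtain K where K: "\<And>t x. t \<in> {0..T} \<Longrightarrow> norm (S t x) \<le> K * norm x"
    using S_bounded[of T] by blast
  have "(\<lambda>n. S (t n) x') \<longlonglongrightarrow> S t' x'"
    using continuous_on_tendsto_compose[OF S_cont t(2)] t' t(1) by auto
  moreover have "(\<lambda>n. S (t n) (x n - x')) \<longlonglongrightarrow> 0"
  proof (rule Lim_null_comparison)
    show "\<forall>\<^sub>F n in sequentially. norm (S (t n) (x n - x')) \<le> K * norm (x n - x')"
      using K[OF T] by auto
    show "(\<lambda>n. K * norm (x n - x')) \<longlonglongrightarrow> 0"
      using tendsto_norm_zero[OF LIM_zero[OF x]] tendsto_mult_right_zero by blast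
  qed
  ultimately have "(\<lambda>n. S (t n) x' + S (t n) (x n - x')) \<longlonglongrightarrow> S t' x' + 0"
    by (rule tendsto_add)
  then show ?thesis by (simp add: blinfun.diff_right)
qed

text \<open>\<open>r\<close> and \<open>s\<close> vary independently, so that both the integrand
  \<open>Pt (t - s) (g s)\<close> and the initial datum, as a source constant in time, are covered.
  The measures converge only weakly while the integrand changes with all three parameters, which is
  the situation of \<open>weak_limit\<close>.\<close>

lemma mehler_tendsto:
  assumes g: "g \<in> Cb_T T"
    and r: "\<And>n. r n \<ge> 0" "r \<longlonglongrightarrow> r'" and s: "\<And>n. s n \<in> {0..T}" "s \<longlonglongrightarrow> s'" and x: "x \<longlonglongrightarrow> x'"
  shows "(\<lambda>n. Pt (r n) (g (s n)) (x n)) \<longlonglongrightarrow> Pt r' (g s') x'"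
proof -
  have r': "r' \<ge> 0" using LIMSEQ_le_const[OF r(2)] r(1) by blast
  have s': "s' \<in> {0..T}" by (rule closed_sequentially[OF closed_atLeastAtMost s])
  obtain B where B: "\<And>s x. s \<in> {0..T} \<Longrightarrow> \<bar>g s x\<bar> \<le> B"
    using g by (fastforce simp: Cb_T_def bounded_iff)
  define F where "F = (\<lambda>(r, s, x) y. g s (S r x + y))"
  have gc: "(\<lambda>n. g (s n) (w n)) \<longlonglongrightarrow> g s' w'"
    if "\<And>n. s n \<in> {0..T}" "s' \<in> {0..T}" "s \<longlonglongrightarrow> s'" "w \<longlonglongrightarrow> w'" for s s' w w'
  proof -
    have "continuous_on ({0..T} \<times> UNIV) (\<lambda>(t, x). g t x)" using g by (simp add: Cb_T_def)
    from continuous_on_tendsto_compose[OF this tendsto_Pair[OF that(3,4)]] that(1,2)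
    show ?thesis by simp
  qed
  have "(\<lambda>n. LINT y|\<mu> (r n). F (r n, s n, x n) y) \<longlonglongrightarrow> (LINT y|\<mu> r'. F (r', s', x') y)"
  proof (rule weak_limit[where A="{0..} \<times> {0..T} \<times> UNIV" and B=B])
    show "continuous_on (({0..} \<times> {0..T} \<times> UNIV) \<times> UNIV) (\<lambda>(z, y). F z y)"
      unfolding continuous_on_sequentially comp_def
    proof (intro allI ballI impI, elim conjE)
      fix p :: "nat \<Rightarrow> (real \<times> real \<times> 'x) \<times> 'x" and a assume a: "a \<in> ({0..} \<times> {0..T} \<times> UNIV) \<times> (UNIV :: 'x set)"
        and p: "\<forall>n. p n \<in> ({0..} \<times> {0..T} \<times> UNIV) \<times> (UNIV :: 'x set)" "p \<longlonglongrightarrow> a"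
      have 1: "(\<lambda>n. fst (fst (p n))) \<longlonglongrightarrow> fst (fst a)" "(\<lambda>n. fst (snd (fst (p n)))) \<longlonglongrightarrow> fst (snd (fst a))"
        "(\<lambda>n. snd (snd (fst (p n)))) \<longlonglongrightarrow> snd (snd (fst a))" "(\<lambda>n. snd (p n)) \<longlonglongrightarrow> snd a"
        by (intro tendsto_intros p(2))+
      have 2: "fst (fst (p n)) \<ge> 0" "fst (snd (fst (p n))) \<in> {0..T}" for n
        using p(1)[rule_format, of n] by (auto simp: mem_Times_iff)
      have "(\<lambda>n. g (fst (snd (fst (p n)))) (S (fst (fst (p n))) (snd (snd (fst (p n)))) + snd (p n)))
          \<longlonglongrightarrow> g (fst (snd (fst a))) (S (fst (fst a)) (snd (snd (fst a))) + snd a)"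
        by (rule gc[OF 2(2) _ 1(2) tendsto_add[OF S_tendsto[OF 2(1) 1(1,3)] 1(4)]])
          (use a in \<open>auto simp: mem_Times_iff\<close>)
      then show "(\<lambda>n. case p n of (z, y) \<Rightarrow> F z y) \<longlonglongrightarrow> (case a of (z, y) \<Rightarrow> F z y)"
        by (simp add: F_def case_prod_unfold)
    qed
    show "\<bar>F z y\<bar> \<le> B" if "z \<in> {0..} \<times> {0..T} \<times> UNIV" for z y
      using that B by (auto simp: F_def)
    show "(\<lambda>n. (r n, s n, x n)) \<longlonglongrightarrow> (r', s', x')"
      by (intro tendsto_Pair r s x)
    show "(\<lambda>n. LINT y|\<mu> (r n). f y) \<longlonglongrightarrow> (LINT y|\<mu> r'. f y)" if "f \<in> Cb" for f
      using continuous_on_tendsto_compose[OF \<mu>_cont[OF that] r(2)] r' r(1) by auto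
  qed (use r r' s s' \<mu>_prob \<mu>_sets in auto)
  then show ?thesis by (simp add: mehler_def F_def)
qed

end

section \<open>Derivatives of the semigroup along \<open>H\<close>\<close>

text \<open>A nonnegative function that is small at \<open>x\<close> cannot decrease fast there:
  with a bounded second derivative it would become negative within a step of length
  \<open>r\<close>. The step is left free, to be chosen according to the admissible error.\<close>

lemma landau_nonneg:
  assumes \<iota>: "bounded_linear \<iota>" and f: "smooth_along \<iota> 2 f" "derivs_bounded \<iota> 2 f K" "\<And>x. f x \<ge> 0"
    and r: "r > 0"
  shows "\<bar>dird \<iota> h f x\<bar> \<le> f x / r + K * (norm h)\<^sup>2 * r"
proof -
  have f2: "smooth_along \<iota> (Suc (Suc 0)) f" "derivs_bounded \<iota> (Suc 1) f K"
    using f by (simp_all add: numeral_2_eq_2)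
  have *: "- dird \<iota> h f x \<le> f x / r + K * (norm h)\<^sup>2 * r" for h
  proof -
    obtain z where z: "z > 0" "z < r"
      "f (x + r *\<^sub>R \<iota> h) - f (x + 0 *\<^sub>R \<iota> h) = (r - 0) * dird \<iota> h f (x + z *\<^sub>R \<iota> h)"
      using MVT2[of 0 r "\<lambda>r. f (x + r *\<^sub>R \<iota> h)" "\<lambda>r. dird \<iota> h f (x + r *\<^sub>R \<iota> h)"] r
        smooth_along_DERIV[OF f2(1)] by blast
    have 1: "\<bar>dird \<iota> h f (x + z *\<^sub>R \<iota> h) - dird \<iota> h f x\<bar> \<le> K * (norm h)\<^sup>2 * z"
      using dirds_diff_le[OF _ f2(2), of z "\<lambda>_. h" x h] f2(1) z(1) by (simp add: power2_eq_square)
    then have "0 \<le> K * (norm h)\<^sup>2 * z" by (rule order_trans[OF abs_ge_zero])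
    then have "0 \<le> K * (norm h)\<^sup>2" using z(1) by (simp add: zero_le_mult_iff)
    then have "K * (norm h)\<^sup>2 * z \<le> K * (norm h)\<^sup>2 * r" using z(2) by (intro mult_left_mono) auto
    moreover have "dird \<iota> h f (x + z *\<^sub>R \<iota> h) \<ge> - (f x / r)"
    proof -
      have "r * dird \<iota> h f (x + z *\<^sub>R \<iota> h) \<ge> - f x" using z(3) f(3)[of "x + r *\<^sub>R \<iota> h"] by simp
      then show ?thesis using r by (simp add: field_simps)
    qed
    ultimately show ?thesis using 1 by linarith
  qed
  \<comment> \<open>The opposite direction supplies the other sign.\<close>
  from *[of h] *[of "(-1) *\<^sub>R h"] dird_scaleR[OF \<iota> f2(1), of "-1" h x]
  show ?thesis by simp
qed

context fomin_mehler_semigroup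
begin

text \<open>The absolute value of \<open>\<omega>\<close> gives a bound valid on all of
  \<open>{0..T}\<close>. The 1 accounts for time 0, where \<open>S_on_H\<close> is the identity, and
  makes powers increase with the exponent.\<close>

definition H_bound :: "real \<Rightarrow> real" where
  "H_bound T = max 1 (M * exp (\<bar>\<omega>\<bar> * T))"

text \<open>The restriction of \<open>S t\<close> to \<open>H\<close>, pulled back along
  \<open>\<iota>\<close>. The invariance of \<open>H\<close> is assumed for positive times, so time
  0 is set apart.\<close>

definition S_on_H :: "real \<Rightarrow> 'h \<Rightarrow> 'h" where
  "S_on_H t h = (if t = 0 then h else
     SOME h'. \<iota> h' = S t (\<iota> h) \<and> norm h' \<le> M * exp (\<omega> * t) * norm h)"

lemma \<iota>_S_on_H: "t \<ge> 0 \<Longrightarrow> \<iota> (S_on_H t h) = S t (\<iota> h)"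
  using someI_ex[OF S_H[of t h]] by (auto simp: S_on_H_def S_0)

lemma H_bound_ge_1: "H_bound T \<ge> 1"
  by (simp add: H_bound_def)

lemma exp_\<omega>_le:
  assumes "0 \<le> t" "t \<le> T"
  shows "exp (\<omega> * t) \<le> exp (\<bar>\<omega>\<bar> * T)"
proof -
  have "\<omega> * t \<le> \<bar>\<omega>\<bar> * t" using assms by (intro mult_right_mono) auto
  also have "\<dots> \<le> \<bar>\<omega>\<bar> * T" using assms by (intro mult_left_mono) auto
  finally show ?thesis by simp
qed

lemma norm_S_on_H:
  assumes t: "0 \<le> t" "t \<le> T"
  shows "norm (S_on_H t h) \<le> H_bound T * norm h"
proof (cases "t = 0")
  case True
  then show ?thesis
    using mult_right_mono[OF H_bound_ge_1[of T] norm_ge_zero[of h]] by (simp add: S_on_H_def)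
next
  case False
  then have "norm (S_on_H t h) \<le> M * exp (\<omega> * t) * norm h"
    using someI_ex[OF S_H[of t h]] t by (auto simp: S_on_H_def)
  also have "\<dots> \<le> M * exp (\<bar>\<omega>\<bar> * T) * norm h"
    using exp_\<omega>_le[OF t] constants_pos by (intro mult_right_mono mult_left_mono) auto
  also have "\<dots> \<le> H_bound T * norm h"
    by (intro mult_right_mono) (auto simp: H_bound_def)
  finally show ?thesis .
qed

lemma prod_S_on_H:
  assumes t: "0 \<le> t" "t \<le> T"
  shows "(\<Prod>i<n. norm (S_on_H t (u i))) \<le> H_bound T ^ n * norm_prod n u"
proof -
  have "(\<Prod>i<n. norm (S_on_H t (u i))) \<le> (\<Prod>i<n. H_bound T * norm (u i))"
    by (intro prod_mono) (auto simp: norm_S_on_H[OF t])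
  then show ?thesis by (simp add: prod.distrib)
qed

lemma smooth_along_flow:
  assumes "t \<ge> 0" "smooth_along \<iota> n f"
  shows "smooth_along \<iota> n (\<lambda>x. f (S t x + y))"
    and "j \<le> n \<Longrightarrow> dirds \<iota> j u (\<lambda>x. f (S t x + y)) = (\<lambda>x. dirds \<iota> j (\<lambda>i. S_on_H t (u i)) f (S t x + y))"
  using smooth_along_affine[where \<iota>=\<iota> and \<kappa>=\<iota> and L="S_on_H t" and z=y,
      OF assms(2) blinfun.bounded_linear_right[of "S t"]]
    \<iota>_S_on_H[OF assms(1)] by simp_all

lemma flow_dominated:
  assumes t: "t \<ge> 0" and f: "smooth_along \<iota> n f" and j: "j \<le> n"
  shows "\<exists>c. integrable (\<mu> t) c \<and> (\<forall>y x. \<bar>dirds \<iota> j u (\<lambda>x. f (S t x + y)) x\<bar> \<le> c y)"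
proof -
  interpret prob_space "\<mu> t" by (rule \<mu>_prob[OF t])
  obtain B where B: "\<And>x. \<bar>dirds \<iota> j (\<lambda>i. S_on_H t (u i)) f x\<bar> \<le> B"
    using CbD(3)[OF dirds_Cb[OF f j]] by blast
  then show ?thesis
    by (intro exI[of _ "\<lambda>_. B"]) (simp add: smooth_along_flow(2)[OF t f j])
qed

text \<open>No smoothing yet: the derivatives fall on \<open>f\<close>, in directions moved by
  \<open>S t\<close>. This serves for Zygmund data, and also at order one for
  \<open>Pt (t / 2) f\<close> in place of \<open>f\<close>, once that function is known to be
  differentiable.\<close>

lemma smooth_along_mehler:
  assumes t: "t \<ge> 0" and f: "smooth_along \<iota> n f"
  shows "smooth_along \<iota> n (Pt t f)"
    and "j \<le> n \<Longrightarrow> dirds \<iota> j u (Pt t f) = Pt t (dirds \<iota> j (\<lambda>i. S_on_H t (u i)) f)"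
proof -
  have m: "(\<lambda>y. f (S t x + y)) \<in> borel_measurable (\<mu> t)" for x
    by (intro Cb_measurable_\<mu> Cb_shift t smooth_along_Cb[OF f])
  note int = smooth_along_integral[OF smooth_along_flow(1)[OF t f] m flow_dominated[OF t f]]
  show "smooth_along \<iota> n (Pt t f)"
    unfolding mehler_def[abs_def] by (rule int(1))
  show "dirds \<iota> j u (Pt t f) = Pt t (dirds \<iota> j (\<lambda>i. S_on_H t (u i)) f)" if "j \<le> n"
    using int(2)[of j u] that unfolding mehler_def[abs_def] by (simp add: smooth_along_flow(2)[OF t f])
qed

text \<open>Meant for the initial datum, where time 0 is allowed and the continuity has to come from
  \<open>f\<close> itself.\<close>

lemma norm_cont_mehler:
  assumes t: "t \<ge> 0" and f: "smooth_along \<iota> n f" "derivs_bounded \<iota> n f B" "B \<ge> 0"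
    and nc: "\<And>x. norm_cont \<iota> n f x"
  shows "norm_cont \<iota> n (Pt t f) x"
proof -
  interpret prob_space "\<mu> t" by (rule \<mu>_prob[OF t])
  have m: "(\<lambda>y. f (S t x + y)) \<in> borel_measurable (\<mu> t)" for x
    by (intro Cb_measurable_\<mu> Cb_shift t smooth_along_Cb[OF f(1)])
  let ?K = "H_bound t ^ n"
  have K: "?K > 0" using H_bound_ge_1[of t] by simp
  show ?thesis
    unfolding mehler_def[abs_def]
  proof (rule norm_cont_integral[OF incl_bounded_linear smooth_along_flow(1)[OF t f(1)] m flow_dominated[OF t f(1)],
        where c="\<lambda>_. B * ?K"])
    fix y
    show "derivs_bounded \<iota> n (\<lambda>x. f (S t x + y)) (B * ?K)"
      unfolding derivs_bounded_def smooth_along_flow(2)[OF t f(1) order_refl]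
    proof (intro allI)
      fix u x
      have "\<bar>dirds \<iota> n (\<lambda>i. S_on_H t (u i)) f (S t x + y)\<bar> \<le> B * (\<Prod>i<n. norm (S_on_H t (u i)))"
        using f(2) by (simp add: derivs_bounded_def)
      also have "\<dots> \<le> B * (?K * norm_prod n u)"
        by (intro mult_left_mono prod_S_on_H f(3)) (use t in auto)
      finally show "\<bar>dirds \<iota> n (\<lambda>i. S_on_H t (u i)) f (S t x + y)\<bar> \<le> B * ?K * norm_prod n u"
        by (simp add: mult_ac)
    qed
    show "norm_cont \<iota> n (\<lambda>x. f (S t x + y)) x"
      unfolding norm_cont_def smooth_along_flow(2)[OF t f(1) order_refl]
    proof (intro allI impI)
      fix e :: real assume e: "e > 0"
      have lim: "filterlim (\<lambda>z. S t z + y) (nhds (S t x + y)) (nhds x)"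
        by (intro tendsto_intros tendsto_ident_at) (simp add: filterlim_ident)
      have "\<forall>\<^sub>F z in nhds (S t x + y). \<forall>u. \<bar>dirds \<iota> n u f z - dirds \<iota> n u f (S t x + y)\<bar>
          \<le> (e / ?K) * norm_prod n u"
        by (rule nc[unfolded norm_cont_def, rule_format]) (use e K in simp)
      from eventually_compose_filterlim[OF this lim]
      show "\<forall>\<^sub>F z in nhds x. \<forall>u. \<bar>dirds \<iota> n (\<lambda>i. S_on_H t (u i)) f (S t z + y) -
          dirds \<iota> n (\<lambda>i. S_on_H t (u i)) f (S t x + y)\<bar> \<le> e * norm_prod n u"
      proof eventually_elim
        case (elim z)
        show ?case
        proof
          fix u
          have "\<bar>dirds \<iota> n (\<lambda>i. S_on_H t (u i)) f (S t z + y) - dirds \<iota> n (\<lambda>i. S_on_H t (u i)) f (S t x + y)\<bar>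
              \<le> (e / ?K) * (\<Prod>i<n. norm (S_on_H t (u i)))"
            using elim by blast
          also have "\<dots> \<le> (e / ?K) * (?K * norm_prod n u)"
            by (intro mult_left_mono prod_S_on_H) (use t e K in auto)
          finally show "\<bar>dirds \<iota> n (\<lambda>i. S_on_H t (u i)) f (S t z + y) - dirds \<iota> n (\<lambda>i. S_on_H t (u i)) f (S t x + y)\<bar>
              \<le> e * norm_prod n u" using H_bound_ge_1[of t] by (simp split: if_splits)
        qed
      qed
    qed
  qed auto
qed

definition C_bound :: "real \<Rightarrow> real" where
  "C_bound T = C * exp (\<bar>\<omega>\<bar> * T)"

lemma C_bound_pos: "C_bound T > 0"
  using constants_pos by (simp add: C_bound_def)

text \<open>Moving \<open>x\<close> by \<open>\<iota> h\<close> shifts the integrand by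
  \<open>S t (\<iota> h)\<close>, a direction of Fomin differentiability of \<open>\<mu> t\<close>,
  so the derivative can be taken of the measure. The density is chosen for each \<open>h\<close>
  separately; with \<open>h\<close> fixed, continuity in \<open>x\<close> follows from that of
  \<open>f\<close> by dominated convergence.\<close>

lemma mehler_dird:
  assumes t: "0 < t" "t \<le> T" and f: "f \<in> Cb" "\<And>x. \<bar>f x\<bar> \<le> b"
  shows "smooth_along \<iota> 1 (Pt t f)"
    and "\<bar>dird \<iota> h (Pt t f) x\<bar> \<le> C_bound T * t powr (- \<theta>) * norm h * b"
proof -
  interpret prob_space "\<mu> t" using \<mu>_prob t by simp
  interpret \<iota>: bounded_linear \<iota> by (rule incl_bounded_linear)
  have t0: "t \<ge> 0" using t by simp
  have b: "b \<ge> 0" using f(2)[of 0] by simp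
  have "\<exists>\<beta>. fomin_density (\<mu> t) (S t (\<iota> h)) \<beta> \<and>
      (LINT x|\<mu> t. \<bar>\<beta> x\<bar>) \<le> C * exp (\<omega> * t) * t powr (- \<theta>) * norm h" for h
    using density_bound t by simp
  then obtain \<beta> where \<beta>: "\<And>h. fomin_density (\<mu> t) (S t (\<iota> h)) (\<beta> h)"
    "\<And>h. (LINT x|\<mu> t. \<bar>\<beta> h x\<bar>) \<le> C * exp (\<omega> * t) * t powr (- \<theta>) * norm h"
    by metis
  have \<beta>i: "integrable (\<mu> t) (\<beta> h)" for h using \<beta>(1) by (simp add: fomin_density_def)
  have d: "((\<lambda>r. Pt t f (x + r *\<^sub>R \<iota> h)) has_real_derivative
      - (LINT y|\<mu> t. f (S t x + y) * \<beta> h y)) (at 0)" for x h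
  proof -
    have "((\<lambda>r. LINT y|\<mu> t. (\<lambda>y. f (S t x + y)) (y + r *\<^sub>R S t (\<iota> h))) has_real_derivative
      - (LINT y|\<mu> t. f (S t x + y) * \<beta> h y)) (at 0)"
      by (rule fomin_DERIV[OF \<mu>_prob[OF t0] \<mu>_sets[OF t0] \<beta>(1), where B=b])
        (intro Cb_borel Cb_shift f)+
    then show ?thesis
      by (simp add: mehler_def blinfun.add_right blinfun.scaleR_right add_ac)
  qed
  have e: "dird \<iota> h (Pt t f) = (\<lambda>x. - (LINT y|\<mu> t. f (S t x + y) * \<beta> h y))" for h
    by (rule ext, rule dird_eqI, rule d)
  have m: "(\<lambda>y. f (S t x + y) * \<beta> h y) \<in> borel_measurable (\<mu> t)" for x h
    by (intro borel_measurable_times borel_measurable_integrable[OF \<beta>i] Cb_measurable_\<mu> t0 Cb_shift f)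
  have le: "\<bar>f (S t x + y) * \<beta> h y\<bar> \<le> b * \<bar>\<beta> h y\<bar>" for x y h
    unfolding abs_mult by (intro mult_right_mono f) simp
  have ic: "integrable (\<mu> t) (\<lambda>y. b * \<bar>\<beta> h y\<bar>)" for h using \<beta>i by simp
  have "(\<lambda>x. LINT y|\<mu> t. f (S t x + y) * \<beta> h y) \<in> Cb" for h
  proof (rule Cb_integral[OF _ m ic le])
    fix y
    have "(\<lambda>x. f (S t x + y)) \<in> Cb"
      using smooth_along_flow(1)[OF t0, of 0 f y] f by simp
    from Cb_linear[OF this Cb_const, of "\<beta> h y" 0] show "(\<lambda>x. f (S t x + y) * \<beta> h y) \<in> Cb"
      by (simp add: mult.commute)
  qed
  from Cb_linear[OF this Cb_const, of "-1" _ 0]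
  have "dird \<iota> h (Pt t f) \<in> Cb" for h by (simp add: e)
  then show "smooth_along \<iota> 1 (Pt t f)"
    using d e mehler_Cb[OF t0 f(1)] by simp
  have "\<bar>dird \<iota> h (Pt t f) x\<bar> \<le> (LINT y|\<mu> t. b * \<bar>\<beta> h y\<bar>)"
    using integrable_real_bound(2)[OF m ic le] by (simp add: e)
  also have "\<dots> \<le> b * (C * exp (\<omega> * t) * t powr (- \<theta>) * norm h)"
    using \<beta>(2)[of h] b by (simp add: mult_left_mono)
  also have "\<dots> \<le> b * (C * exp (\<bar>\<omega>\<bar> * T) * t powr (- \<theta>) * norm h)"
    using exp_\<omega>_le[OF t0 t(2)] constants_pos b
    by (intro mult_left_mono mult_right_mono) auto
  finally show "\<bar>dird \<iota> h (Pt t f) x\<bar> \<le> C_bound T * t powr (- \<theta>) * norm h * b"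
    by (simp add: C_bound_def mult_ac)
qed

section \<open>Derivatives of every order by halving the time\<close>

lemma mehler_half:
  assumes "t > 0" "f \<in> Cb"
  shows "Pt t f = Pt (t / 2) (Pt (t / 2) f)"
  using mehler_add[of "t / 2" "t / 2" f] assms by simp

text \<open>One half of the time pays for the innermost derivative; the other half is left for all
  further ones.\<close>

lemma dird_mehler_half:
  assumes t: "0 < t" "t \<le> T" and f: "f \<in> Cb"
  shows "dird \<iota> h (Pt t f) =
    Pt (t / 2) (dird \<iota> (S_on_H (t / 2) h) (Pt (t / 2) f))"
proof -
  obtain b where b: "\<And>x. \<bar>f x\<bar> \<le> b" using CbD(3)[OF f] by auto
  have s: "smooth_along \<iota> (Suc 0) (Pt (t / 2) f)"
    using mehler_dird(1)[of "t / 2" T f b] t f b by simp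
  have "t / 2 \<ge> 0" using t by simp
  from smooth_along_mehler(2)[OF this s order_refl, of "\<lambda>_. h"]
  show ?thesis by (simp add: mehler_half[OF t(1) f])
qed

lemma mehler_smoothing:
  "\<exists>c\<ge>0. \<forall>t f b. 0 < t \<longrightarrow> t \<le> T \<longrightarrow> f \<in> Cb \<longrightarrow> (\<forall>x. \<bar>f x\<bar> \<le> b) \<longrightarrow>
     smooth_along \<iota> n (Pt t f) \<and>
     derivs_bounded \<iota> n (Pt t f) (c * t powr (- (real n * \<theta>)) * b)"
proof (induction n)
  case 0
  show ?case
    by (intro exI[of _ 1]) (auto simp: derivs_bounded_def mehler_Cb intro!: mehler_bound)
next
  case (Suc n)
  then obtain c where c: "c \<ge> 0"
    "\<And>t f b. 0 < t \<Longrightarrow> t \<le> T \<Longrightarrow> f \<in> Cb \<Longrightarrow> (\<And>x. \<bar>f x\<bar> \<le> b) \<Longrightarrow>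
     smooth_along \<iota> n (Pt t f) \<and>
     derivs_bounded \<iota> n (Pt t f) (c * t powr (- (real n * \<theta>)) * b)"
    by blast
  \<comment> \<open>\<open>C_bound T\<close> comes from the innermost derivative,
    \<open>H_bound T\<close> from its direction moved by \<open>S_on_H (t / 2)\<close>, and the
    power of 2 from expressing the powers of \<open>t / 2\<close> through \<open>t\<close>.\<close>
  define c' where "c' = c * C_bound T * H_bound T * 2 powr (real (Suc n) * \<theta>)"
  have "smooth_along \<iota> (Suc n) (Pt t f) \<and>
     derivs_bounded \<iota> (Suc n) (Pt t f) (c' * t powr (- (real (Suc n) * \<theta>)) * b)"
    if t: "0 < t" "t \<le> T" and f: "f \<in> Cb" "\<And>x. \<bar>f x\<bar> \<le> b" for t f b
  proof
    have b: "b \<ge> 0" using f(2)[of 0] by simp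
    define G where "G = (\<lambda>h. dird \<iota> (S_on_H (t / 2) h) (Pt (t / 2) f))"
    have t2: "0 < t / 2" "t / 2 \<le> T" using t by auto
    have e: "dird \<iota> h (Pt t f) = Pt (t / 2) (G h)" for h
      unfolding G_def by (rule dird_mehler_half[OF t f(1)])
    have G: "G h \<in> Cb" for h
      using mehler_dird(1)[OF t2 f] by (simp add: G_def)
    let ?g = "\<lambda>h. C_bound T * (t / 2) powr (- \<theta>) * (H_bound T * norm h) * b"
    have GB: "\<bar>G h x\<bar> \<le> ?g h" for h x
    proof -
      have "\<bar>G h x\<bar> \<le> C_bound T * (t / 2) powr (- \<theta>) * norm (S_on_H (t / 2) h) * b"
        unfolding G_def by (rule mehler_dird(2)[OF t2 f])
      also have "\<dots> \<le> ?g h"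
        using t2 b C_bound_pos[of T] by (intro mult_right_mono mult_left_mono norm_S_on_H) auto
      finally show ?thesis .
    qed
    show "smooth_along \<iota> (Suc n) (Pt t f)"
      using mehler_dird(1)[OF t f] c(2)[OF t2 G GB] by (simp add: e)
    show "derivs_bounded \<iota> (Suc n) (Pt t f) (c' * t powr (- (real (Suc n) * \<theta>)) * b)"
      unfolding derivs_bounded_def
    proof (intro allI)
      fix u x
      have "\<bar>dirds \<iota> (Suc n) u (Pt t f) x\<bar> = \<bar>dirds \<iota> n u (Pt (t / 2) (G (u n))) x\<bar>"
        by (simp add: e)
      also have "\<dots> \<le> c * (t / 2) powr (- (real n * \<theta>)) * ?g (u n) * norm_prod n u"
        using c(2)[OF t2 G GB] by (auto simp: derivs_bounded_def)
      also have "\<dots> = c * C_bound T * H_bound T * ((t / 2) powr (- (real n * \<theta>)) * (t / 2) powr (- \<theta>)) * b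
          * norm_prod (Suc n) u"
        by (simp add: mult_ac)
      also have "(t / 2) powr (- (real n * \<theta>)) * (t / 2) powr (- \<theta>) =
          2 powr (real (Suc n) * \<theta>) * t powr (- (real (Suc n) * \<theta>))"
        using t by (simp add: powr_add[symmetric] powr_divide powr_minus field_simps)
      finally show "\<bar>dirds \<iota> (Suc n) u (Pt t f) x\<bar> \<le>
          c' * t powr (- (real (Suc n) * \<theta>)) * b * norm_prod (Suc n) u"
        by (simp add: c'_def mult_ac)
    qed
  qed
  moreover have "c' \<ge> 0"
    using c(1) C_bound_pos[of T] H_bound_ge_1[of T] by (simp add: c'_def)
  ultimately show ?case by blast
qed

lemma mehler_smooth:
  assumes "t > 0" "f \<in> Cb"
  shows "smooth_along \<iota> n (Pt t f)"
  using mehler_smoothing[of t n] CbD(3)[OF assms(2)] assms by blast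

text \<open>Landau's inequality needs nonnegative functions, so \<open>f\<close> is written as the
  difference of \<open>f + \<bar>f\<bar>\<close> and \<open>\<bar>f\<bar>\<close>. The gain is that
  the derivative is small wherever \<open>Pt t\<close> of \<open>\<bar>f\<bar>\<close> is small,
  with a constant common to all \<open>f\<close> bounded by \<open>B\<close>, all points and all
  directions of norm at most \<open>R\<close>.\<close>

lemma mehler_landau_step:
  assumes t: "t > 0" and e: "e > 0" and R: "R \<ge> 0"
  shows "\<exists>c\<ge>0. \<forall>f h x. f \<in> Cb \<longrightarrow> (\<forall>x. \<bar>f x\<bar> \<le> B) \<longrightarrow> norm h \<le> R \<longrightarrow>
    \<bar>dird \<iota> h (Pt t f) x\<bar> \<le> c * Pt t (\<lambda>x. \<bar>f x\<bar>) x + e"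
proof -
  have t0: "t \<ge> 0" using t by simp
  obtain c where c: "c \<ge> 0" "\<And>f b. f \<in> Cb \<Longrightarrow> (\<And>x. \<bar>f x\<bar> \<le> b) \<Longrightarrow>
     smooth_along \<iota> 2 (Pt t f) \<and> derivs_bounded \<iota> 2 (Pt t f) (c * t powr (- (real 2 * \<theta>)) * b)"
    using mehler_smoothing[of t 2] t by blast
  define K where "K = c * t powr (- (real 2 * \<theta>)) * (2 * \<bar>B\<bar>)"
  have K: "K \<ge> 0" using c(1) by (simp add: K_def)
  \<comment> \<open>With this step the second derivative contributes at most \<open>e / 2\<close>,
    so the two nonnegative functions below contribute \<open>e\<close> together.\<close>
  define r where "r = e / (2 * (K * R\<^sup>2 + 1))"
  have KR: "K * R\<^sup>2 + 1 > 0" using K by (simp add: add_nonneg_pos)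
  have r: "r > 0" "K * R\<^sup>2 * r \<le> e / 2"
    using e KR K by (simp_all add: r_def field_simps)
  have pos: "\<bar>dird \<iota> h (Pt t f) x\<bar> \<le> Pt t f x / r + e / 2"
    if f: "f \<in> Cb" "\<And>x. \<bar>f x\<bar> \<le> 2 * \<bar>B\<bar>" "\<And>x. f x \<ge> 0" and h: "norm h \<le> R" for f h x
  proof -
    have nn: "Pt t f x \<ge> 0" for x
      using mehler_mono[OF t0 Cb_const[of 0] f(1) f(3), of x] by (simp add: mehler_const[OF t0])
    have "\<bar>dird \<iota> h (Pt t f) x\<bar> \<le> Pt t f x / r + K * (norm h)\<^sup>2 * r"
      by (rule landau_nonneg[OF incl_bounded_linear _ _ nn r(1)]) (use c(2)[OF f(1,2)] in \<open>auto simp: K_def\<close>)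
    also have "K * (norm h)\<^sup>2 * r \<le> K * R\<^sup>2 * r"
      using K r h by (intro mult_left_mono mult_right_mono power_mono) auto
    finally show ?thesis using r(2) by simp
  qed
  \<comment> \<open>The 3 is 2 for \<open>f + \<bar>f\<bar>\<close>, which is at most
    \<open>2 * \<bar>f\<bar>\<close>, plus 1 for \<open>\<bar>f\<bar>\<close>.\<close>
  have "\<bar>dird \<iota> h (Pt t f) x\<bar> \<le> (3 / r) * Pt t (\<lambda>x. \<bar>f x\<bar>) x + e"
    if f: "f \<in> Cb" "\<And>x. \<bar>f x\<bar> \<le> B" and h: "norm h \<le> R" for f h x
  proof -
    let ?a = "\<lambda>x. \<bar>f x\<bar>" and ?p = "\<lambda>x. 1 * f x + 1 * \<bar>f x\<bar>"
    have B: "\<bar>f x\<bar> \<le> \<bar>B\<bar>" for x using f(2)[of x] by linarith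
    have a: "?a \<in> Cb" and p: "?p \<in> Cb" by (intro Cb_abs Cb_linear f)+
    have bp: "\<bar>?p x\<bar> \<le> 2 * \<bar>B\<bar>" for x using B[of x] by linarith
    have ba: "\<bar>?a x\<bar> \<le> 2 * \<bar>B\<bar>" for x using B[of x] by linarith
    have s: "smooth_along \<iota> 1 (Pt t g)" if "g \<in> Cb" for g
      using mehler_dird(1)[OF t order_refl that] CbD(3)[OF that] by blast
    have "Pt t f = Pt t (\<lambda>x. 1 * ?p x + (-1) * ?a x)" by simp
    also have "\<dots> = (\<lambda>x. 1 * Pt t ?p x + (-1) * Pt t ?a x)"
      by (rule ext, rule mehler_linear[OF t0 p a])
    finally have "dirds \<iota> 1 (\<lambda>_. h) (Pt t f) x =
        dirds \<iota> 1 (\<lambda>_. h) (Pt t ?p) x - dirds \<iota> 1 (\<lambda>_. h) (Pt t ?a) x"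
      using smooth_along_linear(2)[OF s[OF p] s[OF a] order_refl, of "\<lambda>_. h" 1 "-1"] by simp
    then have "dird \<iota> h (Pt t f) x = dird \<iota> h (Pt t ?p) x - dird \<iota> h (Pt t ?a) x"
      by simp
    then have "\<bar>dird \<iota> h (Pt t f) x\<bar> \<le> \<bar>dird \<iota> h (Pt t ?p) x\<bar> + \<bar>dird \<iota> h (Pt t ?a) x\<bar>"
      by linarith
    also have "\<dots> \<le> (Pt t ?p x / r + e / 2) + (Pt t ?a x / r + e / 2)"
      using ba bp by (intro add_mono pos a p h) auto
    finally have le: "\<bar>dird \<iota> h (Pt t f) x\<bar> \<le>
      (Pt t ?p x / r + e / 2) + (Pt t ?a x / r + e / 2)" .
    have "Pt t ?p x \<le> 2 * Pt t ?a x"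
      unfolding mehler_linear[OF t0 f(1) a] using mehler_abs_le[OF t0 f(1), of x] by simp
    then have "Pt t ?p x / r \<le> 2 * Pt t ?a x / r"
      using r(1) by (intro divide_right_mono) auto
    with le show ?thesis by simp
  qed
  then show ?thesis using r(1) by (intro exI[of _ "3 / r"]) simp
qed

text \<open>The pointwise bound by \<open>Pt t\<close> of \<open>\<bar>f\<bar>\<close> survives
  iteration because the semigroup is monotone: it is applied to the innermost derivative at time
  \<open>t / 2\<close>, and the outer \<open>Pt (t / 2)\<close> carries it over.\<close>

lemma mehler_landau:
  assumes "t > 0" "e > 0" "R \<ge> 0"
  shows "\<exists>c\<ge>0. \<forall>f u x. f \<in> Cb \<longrightarrow> (\<forall>x. \<bar>f x\<bar> \<le> B) \<longrightarrow> (\<forall>i. norm (u i) \<le> R) \<longrightarrow>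
    \<bar>dirds \<iota> n u (Pt t f) x\<bar> \<le> c * Pt t (\<lambda>x. \<bar>f x\<bar>) x + e"
  using assms
proof (induction n arbitrary: t e B)
  case 0
  then show ?case
    using mehler_abs_le[of t] by (intro exI[of _ 1]) (auto intro: add_increasing2)
next
  case (Suc n)
  let ?s = "t / 2"
  have s: "?s > 0" "?s \<ge> 0" using Suc.prems by auto
  \<comment> \<open>A uniform bound for the innermost derivative in the moved direction; the
    induction hypothesis asks for it before fixing its constant.\<close>
  define B' where "B' = C_bound ?s * ?s powr (- \<theta>) * (H_bound ?s * R) * \<bar>B\<bar>"
  obtain c1 where c1: "c1 \<ge> 0" "\<And>f u x. f \<in> Cb \<Longrightarrow> (\<And>x. \<bar>f x\<bar> \<le> B') \<Longrightarrow> (\<And>i. norm (u i) \<le> R) \<Longrightarrow>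
    \<bar>dirds \<iota> n u (Pt ?s f) x\<bar> \<le> c1 * Pt ?s (\<lambda>x. \<bar>f x\<bar>) x + e / 2"
    using Suc.IH[of ?s "e / 2" B'] Suc.prems by auto
  \<comment> \<open>The outer estimate multiplies the inner error by \<open>c1\<close>, so the
    latter is made small enough for the product to stay below \<open>e / 2\<close>.\<close>
  define e' where "e' = e / (2 * (c1 + 1))"
  have e': "e' > 0" "c1 * e' \<le> e / 2" using Suc.prems c1(1) by (simp_all add: e'_def field_simps)
  have "H_bound ?s * R \<ge> 0" using H_bound_ge_1[of ?s] Suc.prems by simp
  from mehler_landau_step[OF s(1) e'(1) this, of B]
  obtain c2 where c2: "c2 \<ge> 0" "\<And>f h x. f \<in> Cb \<Longrightarrow> (\<And>x. \<bar>f x\<bar> \<le> B) \<Longrightarrow> norm h \<le> H_bound ?s * R \<Longrightarrow>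
    \<bar>dird \<iota> h (Pt ?s f) x\<bar> \<le> c2 * Pt ?s (\<lambda>x. \<bar>f x\<bar>) x + e'"
    by blast
  have "\<bar>dirds \<iota> (Suc n) u (Pt t f) x\<bar> \<le> (c1 * c2) * Pt t (\<lambda>x. \<bar>f x\<bar>) x + e"
    if f: "f \<in> Cb" "\<And>x. \<bar>f x\<bar> \<le> B" and u: "\<And>i. norm (u i) \<le> R" for f u x
  proof -
    define G where "G = dird \<iota> (S_on_H ?s (u n)) (Pt ?s f)"
    have B: "\<bar>f x\<bar> \<le> \<bar>B\<bar>" for x using f(2)[of x] by linarith
    have nu: "norm (S_on_H ?s (u n)) \<le> H_bound ?s * R"
      by (rule order_trans[OF norm_S_on_H[OF s(2) order_refl]])
        (use u H_bound_ge_1[of ?s] in \<open>intro mult_left_mono; simp\<close>)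
    have G: "G \<in> Cb" using mehler_dird(1)[OF s(1) order_refl f] by (simp add: G_def)
    have GB: "\<bar>G x\<bar> \<le> B'" for x
    proof -
      have "\<bar>G x\<bar> \<le> C_bound ?s * ?s powr (- \<theta>) * norm (S_on_H ?s (u n)) * \<bar>B\<bar>"
        unfolding G_def by (rule mehler_dird(2)[OF s(1) order_refl f(1) B])
      also have "\<dots> \<le> B'"
        unfolding B'_def using nu C_bound_pos[of ?s] by (intro mult_right_mono mult_left_mono) auto
      finally show ?thesis .
    qed
    have fa: "Pt ?s (\<lambda>x. \<bar>f x\<bar>) \<in> Cb" by (intro mehler_Cb s Cb_abs f)
    have "Pt ?s (\<lambda>x. \<bar>G x\<bar>) x \<le> Pt ?s (\<lambda>x. c2 * Pt ?s (\<lambda>x. \<bar>f x\<bar>) x + e' * 1) x"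
      by (intro mehler_mono s Cb_abs G Cb_linear Cb_const fa) (use c2(2)[OF f nu] in \<open>simp add: G_def\<close>)
    also have "\<dots> = c2 * Pt t (\<lambda>x. \<bar>f x\<bar>) x + e'"
      using mehler_half[OF Suc.prems(1) Cb_abs[OF f(1)]]
      by (simp add: mehler_linear[OF s(2) fa Cb_const] mehler_const[OF s(2)] del: mult_1_right)
    finally have le: "Pt ?s (\<lambda>x. \<bar>G x\<bar>) x \<le> c2 * Pt t (\<lambda>x. \<bar>f x\<bar>) x + e'" .
    have "\<bar>dirds \<iota> (Suc n) u (Pt t f) x\<bar> = \<bar>dirds \<iota> n u (Pt ?s G) x\<bar>"
      by (simp add: dird_mehler_half[OF Suc.prems(1) order_refl f(1)] G_def)
    also have "\<dots> \<le> c1 * Pt ?s (\<lambda>x. \<bar>G x\<bar>) x + e / 2" by (rule c1(2)[OF G GB u])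
    also have "\<dots> \<le> c1 * (c2 * Pt t (\<lambda>x. \<bar>f x\<bar>) x + e') + e / 2"
      using le c1(1) by (intro add_right_mono mult_left_mono)
    also have "\<dots> \<le> (c1 * c2) * Pt t (\<lambda>x. \<bar>f x\<bar>) x + e"
      using e'(2) by (simp add: algebra_simps)
    finally show ?thesis .
  qed
  then show ?case using c1(1) c2(1) by (intro exI[of _ "c1 * c2"]) simp
qed

text \<open>
  By the previous lemma this holds although the densities of the measures differentiated along
  the unit ball of \<open>H\<close> are not assumed to be uniformly integrable.
\<close>

lemma norm_cont_mehler_pos:
  assumes t: "t > 0" and f: "f \<in> Cb"
  shows "norm_cont \<iota> n (Pt t f) x"
  unfolding norm_cont_def
proof (intro allI impI)
  fix e :: real assume e: "e > 0"
  have t0: "t \<ge> 0" using t by simp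
  interpret prob_space "\<mu> t" by (rule \<mu>_prob[OF t0])
  obtain B where B: "\<And>x. \<bar>f x\<bar> \<le> B" using CbD(3)[OF f] by auto
  have sm: "smooth_along \<iota> n (Pt t f)" by (rule mehler_smooth[OF t f])
  obtain c where c: "c \<ge> 0" "\<And>f u x. f \<in> Cb \<Longrightarrow> (\<And>x. \<bar>f x\<bar> \<le> 2 * B) \<Longrightarrow> (\<And>i. norm (u i) \<le> 1) \<Longrightarrow>
    \<bar>dirds \<iota> n u (Pt t f) x\<bar> \<le> c * Pt t (\<lambda>x. \<bar>f x\<bar>) x + e / 2"
    using mehler_landau[OF t, of "e / 2" 1 "2 * B" n] e by auto
  \<comment> \<open>\<open>Pt t (?p y)\<close> at \<open>x\<close> is the increment of
    \<open>Pt t f\<close> from \<open>x\<close> to \<open>y\<close>. Its derivatives are thus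
    controlled by \<open>?D y\<close>, which depends continuously on \<open>y\<close> by dominated
    convergence and vanishes at \<open>x\<close>.\<close>
  let ?p = "\<lambda>y w. f (w + S t (y - x)) - f w"
  have p: "?p y \<in> Cb" for y
    using Cb_linear[OF Cb_shift(2)[OF f] f, of 1 _ "-1"] by simp
  have pB: "\<bar>?p y w\<bar> \<le> 2 * B" for y w using B[of "w + S t (y - x)"] B[of w] by linarith
  let ?D = "\<lambda>y. LINT w|\<mu> t. \<bar>f (S t y + w) - f (S t x + w)\<bar>"
  have D: "Pt t (\<lambda>w. \<bar>?p y w\<bar>) x = ?D y" for y
    by (simp add: mehler_def blinfun.diff_right add_ac)
  have DCb: "(\<lambda>y. \<bar>f (S t y + w) - f (S t x + w)\<bar>) \<in> Cb" for w
  proof -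
    have "(\<lambda>y. f (S t y + w)) \<in> Cb" using smooth_along_flow(1)[OF t0, of 0 f w] f by simp
    from Cb_abs[OF Cb_linear[OF this Cb_const, of 1 1 "- f (S t x + w)"]] show ?thesis by simp
  qed
  have "?D \<in> Cb"
  proof (rule Cb_integral[OF DCb, where c="\<lambda>_. 2 * B"])
    show "(\<lambda>w. \<bar>f (S t y + w) - f (S t x + w)\<bar>) \<in> borel_measurable (\<mu> t)" for y
      using Cb_measurable_\<mu>[OF t0 Cb_shift(1)[OF f]] by auto
    show "\<bar>\<bar>f (S t y + w) - f (S t x + w)\<bar>\<bar> \<le> 2 * B" for w y
      using B[of "S t y + w"] B[of "S t x + w"] by linarith
  qed simp
  then have "isCont ?D x" by (rule CbD(2))
  then have "(?D \<longlongrightarrow> ?D x) (nhds x)"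
    unfolding isCont_def by (rule tendsto_at_iff_tendsto_nhds[THEN iffD1])
  moreover have "?D x < e / (2 * (c + 1))" using e c(1) by simp
  ultimately have "\<forall>\<^sub>F y in nhds x. ?D y < e / (2 * (c + 1))" by (rule order_tendstoD(2))
  then show "\<forall>\<^sub>F y in nhds x. \<forall>u. \<bar>dirds \<iota> n u (Pt t f) y - dirds \<iota> n u (Pt t f) x\<bar>
      \<le> e * norm_prod n u"
  proof eventually_elim
    case (elim y)
    have "c * ?D y \<le> c * (e / (2 * (c + 1)))" using elim c(1) by (intro mult_left_mono) auto
    also have "\<dots> \<le> e / 2" using e c(1) by (simp add: field_simps)
    finally have cD: "c * ?D y \<le> e / 2" .
    have sh: "Pt t (?p y) = (\<lambda>z. Pt t f (z + (y - x)) - Pt t f z)"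
      by (rule ext, rule mehler_shift[OF t0 f])
    show ?case
    proof (rule allI, rule homogeneous_bound[where Q="\<lambda>u. dirds \<iota> n u (Pt t f) y - dirds \<iota> n u (Pt t f) x"])
      fix u :: "nat \<Rightarrow> 'h" assume u: "\<And>i. norm (u i) \<le> 1"
      have "dirds \<iota> n u (Pt t f) y - dirds \<iota> n u (Pt t f) x = dirds \<iota> n u (Pt t (?p y)) x"
        unfolding sh smooth_along_diff(2)[OF sm order_refl] by simp
      also have "\<bar>\<dots>\<bar> \<le> c * Pt t (\<lambda>w. \<bar>?p y w\<bar>) x + e / 2"
        by (rule c(2)[OF p pB u])
      also have "\<dots> \<le> e" using cD by (simp only: D)
      finally show "\<bar>dirds \<iota> n u (Pt t f) y - dirds \<iota> n u (Pt t f) x\<bar> \<le> e" .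
    qed (simp add: dirds_scaleR[OF incl_bounded_linear sm] right_diff_distrib)
  qed
qed

end

section \<open>The spaces \<open>C\<^sup>n\<^sub>H(X)\<close> and \<open>Z\<^sup>n\<^sub>H(X)\<close>\<close>

lemma multilinear_formsD:
  assumes "A \<in> multilinear_forms n"
  shows "(\<And>i. i < n \<Longrightarrow> u i = u' i) \<Longrightarrow> A u = A u'"
    and "i < n \<Longrightarrow> linear (\<lambda>v. A (u(i := v)))"
    and "continuous_on UNIV A"
  using assms unfolding multilinear_forms_def by blast+

lemma multilinear_forms_zero:
  assumes "A \<in> multilinear_forms n" "i < n" "u i = 0"
  shows "A u = 0"
  using linear_0[OF multilinear_formsD(2)[OF assms(1,2), of u]] assms(3) by (metis fun_upd_triv)

lemma multilinear_forms_scaleR: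
  assumes A: "A \<in> multilinear_forms n"
  shows "A (\<lambda>i. c i *\<^sub>R u i) = (\<Prod>i<n. c i) * A u"
proof -
  have "A (\<lambda>i. if i < m then c i *\<^sub>R u i else u i) = (\<Prod>i<m. c i) * A u" if "m \<le> n" for m
    using that
  proof (induction m)
    case (Suc m)
    let ?w = "\<lambda>i. if i < m then c i *\<^sub>R u i else u i"
    have 1: "(\<lambda>i. if i < Suc m then c i *\<^sub>R u i else u i) = ?w(m := c m *\<^sub>R u m)" and 2: "?w(m := u m) = ?w"
      by (auto simp: less_Suc_eq)
    have "A (?w(m := c m *\<^sub>R u m)) = c m * A (?w(m := u m))"
      using linear_scale[OF multilinear_formsD(2)[OF A, of m ?w], of "c m" "u m"] Suc.prems by simp
    then show ?case using Suc by (simp only: 1 2) simp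
  qed simp
  from this[of n] have "A (\<lambda>i. if i < n then c i *\<^sub>R u i else u i) = (\<Prod>i<n. c i) * A u" by simp
  moreover have "A (\<lambda>i. if i < n then c i *\<^sub>R u i else u i) = A (\<lambda>i. c i *\<^sub>R u i)"
    by (rule multilinear_formsD(1)[OF A]) simp
  ultimately show ?thesis by simp
qed

lemma continuous_on_fun_upd:
  fixes u :: "nat \<Rightarrow> 'h::topological_space"
  shows "continuous_on UNIV (\<lambda>u. u(n := h))" "continuous_on UNIV (\<lambda>h. u(n := h))"
proof -
  have "continuous_on UNIV (\<lambda>u. (u(n := h)) i)" for i
    by (cases "i = n") (auto intro: continuous_on_product_coordinates)
  then show "continuous_on UNIV (\<lambda>u. u(n := h))"
    by (rule continuous_on_coordinatewise_then_product)
  have "continuous_on UNIV (\<lambda>h. (u(n := h)) i)" for i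
    by (cases "i = n") (auto intro: continuous_intros)
  then show "continuous_on UNIV (\<lambda>h. u(n := h))"
    by (rule continuous_on_coordinatewise_then_product)
qed

lemma multilinear_forms_upd:
  assumes A: "A \<in> multilinear_forms (Suc n)"
  shows "(\<lambda>u. A (u(n := h))) \<in> multilinear_forms n"
  unfolding multilinear_forms_def
proof (intro CollectI conjI allI impI)
  fix u u' :: "nat \<Rightarrow> 'a" assume "\<forall>i<n. u i = u' i"
  then show "A (u(n := h)) = A (u'(n := h))"
    by (intro multilinear_formsD(1)[OF A]) (auto simp: less_Suc_eq)
next
  fix u :: "nat \<Rightarrow> 'a" and i assume "i < n"
  then show "linear (\<lambda>v. A ((u(i := v))(n := h)))"
    using multilinear_formsD(2)[OF A, of i "u(n := h)"] fun_upd_twist[of i n u] by simp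
next
  show "continuous_on UNIV (\<lambda>u. A (u(n := h)))"
    by (rule continuous_on_compose2[OF multilinear_formsD(3)[OF A] continuous_on_fun_upd(1)]) simp
qed

text \<open>Banach-Steinhaus for multilinear forms. Freezing the last argument gives, by induction,
  a bound depending on that argument; a second use of uniform boundedness, in the last argument,
  removes the dependence.\<close>

lemma multilinear_uniform_bound:
  fixes \<A> :: "((nat \<Rightarrow> 'h::banach) \<Rightarrow> real) set"
  assumes "\<A> \<subseteq> multilinear_forms n" "\<And>u. \<exists>B. \<forall>A\<in>\<A>. \<bar>A u\<bar> \<le> B"
  shows "\<exists>B\<ge>0. \<forall>A\<in>\<A>. \<forall>u. \<bar>A u\<bar> \<le> B * norm_prod n u"
  using assms
proof (induction n arbitrary: \<A>)
  case 0
  obtain B where B: "\<And>A. A \<in> \<A> \<Longrightarrow> \<bar>A (\<lambda>_. 0)\<bar> \<le> B" using 0(2) by blast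
  have "\<bar>A u\<bar> \<le> \<bar>B\<bar>" if "A \<in> \<A>" for A u
    using B[OF that] multilinear_formsD(1)[of A 0 u "\<lambda>_. 0"] that 0(1) by auto
  then show ?case by (intro exI[of _ "\<bar>B\<bar>"]) simp
next
  case (Suc n)
  have ml: "A \<in> multilinear_forms (Suc n)" if "A \<in> \<A>" for A using Suc.prems(1) that by auto
  have bh: "\<exists>B\<ge>0. \<forall>A\<in>\<A>. \<forall>u. \<bar>A (u(n := h))\<bar> \<le> B * norm_prod n u" for h
  proof -
    have "\<exists>B\<ge>0. \<forall>A\<in>(\<lambda>A u. A (u(n := h))) ` \<A>. \<forall>u. \<bar>A u\<bar> \<le> B * norm_prod n u"
    proof (rule Suc.IH)
      show "(\<lambda>A u. A (u(n := h))) ` \<A> \<subseteq> multilinear_forms n"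
        using multilinear_forms_upd[OF ml] by auto
      show "\<exists>B. \<forall>A\<in>(\<lambda>A u. A (u(n := h))) ` \<A>. \<bar>A u\<bar> \<le> B" for u
      proof -
        obtain B where "\<forall>A\<in>\<A>. \<bar>A (u(n := h))\<bar> \<le> B" using Suc.prems(2) by blast
        then show ?thesis by (intro exI[of _ B]) blast
      qed
    qed
    then show ?thesis by simp
  qed
  have lin: "linear (\<lambda>h. A (u(n := h)))" if "A \<in> \<A>" for A u
    by (rule multilinear_formsD(2)[OF ml[OF that]]) simp
  \<comment> \<open>The family is indexed by pairs of a form and a tuple of the remaining arguments
    in the unit ball, which makes the resulting bound uniform over both.\<close>
  have "\<exists>B\<ge>0. \<forall>p\<in>\<A> \<times> {u. \<forall>i. norm (u i) \<le> 1}. \<forall>h. \<bar>fst p ((snd p)(n := h))\<bar> \<le> B * norm h"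
  proof (rule uniform_boundedness)
    show "\<exists>B. \<forall>p\<in>\<A> \<times> {u. \<forall>i. norm (u i) \<le> 1}. \<bar>fst p ((snd p)(n := h))\<bar> \<le> B" for h
    proof -
      obtain B where B: "B \<ge> 0" "\<And>A u. A \<in> \<A> \<Longrightarrow> \<bar>A (u(n := h))\<bar> \<le> B * norm_prod n u"
        using bh[of h] by blast
      have "\<bar>A (u(n := h))\<bar> \<le> B" if "A \<in> \<A>" "\<And>i. norm (u i) \<le> 1" for A u
      proof -
        have "\<bar>A (u(n := h))\<bar> \<le> B * norm_prod n u" by (rule B(2)[OF that(1)])
        also have "\<dots> \<le> B * 1"
          using prod_norm_le[of u 1 n] that(2) B(1) by (intro mult_left_mono) auto
        finally show ?thesis by simp
      qed
      then show ?thesis by (intro exI[of _ B]) auto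
    qed
  next
    fix p assume p: "p \<in> \<A> \<times> {u :: nat \<Rightarrow> 'h. \<forall>i. norm (u i) \<le> 1}"
    then have l: "linear (\<lambda>h. fst p ((snd p)(n := h)))" using lin by auto
    show "\<bar>fst p ((snd p)(n := x - y))\<bar> \<le> \<bar>fst p ((snd p)(n := x))\<bar> + \<bar>fst p ((snd p)(n := y))\<bar>" for x y
      using linear_diff[OF l, of x y] by simp
    show "\<bar>fst p ((snd p)(n := c *\<^sub>R x))\<bar> = \<bar>c\<bar> * \<bar>fst p ((snd p)(n := x))\<bar>" for c x
      using linear_scale[OF l, of c x] by (simp add: abs_mult)
    have "fst p \<in> multilinear_forms (Suc n)" using p ml by auto
    then have "continuous_on UNIV (\<lambda>h. fst p ((snd p)(n := h)))"
      by (intro continuous_on_compose2[OF multilinear_formsD(3) continuous_on_fun_upd(2)]) auto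
    then show "continuous_on UNIV (\<lambda>h. \<bar>fst p ((snd p)(n := h))\<bar>)"
      by (rule continuous_on_rabs)
  qed
  then obtain B where B: "B \<ge> 0"
    "\<And>A u h. A \<in> \<A> \<Longrightarrow> (\<And>i. norm (u i) \<le> 1) \<Longrightarrow> \<bar>A (u(n := h))\<bar> \<le> B * norm h"
    by auto
  have "\<bar>A u\<bar> \<le> B * norm_prod (Suc n) u" if A: "A \<in> \<A>" for A u
  proof -
    have "\<bar>A (u(n := u n))\<bar> \<le> B * norm (u n) * norm_prod n u"
      by (rule homogeneous_bound[where Q="\<lambda>v. A (v(n := u n))"])
        (rule multilinear_forms_scaleR[OF multilinear_forms_upd[OF ml[OF A]]], rule B(2)[OF A])
    then show ?thesis by (simp add: mult_ac)
  qed
  then show ?case using B(1) by blast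
qed

section \<open>The norm of multilinear forms and their continuity\<close>

lemma form_norm_le:
  assumes "\<And>u. \<bar>A u\<bar> \<le> B * norm_prod n u"
  shows "form_norm n A \<le> ennreal B"
  unfolding form_norm_def
proof (rule SUP_least, rule ennreal_leI)
  fix u :: "nat \<Rightarrow> 'a" assume "u \<in> {h. \<forall>i<n. h i \<noteq> 0}"
  then have "norm_prod n u > 0" by (intro prod_pos) auto
  then show "\<bar>A u\<bar> / norm_prod n u \<le> B"
    using assms[of u] by (simp add: pos_divide_le_eq)
qed

text \<open>The supremum in \<open>form_norm\<close> runs over tuples of nonzero directions, so the
  vanishing of \<open>A\<close> at the other tuples has to be supplied separately.\<close>

lemma form_norm_leD:
  assumes "form_norm n A \<le> ennreal B" "B \<ge> 0" and zero: "\<And>i. i < n \<Longrightarrow> u i = 0 \<Longrightarrow> A u = 0"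
  shows "\<bar>A u\<bar> \<le> B * norm_prod n u"
proof (cases "\<forall>i<n. u i \<noteq> 0")
  case True
  then have "ennreal (\<bar>A u\<bar> / norm_prod n u) \<le> form_norm n A"
    unfolding form_norm_def by (intro SUP_upper) simp
  also have "\<dots> \<le> ennreal B" by fact
  finally have "\<bar>A u\<bar> / norm_prod n u \<le> B" using assms(2) by simp
  moreover have "norm_prod n u > 0" using True by (intro prod_pos) auto
  ultimately show ?thesis by (simp add: pos_divide_le_eq)
next
  case False
  then show ?thesis
    using zero assms(2) by (auto intro!: mult_nonneg_nonneg prod_nonneg)
qed

lemma dirds_linear:
  assumes \<iota>: "bounded_linear \<iota>" and f: "smooth_along \<iota> n f" and i: "i < n"
  shows "linear (\<lambda>v. dirds \<iota> n (u(i := v)) f x)"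
  using f i
proof (induction n arbitrary: f)
  case (Suc n)
  show ?case
  proof (cases "i = n")
    case True
    have c: "dirds \<iota> n (u(n := v)) = dirds \<iota> n u" for v
      by (rule ext, rule dirds_cong) simp
    have s: "smooth_along \<iota> n (dird \<iota> v f)" for v using Suc.prems by simp
    have 1: "dird \<iota> (v + w) f = (\<lambda>x. 1 * dird \<iota> v f x + 1 * dird \<iota> w f x)" for v w
      using dird_add[OF \<iota> Suc.prems(1), of v w] by auto
    have 2: "dird \<iota> (a *\<^sub>R v) f = (\<lambda>x. a * dird \<iota> v f x + 0 * dird \<iota> v f x)" for a v
      using dird_scaleR[OF \<iota> Suc.prems(1), of a v] by auto
    show ?thesis
    proof (rule linearI)
      show "dirds \<iota> (Suc n) (u(i := v + w)) f x = dirds \<iota> (Suc n) (u(i := v)) f x + dirds \<iota> (Suc n) (u(i := w)) f x" for v w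
        using smooth_along_linear(2)[OF s[of v] s[of w] order_refl, of u 1 1] True
        by (simp del: mult_1 add: 1[of v w] c)
      show "dirds \<iota> (Suc n) (u(i := a *\<^sub>R v)) f x = a *\<^sub>R dirds \<iota> (Suc n) (u(i := v)) f x" for a v
        using smooth_along_linear(2)[OF s[of v] s[of v] order_refl, of u a 0] True
        by (simp add: 2[of a v] c del: add_0_right)
    qed
  next
    case False
    then show ?thesis using Suc.IH[of "dird \<iota> (u n) f"] Suc.prems by simp
  qed
qed simp

text \<open>Exchanging the entries of \<open>u\<close> for those of \<open>v\<close> one at a time
  bounds the difference of the values by \<open>R u v\<close>. Each summand has one factor that is
  the norm of a difference, so \<open>R u\<close> is continuous in the product topology and vanishes
  at \<open>u\<close>.\<close>

lemma bounded_multilinear_continuous: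
  fixes A :: "(nat \<Rightarrow> 'h::real_normed_vector) \<Rightarrow> real"
  assumes cong: "\<And>u u'. (\<And>i. i < n \<Longrightarrow> u i = u' i) \<Longrightarrow> A u = A u'"
    and lin: "\<And>u i. i < n \<Longrightarrow> linear (\<lambda>v. A (u(i := v)))"
    and bdd: "\<And>u. \<bar>A u\<bar> \<le> B * norm_prod n u"
  shows "continuous_on UNIV A"
proof -
  define R where "R = (\<lambda>u v. \<Sum>i<n. \<bar>B\<bar> * (\<Prod>j<n. if j = i then norm (v j - u j) else norm (v j) + norm (u j :: 'h)))"
  have tele: "\<bar>A (\<lambda>i. if i < m then v i else u i) - A u\<bar> \<le>
      (\<Sum>i<m. \<bar>B\<bar> * (\<Prod>j<n. if j = i then norm (v j - u j) else norm (v j) + norm (u j)))" if "m \<le> n" for m u v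
    using that
  proof (induction m)
    case (Suc m)
    let ?w = "\<lambda>i. if i < m then v i else u i"
    have e: "(\<lambda>i. if i < Suc m then v i else u i) = ?w(m := v m)" and e': "?w(m := u m) = ?w"
      by (auto simp: less_Suc_eq)
    have "A (?w(m := v m)) - A ?w = A (?w(m := v m - u m))"
      using linear_diff[OF lin[of m ?w], of "v m" "u m"] Suc.prems by (simp add: e')
    also have "\<bar>\<dots>\<bar> \<le> \<bar>B\<bar> * (\<Prod>j<n. norm ((?w(m := v m - u m)) j))"
      by (rule order_trans[OF bdd]) (intro mult_right_mono prod_nonneg; simp)
    also have "\<dots> \<le> \<bar>B\<bar> * (\<Prod>j<n. if j = m then norm (v j - u j) else norm (v j) + norm (u j))"
      by (intro mult_left_mono prod_mono) auto
    finally show ?case using Suc by (simp add: e)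
  qed simp
  have le: "\<bar>A v - A u\<bar> \<le> R u v" for u v
    using tele[of n v u] cong[of "\<lambda>i. if i < n then v i else u i" v] by (simp add: R_def)
  have "isCont A u" for u
  proof -
    have "continuous_on UNIV (R u)"
      unfolding R_def
    proof (intro continuous_intros)
      show "continuous_on UNIV (\<lambda>v. if j = i then norm (v j - u j) else norm (v j) + norm (u j))" for i j
        by (cases "j = i") (auto intro!: continuous_intros continuous_on_product_coordinates)
    qed
    then have "(R u \<longlongrightarrow> R u u) (at u)" by (simp add: continuous_on_def)
    moreover have "R u u = 0"
      unfolding R_def by (intro sum.neutral ballI) (auto intro!: prod_zero)
    ultimately have "(R u \<longlongrightarrow> 0) (at u)" by simp
    then have "((\<lambda>v. A v - A u) \<longlongrightarrow> 0) (at u)"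
      by (rule Lim_null_comparison[rotated]) (simp add: le)
    then show ?thesis by (simp add: isCont_def LIM_zero_iff)
  qed
  then show ?thesis by (simp add: continuous_at_imp_continuous_on)
qed

lemma dirds_multilinear:
  assumes \<iota>: "bounded_linear \<iota>" and f: "smooth_along \<iota> n f" "derivs_bounded \<iota> n f B"
  shows "(\<lambda>u. dirds \<iota> n u f x) \<in> multilinear_forms n"
  unfolding multilinear_forms_def
proof (intro CollectI conjI allI impI)
  show c: "dirds \<iota> n u f x = dirds \<iota> n u' f x" if "\<forall>i<n. u i = u' i" for u u'
    by (rule fun_cong[OF dirds_cong]) (use that in blast)
  show l: "linear (\<lambda>v. dirds \<iota> n (u(i := v)) f x)" if "i < n" for u i
    by (rule dirds_linear[OF \<iota> f(1) that])
  show "continuous_on UNIV (\<lambda>u. dirds \<iota> n u f x)"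
    by (rule bounded_multilinear_continuous[of n _ B, OF c l]) (use f(2) in \<open>auto simp: derivs_bounded_def\<close>)
qed

section \<open>H-Gateaux derivatives and directional derivatives\<close>

lemma form_norm_tendsto_0:
  assumes "\<And>e. e > 0 \<Longrightarrow> \<forall>\<^sub>F t in F. \<forall>u. \<bar>A t u\<bar> \<le> e * norm_prod n u"
  shows "((\<lambda>t. form_norm n (A t)) \<longlongrightarrow> 0) F"
proof (rule order_tendstoI)
  fix a :: ennreal assume "a > 0"
  then obtain b where b: "0 < b" "b < a" using dense by blast
  then obtain e where e: "b = ennreal e" "e > 0" by (cases b) auto
  from assms[OF e(2)] show "\<forall>\<^sub>F t in F. form_norm n (A t) < a"
  proof eventually_elim
    case (elim t)
    then have "form_norm n (A t) \<le> b" unfolding e(1) by (intro form_norm_le) blast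
    then show ?case using b(2) by simp
  qed
qed simp

lemma form_norm_tendsto_0D:
  assumes "((\<lambda>t. form_norm n (A t)) \<longlongrightarrow> 0) F" "e > 0"
    and zero: "\<And>t i u. i < n \<Longrightarrow> u i = 0 \<Longrightarrow> A t u = 0"
  shows "\<forall>\<^sub>F t in F. \<forall>u. \<bar>A t u\<bar> \<le> e * norm_prod n u"
proof -
  have "\<forall>\<^sub>F t in F. form_norm n (A t) < ennreal e"
    using assms(1,2) by (intro order_tendstoD(2)) auto
  then show ?thesis
  proof eventually_elim
    case (elim t)
    show ?case
      by (intro allI form_norm_leD zero) (use elim assms(2) in auto)
  qed
qed

text \<open>Below the top order the bound on the following derivative gives a Lipschitz estimate
  along \<open>\<iota> h\<close>; at the top order the continuity is that of
  \<open>norm_cont\<close>.\<close>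

lemma dirds_line_cont:
  fixes \<iota> :: "'h::real_normed_vector \<Rightarrow> 'x::real_normed_vector"
  assumes f: "smooth_along \<iota> n f" and \<iota>: "bounded_linear \<iota>"
    and bdd: "\<And>j. j \<le> n \<Longrightarrow> derivs_bounded \<iota> j f b"
    and nc: "norm_cont \<iota> n f x" and j: "j < n" and e: "e > 0"
  shows "\<forall>\<^sub>F z in nhds 0. \<forall>u. \<bar>dirds \<iota> (Suc j) (case_nat h u) f (x + z *\<^sub>R \<iota> h) -
    dirds \<iota> (Suc j) (case_nat h u) f x\<bar> \<le> e * norm_prod j u"
proof (cases "Suc j < n")
  case True
  define K where "K = \<bar>b\<bar> * (norm h)\<^sup>2 + 1"
  have K: "K > 0" by (simp add: K_def add_nonneg_pos)
  have s: "smooth_along \<iota> (Suc (Suc j)) f" using True by (intro smooth_along_mono[OF f]) simp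
  have b: "derivs_bounded \<iota> (Suc (Suc j)) f \<bar>b\<bar>"
    by (rule derivs_bounded_nonneg_const[OF bdd]) (use True in auto)
  have le: "\<bar>dirds \<iota> (Suc j) (case_nat h u) f (x + z *\<^sub>R \<iota> h) - dirds \<iota> (Suc j) (case_nat h u) f x\<bar>
      \<le> K * norm_prod j u * \<bar>z\<bar>" for u z
  proof -
    have "\<bar>dirds \<iota> (Suc j) (case_nat h u) f (x + s *\<^sub>R \<iota> h) - dirds \<iota> (Suc j) (case_nat h u) f x\<bar>
      \<le> \<bar>b\<bar> * (norm h * (norm h * norm_prod j u)) * s" if "s \<ge> 0" for x s
      using dirds_diff_le[OF s b that, of "case_nat h u" x h] by (simp only: prod_case_nat)
    from this[of z x] this[of "- z" "x + z *\<^sub>R \<iota> h"]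
    have "\<bar>dirds \<iota> (Suc j) (case_nat h u) f (x + z *\<^sub>R \<iota> h) - dirds \<iota> (Suc j) (case_nat h u) f x\<bar>
      \<le> \<bar>b\<bar> * (norm h * (norm h * norm_prod j u)) * \<bar>z\<bar>"
      by (cases "z \<ge> 0") (simp_all add: abs_minus_commute del: dirds.simps)
    also have "\<dots> = (K - 1) * (norm_prod j u * \<bar>z\<bar>)"
      by (simp add: K_def power2_eq_square)
    also have "\<dots> \<le> K * (norm_prod j u * \<bar>z\<bar>)"
      by (intro mult_right_mono mult_nonneg_nonneg prod_nonneg) auto
    finally show ?thesis by (simp add: mult_ac)
  qed
  show ?thesis
    unfolding eventually_nhds_metric
  proof (intro exI[of _ "e / K"] conjI allI impI)
    fix z :: real and u :: "nat \<Rightarrow> 'h" assume z: "dist z 0 < e / K"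
    have "K * norm_prod j u * \<bar>z\<bar> \<le> K * norm_prod j u * (e / K)"
      using z K by (intro mult_left_mono mult_nonneg_nonneg prod_nonneg) auto
    also have "\<dots> = e * norm_prod j u" using K by simp
    finally show "\<bar>dirds \<iota> (Suc j) (case_nat h u) f (x + z *\<^sub>R \<iota> h) - dirds \<iota> (Suc j) (case_nat h u) f x\<bar>
      \<le> e * norm_prod j u"
      by (rule order_trans[OF le])
  qed (use e K in simp)
next
  case False
  then have n: "n = Suc j" using j by simp
  \<comment> \<open>\<open>norm h\<close> may vanish, so the error is divided by
    \<open>norm h + 1\<close> instead.\<close>
  have "norm h + 1 > 0" by (simp add: add_nonneg_pos)
  then have e': "e / (norm h + 1) > 0" using e by simp
  have lim: "filterlim (\<lambda>z. x + z *\<^sub>R \<iota> h) (nhds x) (nhds 0)"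
  proof -
    have "filterlim (\<lambda>z. x + z *\<^sub>R \<iota> h) (nhds (x + 0 *\<^sub>R \<iota> h)) (nhds 0)"
      by (intro tendsto_intros) (simp add: filterlim_ident)
    then show ?thesis by simp
  qed
  from eventually_compose_filterlim[OF nc[unfolded norm_cont_def n, rule_format, OF e'] lim]
  show ?thesis
  proof eventually_elim
    case (elim z)
    show ?case
    proof
      fix u :: "nat \<Rightarrow> 'h"
      have "\<bar>dirds \<iota> (Suc j) (case_nat h u) f (x + z *\<^sub>R \<iota> h) - dirds \<iota> (Suc j) (case_nat h u) f x\<bar>
        \<le> e / (norm h + 1) * (norm h * norm_prod j u)"
        using elim unfolding prod_case_nat[symmetric] by blast
      also have "\<dots> = (e * norm_prod j u) * (norm h / (norm h + 1))" by simp
      also have "\<dots> \<le> (e * norm_prod j u) * 1"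
        using e \<open>norm h + 1 > 0\<close> by (intro mult_left_mono mult_nonneg_nonneg prod_nonneg) auto
      finally show "\<bar>dirds \<iota> (Suc j) (case_nat h u) f (x + z *\<^sub>R \<iota> h) - dirds \<iota> (Suc j) (case_nat h u) f x\<bar>
        \<le> e * norm_prod j u" by simp
    qed
  qed
qed

text \<open>By the mean value theorem the difference quotient is the next derivative at an
  intermediate point. This point depends on \<open>u\<close>, but continuity along the line is
  uniform over \<open>u\<close>, so the quotients converge in operator norm.\<close>

lemma dirds_has_H_gateaux_derivative:
  assumes f: "smooth_along \<iota> n f" and \<iota>: "bounded_linear \<iota>"
    and bdd: "\<And>j. j \<le> n \<Longrightarrow> derivs_bounded \<iota> j f b"
    and nc: "norm_cont \<iota> n f x" and j: "j < n"
  shows "has_H_gateaux_derivative \<iota> j (\<lambda>x u. dirds \<iota> j u f x) x (\<lambda>u. dirds \<iota> (Suc j) u f x)"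
  unfolding has_H_gateaux_derivative_def
proof (intro conjI allI form_norm_tendsto_0)
  show "(\<lambda>u. dirds \<iota> (Suc j) u f x) \<in> multilinear_forms (Suc j)"
    by (rule dirds_multilinear[OF \<iota> smooth_along_mono[OF f] bdd]) (use j in auto)
  fix h and e :: real assume e: "e > 0"
  from dirds_line_cont[OF f \<iota> bdd nc j e, of h]
  obtain d where d: "d > 0" "\<And>z u. \<bar>z\<bar> < d \<Longrightarrow> \<bar>dirds \<iota> (Suc j) (case_nat h u) f (x + z *\<^sub>R \<iota> h) -
    dirds \<iota> (Suc j) (case_nat h u) f x\<bar> \<le> e * norm_prod j u"
    unfolding eventually_nhds_metric by auto
  show "\<forall>\<^sub>F t in at 0. \<forall>u. \<bar>(dirds \<iota> j u f (x + t *\<^sub>R \<iota> h) - dirds \<iota> j u f x) / t -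
    dirds \<iota> (Suc j) (case_nat h u) f x\<bar> \<le> e * norm_prod j u"
    unfolding eventually_at
  proof (intro exI[of _ d] conjI ballI impI allI)
    fix t :: real and u assume t': "t \<noteq> 0 \<and> dist t 0 < d"
    then have t: "t \<noteq> 0" "dist t 0 < d" by auto
    obtain z where z: "\<bar>z\<bar> \<le> \<bar>t\<bar>" "dirds \<iota> j u f (x + t *\<^sub>R \<iota> h) - dirds \<iota> j u f (x + 0 *\<^sub>R \<iota> h) =
        t * dirds \<iota> (Suc j) (case_nat h u) f (x + z *\<^sub>R \<iota> h)"
      by (rule mvt_symmetric[OF dirds_DERIV[OF f j, of u x h]])
    have "(dirds \<iota> j u f (x + t *\<^sub>R \<iota> h) - dirds \<iota> j u f x) / t = dirds \<iota> (Suc j) (case_nat h u) f (x + z *\<^sub>R \<iota> h)"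
      using z(2) t(1) by (simp del: dirds.simps add: field_simps)
    then show "\<bar>(dirds \<iota> j u f (x + t *\<^sub>R \<iota> h) - dirds \<iota> j u f x) / t -
      dirds \<iota> (Suc j) (case_nat h u) f x\<bar> \<le> e * norm_prod j u"
      using d(2)[of z u] z(1) t(2) by (simp del: dirds.simps)
  qed (use d in simp)
qed

lemma has_H_gateaux_derivative_DERIV:
  assumes D: "has_H_gateaux_derivative \<iota> n F x D" and F: "\<And>x. F x \<in> multilinear_forms n"
  shows "((\<lambda>r. F (x + r *\<^sub>R \<iota> h) u) has_real_derivative D (case_nat h u)) (at 0)"
proof (rule DERIV_at_0I, rule LIM_zero_cancel, rule tendstoI)
  fix e :: real assume e: "e > 0"
  have Dm: "D \<in> multilinear_forms (Suc n)"
    and lim: "((\<lambda>t. form_norm n (\<lambda>u. (F (x + t *\<^sub>R \<iota> h) u - F x u) / t - D (case_nat h u))) \<longlongrightarrow> 0) (at 0)"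
    using D by (auto simp: has_H_gateaux_derivative_def)
  define p where "p = norm_prod n u"
  have p: "p \<ge> 0" unfolding p_def by (intro prod_nonneg) auto
  have "\<forall>\<^sub>F t in at 0. \<forall>u. \<bar>(F (x + t *\<^sub>R \<iota> h) u - F x u) / t - D (case_nat h u)\<bar> \<le> (e / (p + 1)) * norm_prod n u"
  proof (rule form_norm_tendsto_0D[OF lim])
    fix t i and u :: "nat \<Rightarrow> 'a" assume i: "i < n" "u i = 0"
    then have "D (case_nat h u) = 0" by (intro multilinear_forms_zero[OF Dm, of "Suc i"]) auto
    then show "(F (x + t *\<^sub>R \<iota> h) u - F x u) / t - D (case_nat h u) = 0"
      using multilinear_forms_zero[where u=u and i=i, OF F i] by simp
  qed (use e p in simp)
  then show "\<forall>\<^sub>F t in at 0. dist ((F (x + t *\<^sub>R \<iota> h) u - F (x + 0 *\<^sub>R \<iota> h) u) / t - D (case_nat h u)) 0 < e"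
  proof eventually_elim
    case (elim t)
    then have "\<bar>(F (x + t *\<^sub>R \<iota> h) u - F x u) / t - D (case_nat h u)\<bar> \<le> (e / (p + 1)) * p"
      unfolding p_def by blast
    also have "\<dots> < e" using e p by (simp add: field_simps)
    finally show ?case by simp
  qed
qed

text \<open>\<open>DH\<close> is a definite description and has no content without this. Every
  sequence has the form \<open>case_nat h u\<close>, and there the value is an ordinary
  derivative.\<close>

lemma has_H_gateaux_derivative_unique:
  assumes "has_H_gateaux_derivative \<iota> n F x D" "has_H_gateaux_derivative \<iota> n F x D'"
    and "\<And>x. F x \<in> multilinear_forms n"
  shows "D = D'"
proof
  fix v :: "nat \<Rightarrow> 'a"
  have "v = case_nat (v 0) (\<lambda>i. v (Suc i))" by (rule ext) (simp split: nat.split)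
  then show "D v = D' v"
    using DERIV_unique[OF has_H_gateaux_derivative_DERIV[OF assms(1,3), of "v 0" "\<lambda>i. v (Suc i)"]
        has_H_gateaux_derivative_DERIV[OF assms(2,3), of "v 0" "\<lambda>i. v (Suc i)"]] by simp
qed

lemma DH_eq_dirds:
  assumes f: "smooth_along \<iota> n f" and \<iota>: "bounded_linear \<iota>"
    and bdd: "\<And>j. j \<le> n \<Longrightarrow> derivs_bounded \<iota> j f b"
    and nc: "\<And>x. norm_cont \<iota> n f x" and j: "j \<le> n"
  shows "DH \<iota> j f = (\<lambda>x u. dirds \<iota> j u f x)"
  using j
proof (induction j)
  case 0
  show ?case by (auto simp: fun_eq_iff)
next
  case (Suc j)
  then have IH: "DH \<iota> j f = (\<lambda>x u. dirds \<iota> j u f x)" and j: "j < n" by simp_all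
  have ml: "(\<lambda>u. dirds \<iota> j u f x) \<in> multilinear_forms j" for x
    by (rule dirds_multilinear[OF \<iota> smooth_along_mono[OF f] bdd]) (use j in auto)
  show ?case
  proof
    fix x
    show "DH \<iota> (Suc j) f x = (\<lambda>u. dirds \<iota> (Suc j) u f x)"
      unfolding DH.simps IH
      by (rule the_equality) (auto simp del: dirds.simps intro: has_H_gateaux_derivative_unique[OF _ _ ml]
          dirds_has_H_gateaux_derivative[OF f \<iota> bdd nc j])
  qed
qed

lemma smooth_along_CH:
  assumes f: "smooth_along \<iota> n f" and \<iota>: "bounded_linear \<iota>"
    and bdd: "\<And>j. j \<le> n \<Longrightarrow> derivs_bounded \<iota> j f b"
    and nc: "\<And>x. norm_cont \<iota> n f x"
  shows "f \<in> CH \<iota> n"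
  unfolding CH_def
proof (intro CollectI conjI allI impI)
  have DH: "DH \<iota> k f = (\<lambda>x u. dirds \<iota> k u f x)" if "k \<le> n" for k
    by (rule DH_eq_dirds[OF f \<iota> bdd nc that])
  show "f \<in> Cb" by (rule smooth_along_Cb[OF f])
  show "H_gateaux_differentiable \<iota> n f"
    unfolding H_gateaux_differentiable_def
  proof (intro allI impI exI)
    fix k x assume k: "k < n"
    show "has_H_gateaux_derivative \<iota> k (DH \<iota> k f) x (\<lambda>u. dirds \<iota> (Suc k) u f x)"
      unfolding DH[OF less_imp_le[OF k]]
      by (rule dirds_has_H_gateaux_derivative[OF f \<iota> bdd nc k])
  qed
  show "(\<lambda>x. DH \<iota> k f x h) \<in> Cb" if "k \<le> n" for k h
    unfolding DH[OF that] using dirds_Cb[OF f that] by simp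
qed

section \<open>A quantitative form of membership in the Zygmund spaces\<close>

abbreviation diff2 :: "('h \<Rightarrow> 'x::real_normed_vector) \<Rightarrow> 'h \<Rightarrow> ('x \<Rightarrow> real) \<Rightarrow> 'x \<Rightarrow> real" where
  "diff2 \<iota> h f x \<equiv> f (x + 2 *\<^sub>R \<iota> h) - 2 * f (x + \<iota> h) + f x"

text \<open>One real number bounds all orders up to \<open>k - 1\<close> and the Zygmund seminorm.
  Being stated through \<open>dirds\<close> and multiplied out, the conditions pass through sums and
  integrals directly; suprema in \<open>ennreal\<close> occur only in the conversions.\<close>

definition ZH_bounded ::
  "('h::real_normed_vector \<Rightarrow> 'x::real_normed_vector) \<Rightarrow> nat \<Rightarrow> ('x \<Rightarrow> real) \<Rightarrow> real \<Rightarrow> bool" where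
  "ZH_bounded \<iota> k f b \<longleftrightarrow> smooth_along \<iota> (k - 1) f \<and> (\<forall>x. norm_cont \<iota> (k - 1) f x) \<and>
     (\<forall>j\<le>k - 1. derivs_bounded \<iota> j f b) \<and>
     (\<forall>x u h. \<bar>diff2 \<iota> h (dirds \<iota> (k - 1) u f) x\<bar>
       \<le> b * norm h * norm_prod (k - 1) u)"

lemma ZH_boundedD:
  assumes "ZH_bounded \<iota> k f b"
  shows "smooth_along \<iota> (k - 1) f" "norm_cont \<iota> (k - 1) f x" "j \<le> k - 1 \<Longrightarrow> derivs_bounded \<iota> j f b"
    "\<bar>diff2 \<iota> h (dirds \<iota> (k - 1) u f) x\<bar>
       \<le> b * norm h * norm_prod (k - 1) u"
    "\<bar>f x\<bar> \<le> b" "b \<ge> 0"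
proof -
  show *: "smooth_along \<iota> (k - 1) f" "norm_cont \<iota> (k - 1) f x" "j \<le> k - 1 \<Longrightarrow> derivs_bounded \<iota> j f b"
    "\<bar>diff2 \<iota> h (dirds \<iota> (k - 1) u f) x\<bar>
       \<le> b * norm h * norm_prod (k - 1) u" for x j
    using assms unfolding ZH_bounded_def by blast+
  show "\<bar>f x\<bar> \<le> b" for x
    using *(3)[of 0] by (simp add: derivs_bounded_def)
  from this[of 0] show "b \<ge> 0" by simp
qed

lemma ZH_bounded_DH:
  assumes \<iota>: "bounded_linear \<iota>" and f: "ZH_bounded \<iota> k f b" and j: "j \<le> k - 1"
  shows "DH \<iota> j f = (\<lambda>x u. dirds \<iota> j u f x)"
  by (rule DH_eq_dirds[OF ZH_boundedD(1)[OF f] \<iota> ZH_boundedD(3)[OF f] ZH_boundedD(2)[OF f] j])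

lemma ZH_bounded_CH_norm:
  assumes \<iota>: "bounded_linear \<iota>" and f: "ZH_bounded \<iota> k f b"
  shows "CH_norm \<iota> (k - 1) f \<le> ennreal ((real k + 1) * b)"
proof -
  note F = ZH_boundedD[OF f]
  have sup: "sup_norm f \<le> ennreal b"
    unfolding sup_norm_def by (intro SUP_least ennreal_leI F)
  have "form_norm j (DH \<iota> j f x) \<le> ennreal b" if "j \<le> k - 1" for j x
    unfolding ZH_bounded_DH[OF \<iota> f that]
    by (rule form_norm_le) (use F(3)[OF that] in \<open>simp add: derivs_bounded_def\<close>)
  then have "(\<Sum>j=1..k - 1. SUP x. form_norm j (DH \<iota> j f x)) \<le> of_nat (card {1..k - 1}) * ennreal b"
    by (intro sum_bounded_above SUP_least) auto
  also have "\<dots> \<le> of_nat k * ennreal b" by (intro mult_right_mono) auto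
  also have "\<dots> = ennreal (real k * b)"
    using F(6) by (simp add: ennreal_of_nat_eq_real_of_nat ennreal_mult')
  finally have "CH_norm \<iota> (k - 1) f \<le> ennreal b + ennreal (real k * b)"
    unfolding CH_norm_def by (intro add_mono sup)
  also have "\<dots> = ennreal ((real k + 1) * b)"
    using F(6) by (simp add: ennreal_plus[symmetric] algebra_simps del: ennreal_plus)
  finally show ?thesis .
qed

text \<open>The constant counts copies of \<open>b\<close>: one for the sup norm, at most
  \<open>k\<close> for the derivatives and one for the Zygmund seminorm.\<close>

lemma ZH_bounded_imp_ZH:
  assumes \<iota>: "bounded_linear \<iota>" and f: "ZH_bounded \<iota> k f b"
  shows "f \<in> CH \<iota> (k - 1)" "f \<in> ZH \<iota> k" "ZH_norm \<iota> k f \<le> ennreal ((real k + 2) * b)"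
proof -
  note F = ZH_boundedD[OF f]
  let ?n = "k - 1"
  show CH: "f \<in> CH \<iota> ?n"
    by (rule smooth_along_CH[OF F(1) \<iota> F(3) F(2)])
  have DH: "DH \<iota> ?n f = (\<lambda>x u. dirds \<iota> ?n u f x)"
    by (rule ZH_bounded_DH[OF \<iota> f order_refl])
  have Z: "Z1_seminorm \<iota> ?n (DH \<iota> ?n f) \<le> ennreal b"
    unfolding Z1_seminorm_def DH
  proof (intro SUP_least)
    fix x h assume "h \<in> - {0 :: 'a}"
    then have h: "norm h > 0" by simp
    have "form_norm ?n (\<lambda>u. diff2 \<iota> h (dirds \<iota> ?n u f) x)
        \<le> ennreal (b * norm h)"
      by (rule form_norm_le) (rule F(4))
    then have "form_norm ?n (\<lambda>u. diff2 \<iota> h (dirds \<iota> ?n u f) x)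
        / ennreal (norm h) \<le> ennreal (b * norm h) / ennreal (norm h)"
      by (rule divide_right_mono_ennreal)
    also have "\<dots> = ennreal b" using h F(6) by (simp add: divide_ennreal)
    finally show "form_norm ?n (\<lambda>u. diff2 \<iota> h (dirds \<iota> ?n u f) x)
        / ennreal (norm h) \<le> ennreal b" .
  qed
  have "DH \<iota> ?n f \<in> Cb_form ?n"
    unfolding Cb_form_def DH
  proof (intro CollectI conjI allI)
    show "(\<lambda>u. dirds \<iota> ?n u f x) \<in> multilinear_forms ?n" for x
      by (rule dirds_multilinear[OF \<iota> F(1) F(3)]) simp
    show "((\<lambda>y. form_norm ?n (\<lambda>u. dirds \<iota> ?n u f y - dirds \<iota> ?n u f x)) \<longlongrightarrow> 0) (at x)" for x
    proof (rule form_norm_tendsto_0)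
      fix e :: real assume "e > 0"
      then have "\<forall>\<^sub>F y in nhds x. \<forall>u. \<bar>dirds \<iota> ?n u f y - dirds \<iota> ?n u f x\<bar> \<le> e * norm_prod ?n u"
        using F(2)[of x] unfolding norm_cont_def by blast
      then show "\<forall>\<^sub>F y in at x. \<forall>u. \<bar>dirds \<iota> ?n u f y - dirds \<iota> ?n u f x\<bar> \<le> e * norm_prod ?n u"
        unfolding eventually_at_filter by (rule eventually_mono) blast
    qed
    have "(SUP x. form_norm ?n (\<lambda>u. dirds \<iota> ?n u f x)) \<le> ennreal b"
      by (intro SUP_least form_norm_le) (use F(3)[OF order_refl] in \<open>simp add: derivs_bounded_def\<close>)
    then show "(SUP x. form_norm ?n (\<lambda>u. dirds \<iota> ?n u f x)) < \<infinity>"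
      by (rule le_less_trans) simp
  qed
  moreover have "Z1_seminorm \<iota> ?n (DH \<iota> ?n f) < \<infinity>" using Z by (rule le_less_trans) simp
  ultimately show "f \<in> ZH \<iota> k" using CH by (simp add: ZH_def Z1_def)
  have "ZH_norm \<iota> k f \<le> ennreal ((real k + 1) * b) + ennreal b"
    unfolding ZH_norm_def by (intro add_mono ZH_bounded_CH_norm[OF \<iota> f] Z)
  also have "\<dots> = ennreal ((real k + 2) * b)"
    using F(6) by (simp add: ennreal_plus[symmetric] algebra_simps del: ennreal_plus)
  finally show "ZH_norm \<iota> k f \<le> ennreal ((real k + 2) * b)" .
qed

text \<open>Norm convergence of the difference quotients implies convergence for each fixed tuple,
  so \<open>DH\<close> agrees with iterated directional derivatives. As uniqueness of the derivative
  relies on multilinear values at the order below, both facts are carried along in one induction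
  over the order.\<close>

lemma CH_D:
  assumes f: "f \<in> CH \<iota> n"
  shows "j \<le> n \<Longrightarrow> DH \<iota> j f x \<in> multilinear_forms j"
    and "j \<le> n \<Longrightarrow> DH \<iota> j f = (\<lambda>x u. dirds \<iota> j u f x)"
    and "smooth_along \<iota> n f"
proof -
  have "(\<forall>x. DH \<iota> j f x \<in> multilinear_forms j) \<and> (\<forall>i x. j = Suc i \<longrightarrow>
      has_H_gateaux_derivative \<iota> i (DH \<iota> i f) x (DH \<iota> j f x))" if "j \<le> n" for j
    using that
  proof (induction j)
    case 0
    show ?case by (auto simp: multilinear_forms_def)
  next
    case (Suc j)
    then have ml: "\<And>x. DH \<iota> j f x \<in> multilinear_forms j" by simp
    have "has_H_gateaux_derivative \<iota> j (DH \<iota> j f) x (DH \<iota> (Suc j) f x)" for x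
    proof -
      obtain D where "has_H_gateaux_derivative \<iota> j (DH \<iota> j f) x D"
        using f Suc.prems by (force simp: CH_def H_gateaux_differentiable_def)
      then have "\<exists>!D. has_H_gateaux_derivative \<iota> j (DH \<iota> j f) x D"
        using has_H_gateaux_derivative_unique[where F="DH \<iota> j f", OF _ _ ml] by blast
      then show ?thesis unfolding DH.simps by (rule theI')
    qed
    then show ?case by (auto simp: has_H_gateaux_derivative_def)
  qed
  then have ml: "\<And>j x. j \<le> n \<Longrightarrow> DH \<iota> j f x \<in> multilinear_forms j"
    and has: "\<And>j x. j < n \<Longrightarrow> has_H_gateaux_derivative \<iota> j (DH \<iota> j f) x (DH \<iota> (Suc j) f x)"
    using Suc_leI by blast+
  have d: "((\<lambda>r. DH \<iota> j f (x + r *\<^sub>R \<iota> h) u) has_real_derivative DH \<iota> (Suc j) f x (case_nat h u)) (at 0)"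
    if "j < n" for j x h u
    by (rule has_H_gateaux_derivative_DERIV[OF has[OF that] ml]) (use that in simp)
  have eq: "DH \<iota> j f = (\<lambda>x u. dirds \<iota> j u f x)" if "j \<le> n" for j
    using that
  proof (induction j)
    case 0
    show ?case by (auto simp: fun_eq_iff)
  next
    case (Suc j)
    have IH: "DH \<iota> j f = (\<lambda>x u. dirds \<iota> j u f x)" and j: "j < n" using Suc by simp_all
    have "DH \<iota> (Suc j) f x v = dirds \<iota> (Suc j) v f x" for x v
    proof -
      let ?u = "\<lambda>i. v (Suc i)"
      have v: "v = case_nat (v 0) ?u" by (rule ext) (simp split: nat.split)
      have "dird \<iota> (v 0) (dirds \<iota> j ?u f) x = DH \<iota> (Suc j) f x (case_nat (v 0) ?u)"
        by (rule dird_eqI) (use d[OF j, of x "v 0" ?u] in \<open>simp only: IH\<close>)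
      then show ?thesis by (simp only: dirds_Suc_newest v[symmetric])
    qed
    then show ?case by blast
  qed
  show "j \<le> n \<Longrightarrow> DH \<iota> j f x \<in> multilinear_forms j" by (rule ml)
  show "j \<le> n \<Longrightarrow> DH \<iota> j f = (\<lambda>x u. dirds \<iota> j u f x)" by (rule eq)
  show "smooth_along \<iota> n f"
  proof (rule smooth_alongI)
    fix j u assume j: "j \<le> n"
    then have "(\<lambda>x. DH \<iota> j f x u) \<in> Cb" using f by (simp add: CH_def)
    then show "dirds \<iota> j u f \<in> Cb" by (simp add: eq[OF j])
  next
    fix j u h x assume j: "j < n"
    have "((\<lambda>r. dirds \<iota> j u f (x + r *\<^sub>R \<iota> h)) has_real_derivative DH \<iota> (Suc j) f x (case_nat h u)) (at 0)"
      using d[OF j, of x h u] by (simp only: eq[OF less_imp_le[OF j]])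
    then show "((\<lambda>r. dirds \<iota> j u f (x + r *\<^sub>R \<iota> h)) has_real_derivative dird \<iota> h (dirds \<iota> j u f) x) (at 0)"
      using dird_eqI by metis
  qed
qed

lemma ZH_imp_ZH_bounded:
  assumes \<iota>: "bounded_linear \<iota>" and f: "f \<in> ZH \<iota> k" and b: "ZH_norm \<iota> k f \<le> ennreal b" "b \<ge> 0"
  shows "ZH_bounded \<iota> k f b"
proof -
  let ?n = "k - 1"
  have CH: "f \<in> CH \<iota> ?n" and Z1: "DH \<iota> ?n f \<in> Z1 \<iota> ?n" using f by (auto simp: ZH_def)
  note F = CH_D[OF CH]
  have sup: "sup_norm f \<le> ennreal b" and sum: "(\<Sum>j=1..?n. SUP x. form_norm j (DH \<iota> j f x)) \<le> ennreal b"
    and Z: "Z1_seminorm \<iota> ?n (DH \<iota> ?n f) \<le> ennreal b"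
    using b(1) unfolding ZH_norm_def CH_norm_def
    by (meson add_increasing add_increasing2 order_refl order_trans zero_le)+
  have fb: "\<bar>f x\<bar> \<le> b" for x
  proof -
    have "ennreal \<bar>f x\<bar> \<le> sup_norm f" unfolding sup_norm_def by (rule SUP_upper) simp
    then show ?thesis using sup b(2) by (metis ennreal_le_iff order_trans)
  qed
  have zero: "dirds \<iota> j u f x = 0" if "j \<le> ?n" "i < j" "u i = 0" for j u x i
    using multilinear_forms_zero[OF F(1)[OF that(1), of x] that(2), of u] that(3) by (simp add: F(2)[OF that(1)])
  have db: "derivs_bounded \<iota> j f b" if j: "j \<le> ?n" for j
  proof (cases "j = 0")
    case True
    then show ?thesis using fb by (simp add: derivs_bounded_def)
  next
    case False
    have "form_norm j (DH \<iota> j f x) \<le> ennreal b" for x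
    proof -
      have "form_norm j (DH \<iota> j f x) \<le> (SUP x. form_norm j (DH \<iota> j f x))" by (rule SUP_upper) simp
      also have "\<dots> \<le> (\<Sum>j=1..?n. SUP x. form_norm j (DH \<iota> j f x))"
        by (rule member_le_sum) (use j False in auto)
      finally show ?thesis using sum by (rule order_trans)
    qed
    then show ?thesis
      unfolding derivs_bounded_def F(2)[OF j] by (intro allI form_norm_leD b(2) zero[OF j])
  qed
  have nc: "norm_cont \<iota> ?n f x" for x
    unfolding norm_cont_def
  proof (intro allI impI)
    fix e :: real assume e: "e > 0"
    have "((\<lambda>y. form_norm ?n (\<lambda>u. dirds \<iota> ?n u f y - dirds \<iota> ?n u f x)) \<longlongrightarrow> 0) (at x)"
      using Z1 unfolding Z1_def Cb_form_def F(2)[OF order_refl] by blast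
    from form_norm_tendsto_0D[OF this e]
    have "\<forall>\<^sub>F y in at x. \<forall>u. \<bar>dirds \<iota> ?n u f y - dirds \<iota> ?n u f x\<bar> \<le> e * norm_prod ?n u"
      using zero[OF order_refl] by simp
    then show "\<forall>\<^sub>F y in nhds x. \<forall>u. \<bar>dirds \<iota> ?n u f y - dirds \<iota> ?n u f x\<bar> \<le> e * norm_prod ?n u"
      unfolding eventually_at_filter
    proof eventually_elim
      case (elim y)
      then show ?case using e by (cases "y = x") (auto intro!: mult_nonneg_nonneg prod_nonneg)
    qed
  qed
  have "\<bar>diff2 \<iota> h (dirds \<iota> ?n u f) x\<bar>
       \<le> b * norm h * norm_prod ?n u" if h: "h \<noteq> 0" for x u h
  proof (rule form_norm_leD)
    let ?F = "form_norm ?n (\<lambda>u. diff2 \<iota> h (dirds \<iota> ?n u f) x)"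
    have "?F / ennreal (norm h) \<le> Z1_seminorm \<iota> ?n (DH \<iota> ?n f)"
      unfolding Z1_seminorm_def F(2)[OF order_refl] using h by (intro SUP_upper2[of x] SUP_upper2[of h]) auto
    then have "?F / ennreal (norm h) \<le> ennreal b" using Z by (rule order_trans)
    then have "?F / ennreal (norm h) * ennreal (norm h) \<le> ennreal b * ennreal (norm h)"
      by (rule mult_right_mono) simp
    also have "?F / ennreal (norm h) * ennreal (norm h) = ?F"
      using h by (subst ennreal_divide_times) (simp add: divide_ennreal)
    finally show "?F \<le> ennreal (b * norm h)" using b(2) by (simp add: ennreal_mult)
  qed (use b(2) zero[OF order_refl] in auto)
  moreover have "\<bar>diff2 \<iota> h (dirds \<iota> ?n u f) x\<bar>
       \<le> b * norm h * norm_prod ?n u" if "h = 0" for x u h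
    using that linear_0[OF bounded_linear.linear[OF \<iota>]] by simp
  ultimately show ?thesis
    using F(3) nc db unfolding ZH_bounded_def by blast
qed

text \<open>\<open>CH\<close> bounds the derivatives for each fixed tuple of directions;
  completeness of \<open>H\<close> turns this into a bound on the operator norm, uniform in the
  point. Only then can a finite real constant be attached to \<open>f\<close>.\<close>

lemma ZH_norm_finite:
  fixes \<iota> :: "'h::banach \<Rightarrow> 'x::real_normed_vector"
  assumes f: "f \<in> ZH \<iota> k"
  shows "ZH_norm \<iota> k f < \<infinity>"
proof -
  let ?n = "k - 1"
  have CH: "f \<in> CH \<iota> ?n" and Z1: "Z1_seminorm \<iota> ?n (DH \<iota> ?n f) < \<infinity>"
    using f by (auto simp: ZH_def Z1_def)
  have Cb: "f \<in> Cb" using CH by (simp add: CH_def)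
  obtain B where "\<And>x. \<bar>f x\<bar> \<le> B" using CbD(3)[OF Cb] by auto
  then have "sup_norm f \<le> ennreal B" unfolding sup_norm_def by (intro SUP_least ennreal_leI)
  then have sup: "sup_norm f < \<infinity>" by (rule le_less_trans) simp
  have "(SUP x. form_norm j (DH \<iota> j f x)) < \<infinity>" if j: "j \<le> ?n" for j
  proof -
    have "\<exists>B\<ge>0. \<forall>A\<in>range (DH \<iota> j f). \<forall>u. \<bar>A u\<bar> \<le> B * norm_prod j u"
    proof (rule multilinear_uniform_bound)
      show "range (DH \<iota> j f) \<subseteq> multilinear_forms j" using CH_D(1)[OF CH j] by auto
      show "\<exists>B. \<forall>A\<in>range (DH \<iota> j f). \<bar>A u\<bar> \<le> B" for u
      proof -
        have "(\<lambda>x. DH \<iota> j f x u) \<in> Cb" using CH j by (simp add: CH_def)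
        from CbD(3)[OF this] show ?thesis by auto
      qed
    qed
    then obtain B where "\<And>x u. \<bar>DH \<iota> j f x u\<bar> \<le> B * norm_prod j u" by auto
    then have "(SUP x. form_norm j (DH \<iota> j f x)) \<le> ennreal B"
      by (intro SUP_least form_norm_le)
    then show ?thesis by (rule le_less_trans) simp
  qed
  then have "(\<Sum>j=1..?n. SUP x. form_norm j (DH \<iota> j f x)) < \<infinity>"
    by (auto simp: less_top[symmetric] infinity_ennreal_def)
  then show ?thesis using sup Z1 by (simp add: ZH_norm_def CH_norm_def)
qed

section \<open>The Zygmund condition\<close>

lemma norm_cont_add:
  assumes f: "smooth_along \<iota> n f" "norm_cont \<iota> n f x" and g: "smooth_along \<iota> n g" "norm_cont \<iota> n g x"
  shows "norm_cont \<iota> n (\<lambda>x. f x + g x) x"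
  unfolding norm_cont_def
proof (intro allI impI)
  fix e :: real assume "e > 0"
  then have e: "e / 2 > 0" by simp
  have add: "dirds \<iota> n u (\<lambda>x. f x + g x) y = dirds \<iota> n u f y + dirds \<iota> n u g y" for u y
    using smooth_along_linear(2)[OF f(1) g(1) order_refl, of u 1 1] by simp
  from f(2)[unfolded norm_cont_def, rule_format, OF e] g(2)[unfolded norm_cont_def, rule_format, OF e]
  show "\<forall>\<^sub>F y in nhds x. \<forall>u. \<bar>dirds \<iota> n u (\<lambda>x. f x + g x) y - dirds \<iota> n u (\<lambda>x. f x + g x) x\<bar>
      \<le> e * norm_prod n u"
  proof eventually_elim
    case (elim y)
    show ?case
    proof
      fix u
      from elim(1)[rule_format, of u] elim(2)[rule_format, of u]
      show "\<bar>dirds \<iota> n u (\<lambda>x. f x + g x) y - dirds \<iota> n u (\<lambda>x. f x + g x) x\<bar> \<le> e * norm_prod n u"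
        unfolding add by argo
    qed
  qed
qed

lemma ZH_bounded_add:
  assumes f: "ZH_bounded \<iota> k f b" and g: "ZH_bounded \<iota> k g c"
  shows "ZH_bounded \<iota> k (\<lambda>x. f x + g x) (b + c)"
proof -
  note F = ZH_boundedD[OF f] and G = ZH_boundedD[OF g]
  have add: "dirds \<iota> j u (\<lambda>x. f x + g x) y = dirds \<iota> j u f y + dirds \<iota> j u g y" if "j \<le> k - 1" for j u y
    using smooth_along_linear(2)[OF F(1) G(1) that, of u 1 1] by simp
  show ?thesis
    unfolding ZH_bounded_def
  proof (intro conjI allI impI)
    show "smooth_along \<iota> (k - 1) (\<lambda>x. f x + g x)"
      using smooth_along_linear(1)[OF F(1) G(1), of 1 1] by simp
    show "norm_cont \<iota> (k - 1) (\<lambda>x. f x + g x) x" for x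
      by (rule norm_cont_add[OF F(1,2) G(1,2)])
    show "derivs_bounded \<iota> j (\<lambda>x. f x + g x) (b + c)" if j: "j \<le> k - 1" for j
      unfolding derivs_bounded_def add[OF j]
    proof (intro allI)
      fix u x
      from F(3)[OF j, unfolded derivs_bounded_def, rule_format, of u x]
        G(3)[OF j, unfolded derivs_bounded_def, rule_format, of u x]
      show "\<bar>dirds \<iota> j u f x + dirds \<iota> j u g x\<bar> \<le> (b + c) * norm_prod j u"
        unfolding distrib_right by linarith
    qed
    fix x u h
    have split: "(a + a') - 2 * (b + b') + (c + c') = (a - 2 * b + c) + (a' - 2 * b' + c')" for a a' b b' c c' :: real
      by simp
    show "\<bar>diff2 \<iota> h (dirds \<iota> (k - 1) u (\<lambda>x. f x + g x)) x\<bar> \<le> (b + c) * norm h * norm_prod (k - 1) u"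
      unfolding add[OF order_refl] distrib_right split
      by (rule order_trans[OF abs_triangle_ineq add_mono[OF F(4) G(4)]])
  qed
qed

text \<open>Twice the increment over \<open>z\<close> is the increment over \<open>2 * z\<close>
  minus a second difference. Iterating \<open>n\<close> times gives, in quantitative form, the
  modulus \<open>z log (1 / z)\<close> of Zygmund functions, which need not be Lipschitz.\<close>

lemma zygmund_modulus:
  fixes \<gamma> :: "'x::real_normed_vector \<Rightarrow> real"
  assumes B: "\<And>x. \<bar>\<gamma> x\<bar> \<le> B" and K: "\<And>x z. \<bar>\<gamma> (x + (2 * z) *\<^sub>R v) - 2 * \<gamma> (x + z *\<^sub>R v) + \<gamma> x\<bar> \<le> K * \<bar>z\<bar>"
    and K0: "K \<ge> 0"
  shows "\<bar>\<gamma> (x + z *\<^sub>R v) - \<gamma> x\<bar> \<le> 2 * B / 2 ^ n + real n * K * \<bar>z\<bar>"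
proof (induction n arbitrary: x z)
  case 0
  show ?case using B[of "x + z *\<^sub>R v"] B[of x] by simp
next
  case (Suc n)
  define a where "a = \<gamma> (x + (2 * z) *\<^sub>R v)"
  have "2 * \<bar>b - c\<bar> \<le> \<bar>a - c\<bar> + \<bar>a - 2 * b + c\<bar>" for b c :: real
  proof -
    have "2 * \<bar>b - c\<bar> = \<bar>2 * (b - c)\<bar>" by (simp only: abs_mult)
    also have "2 * (b - c) = (a - c) - (a - 2 * b + c)" by simp
    finally show ?thesis using abs_triangle_ineq4[of "a - c" "a - 2 * b + c"] by simp
  qed
  also have "\<bar>a - \<gamma> x\<bar> + \<bar>a - 2 * \<gamma> (x + z *\<^sub>R v) + \<gamma> x\<bar> \<le> (2 * B / 2 ^ n + real n * K * \<bar>2 * z\<bar>) + K * \<bar>z\<bar>"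
    unfolding a_def by (intro add_mono Suc.IH K)
  finally have "2 * \<bar>\<gamma> (x + z *\<^sub>R v) - \<gamma> x\<bar> \<le> 2 * B / 2 ^ n + 2 * (real n * K * \<bar>z\<bar>) + K * \<bar>z\<bar>"
    by (simp add: abs_mult)
  moreover have "0 \<le> K * \<bar>z\<bar>" using K0 by simp
  moreover have "2 * (2 * B / 2 ^ Suc n) = 2 * B / 2 ^ n" by simp
  moreover have "real (Suc n) * K * \<bar>z\<bar> = real n * K * \<bar>z\<bar> + K * \<bar>z\<bar>" by (simp add: algebra_simps)
  ultimately show ?case by argo
qed

text \<open>The point is that \<open>d\<close> is chosen before \<open>f\<close>: all time slices of
  a solution share it.\<close>

lemma ZH_bounded_equicontinuous:
  assumes \<iota>: "bounded_linear \<iota>" and j: "j \<le> k - 1" and b: "b \<ge> 0" and e: "e > 0"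
  shows "\<exists>d>0. \<forall>f x z. ZH_bounded \<iota> k f b \<longrightarrow> 0 \<le> z \<longrightarrow> z \<le> d \<longrightarrow>
    \<bar>dirds \<iota> j u f (x + z *\<^sub>R \<iota> h) - dirds \<iota> j u f x\<bar> \<le> e"
proof -
  define p where "p = norm_prod j u"
  have p: "p \<ge> 0" unfolding p_def by (intro prod_nonneg) auto
  define K where "K = b * (norm h * p)"
  have K: "K \<ge> 0" using b p by (simp add: K_def)
  have "\<exists>n. 2 * (b * p) / 2 ^ n < e / 2"
  proof -
    have "(\<lambda>n. 2 * (b * p) * (1 / 2) ^ n) \<longlonglongrightarrow> 2 * (b * p) * 0"
      by (intro tendsto_intros LIMSEQ_power_zero) simp
    then have "\<forall>\<^sub>F n in sequentially. 2 * (b * p) * (1 / 2) ^ n < e / 2"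
      by (rule order_tendstoD(2)) (use e in simp)
    then obtain n where "2 * (b * p) * (1 / 2) ^ n < e / 2"
      using eventually_happens'[OF sequentially_bot] by blast
    then show ?thesis by (intro exI[of _ n]) (simp add: power_one_over)
  qed
  then obtain n where n: "2 * (b * p) / 2 ^ n < e / 2" by blast
  \<comment> \<open>\<open>real n * K\<close> belongs to the Zygmund modulus at the top order and
    \<open>K\<close> to the Lipschitz bound below it, so one \<open>d\<close> serves both cases; the
    1 keeps the denominator positive.\<close>
  define d where "d = e / (2 * (real n * K + K + 1))"
  have pos: "real n * K + K + 1 > 0" using K by (simp add: add_nonneg_pos)
  have d: "d > 0" using e pos by (simp add: d_def)
  have "(real n * K + K) * d = (e / 2) * ((real n * K + K) / (real n * K + K + 1))"
    by (simp add: d_def)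
  also have "\<dots> \<le> (e / 2) * 1"
    using e pos by (intro mult_left_mono) (simp_all add: pos_divide_le_eq)
  finally have dK: "(real n * K + K) * d \<le> e / 2" by simp
  have "\<bar>dirds \<iota> j u f (x + z *\<^sub>R \<iota> h) - dirds \<iota> j u f x\<bar> \<le> e"
    if f: "ZH_bounded \<iota> k f b" and z: "0 \<le> z" "z \<le> d" for f x z
  proof -
    note F = ZH_boundedD[OF f]
    have Kz: "(real n * K + K) * z \<le> e / 2"
      using dK mult_left_mono[OF z(2), of "real n * K + K"] K by simp
    show ?thesis
    proof (cases "j < k - 1")
      case True
      have "\<bar>dirds \<iota> j u f (x + z *\<^sub>R \<iota> h) - dirds \<iota> j u f x\<bar> \<le> b * (norm h * norm_prod j u) * z"
        by (rule dirds_diff_le[OF smooth_along_mono[OF F(1)] F(3) z(1)]) (use True in auto)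
      also have "\<dots> = K * z" by (simp add: K_def p_def)
      also have "\<dots> \<le> (real n * K + K) * z" using K z by (intro mult_right_mono) auto
      finally show ?thesis using Kz e by linarith
    next
      case False
      then have jk: "j = k - 1" using j by simp
      have "\<bar>dirds \<iota> j u f (x + z *\<^sub>R \<iota> h) - dirds \<iota> j u f x\<bar> \<le> 2 * (b * p) / 2 ^ n + real n * K * \<bar>z\<bar>"
      proof (rule zygmund_modulus)
        show "\<bar>dirds \<iota> j u f x\<bar> \<le> b * p" for x
          using F(3)[OF j] unfolding derivs_bounded_def p_def by blast
        show "\<bar>dirds \<iota> j u f (x + (2 * z) *\<^sub>R \<iota> h) - 2 * dirds \<iota> j u f (x + z *\<^sub>R \<iota> h) + dirds \<iota> j u f x\<bar> \<le> K * \<bar>z\<bar>" for x z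
        proof -
          have "\<iota> (z *\<^sub>R h) = z *\<^sub>R \<iota> h" by (rule linear_scale[OF bounded_linear.linear[OF \<iota>]])
          then show ?thesis
            using F(4)[of u x "z *\<^sub>R h"] by (simp add: jk K_def p_def mult_ac)
        qed
      qed (rule K)
      moreover have "real n * K * \<bar>z\<bar> \<le> (real n * K + K) * z"
        using z(1) K by (simp add: algebra_simps)
      ultimately show ?thesis using n Kz by linarith
    qed
  qed
  then show ?thesis using d by blast
qed

text \<open>Regularity in time is inherited from \<open>V\<close>. Equicontinuity of the next
  derivative, uniform in \<open>t\<close>, makes its difference quotients converge uniformly on
  \<open>I \<times> UNIV\<close>, and joint continuity passes to the uniform limit.\<close>

lemma dirds_jointly_continuous:
  fixes V :: "real \<Rightarrow> 'x::real_normed_vector \<Rightarrow> real"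
  assumes \<iota>: "bounded_linear \<iota>" and cont: "continuous_on (I \<times> UNIV) (\<lambda>(t, x). V t x)"
    and V: "\<And>t. t \<in> I \<Longrightarrow> ZH_bounded \<iota> k (V t) b" and b: "b \<ge> 0" and j: "j \<le> k - 1"
  shows "continuous_on (I \<times> UNIV) (\<lambda>(t, x). dirds \<iota> j u (V t) x)"
  using j
proof (induction j arbitrary: u)
  case 0
  then show ?case using cont by simp
next
  case (Suc j)
  let ?h = "u 0" and ?u = "\<lambda>i. u (Suc i)"
  let ?\<rho> = "\<lambda>m::nat. 1 / real (Suc m)"
  define W where "W = (\<lambda>p. dirds \<iota> j ?u (V (fst p)) (snd p))"
  define D where "D = (\<lambda>p. dirds \<iota> (Suc j) u (V (fst p)) (snd p))"
  have W: "continuous_on (I \<times> UNIV) W"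
    using Suc.IH[of ?u] Suc.prems by (simp add: W_def case_prod_unfold)
  have "continuous_on (I \<times> UNIV) D"
  proof (rule uniform_limit_theorem)
    show "\<forall>\<^sub>F m in sequentially. continuous_on (I \<times> UNIV)
        (\<lambda>p. (W (fst p, snd p + ?\<rho> m *\<^sub>R \<iota> ?h) - W p) / ?\<rho> m)"
    proof (intro always_eventually allI continuous_on_divide continuous_on_diff W)
      show "continuous_on (I \<times> UNIV) (\<lambda>p. W (fst p, snd p + ?\<rho> m *\<^sub>R \<iota> ?h))" for m
        by (rule continuous_on_compose2[OF W]) (auto intro!: continuous_intros)
    qed auto
    show "uniform_limit (I \<times> UNIV) (\<lambda>m p. (W (fst p, snd p + ?\<rho> m *\<^sub>R \<iota> ?h) - W p) / ?\<rho> m) D sequentially"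
      unfolding uniform_limit_iff
    proof (intro allI impI)
      fix e :: real assume e: "e > 0"
      from ZH_bounded_equicontinuous[OF \<iota> Suc.prems b, of "e / 2" u ?h] e
      obtain d where d: "d > 0" "\<And>f x z. ZH_bounded \<iota> k f b \<Longrightarrow> 0 \<le> z \<Longrightarrow> z \<le> d \<Longrightarrow>
        \<bar>dirds \<iota> (Suc j) u f (x + z *\<^sub>R \<iota> ?h) - dirds \<iota> (Suc j) u f x\<bar> \<le> e / 2" by auto
      have "\<forall>\<^sub>F m in sequentially. ?\<rho> m < d"
        using order_tendstoD(2)[OF LIMSEQ_inverse_real_of_nat d(1)] by (simp add: inverse_eq_divide)
      then show "\<forall>\<^sub>F m in sequentially. \<forall>p\<in>I \<times> UNIV.
          dist ((W (fst p, snd p + ?\<rho> m *\<^sub>R \<iota> ?h) - W p) / ?\<rho> m) (D p) < e"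
      proof eventually_elim
        case (elim m)
        show ?case
        proof
          fix p assume "p \<in> I \<times> (UNIV :: 'x set)"
          then have Z: "ZH_bounded \<iota> k (V (fst p)) b" by (auto intro: V)
          have sm: "smooth_along \<iota> (k - 1) (V (fst p))" by (rule ZH_boundedD(1)[OF Z])
          have r: "?\<rho> m > 0" by simp
          let ?E = "\<lambda>z. dirds \<iota> (Suc j) u (V (fst p)) (snd p + z *\<^sub>R \<iota> ?h)"
          have u: "case_nat ?h ?u = u" by (rule ext) (simp split: nat.split)
          have "((\<lambda>r. dirds \<iota> j ?u (V (fst p)) (snd p + r *\<^sub>R \<iota> ?h)) has_real_derivative ?E r) (at r)" for r
            using dirds_DERIV[OF sm, of j ?u "snd p" ?h r] Suc.prems by (simp only: u Suc_le_eq)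
          then obtain z where z: "0 < z" "z < ?\<rho> m"
            "dirds \<iota> j ?u (V (fst p)) (snd p + ?\<rho> m *\<^sub>R \<iota> ?h) - dirds \<iota> j ?u (V (fst p)) (snd p + 0 *\<^sub>R \<iota> ?h) =
              (?\<rho> m - 0) * ?E z"
            using MVT2[of 0 "?\<rho> m" "\<lambda>r. dirds \<iota> j ?u (V (fst p)) (snd p + r *\<^sub>R \<iota> ?h)" ?E] r by blast
          have "(W (fst p, snd p + ?\<rho> m *\<^sub>R \<iota> ?h) - W p) / ?\<rho> m = ?E z"
            using z(3) r by (simp add: W_def field_simps del: dirds.simps)
          then show "dist ((W (fst p, snd p + ?\<rho> m *\<^sub>R \<iota> ?h) - W p) / ?\<rho> m) (D p) < e"
            using d(2)[OF Z, of z "snd p"] z elim e by (simp add: D_def dist_real_def del: dirds.simps)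
        qed
      qed
    qed
  qed simp
  then show ?case by (simp only: D_def case_prod_unfold)
qed

lemma ZH_TI:
  assumes \<iota>: "bounded_linear \<iota>" and cont: "continuous_on ({0..T} \<times> UNIV) (\<lambda>(t, x). V t x)"
    and V: "\<And>t. t \<in> {0..T} \<Longrightarrow> ZH_bounded \<iota> k (V t) b" and b: "b \<ge> 0"
  shows "V \<in> ZH_T \<iota> T k" "ZH_T_norm \<iota> T k V \<le> ennreal ((real k + 2) * b)"
proof -
  have "bounded ((\<lambda>(t, x). V t x) ` ({0..T} \<times> UNIV))"
    by (rule boundedI[of _ b]) (use ZH_boundedD(5)[OF V] in auto)
  then have Cb: "V \<in> Cb_T T" using cont by (simp add: Cb_T_def)
  show n: "ZH_T_norm \<iota> T k V \<le> ennreal ((real k + 2) * b)"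
    unfolding ZH_T_norm_def by (intro SUP_least ZH_bounded_imp_ZH(3)[OF \<iota> V])
  have "V \<in> CH_T \<iota> T (k - 1)"
    unfolding CH_T_def
  proof (intro CollectI conjI ballI allI impI Cb)
    show "V t \<in> CH \<iota> (k - 1)" if "t \<in> {0..T}" for t by (rule ZH_bounded_imp_ZH(1)[OF \<iota> V[OF that]])
    have "(SUP t\<in>{0..T}. CH_norm \<iota> (k - 1) (V t)) \<le> ennreal ((real k + 1) * b)"
      by (intro SUP_least ZH_bounded_CH_norm[OF \<iota> V])
    then show "(SUP t\<in>{0..T}. CH_norm \<iota> (k - 1) (V t)) < \<infinity>" by (rule le_less_trans) simp
    fix j h assume j: "j \<le> k - 1"
    have "continuous_on ({0..T} \<times> UNIV) (\<lambda>(t, x). dirds \<iota> j h (V t) x)"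
      by (rule dirds_jointly_continuous[OF \<iota> cont V b j])
    then show "continuous_on ({0..T} \<times> UNIV) (\<lambda>(t, x). DH \<iota> j (V t) x h)"
      by (rule continuous_on_eq) (auto simp: ZH_bounded_DH[OF \<iota> V j])
  qed
  moreover have "ZH_T_norm \<iota> T k V < \<infinity>" using n by (rule le_less_trans) simp
  ultimately show "V \<in> ZH_T \<iota> T k"
    unfolding ZH_T_def using Cb ZH_bounded_imp_ZH(2)[OF \<iota> V] by blast
qed

section \<open>Kernels for the time integral and bounds for increments\<close>

lemma has_bochner_integral_powr:
  fixes c q :: real
  assumes "c > 0"
  shows "q < 1 \<Longrightarrow> has_bochner_integral lborel (\<lambda>r. indicator {0..c} r * r powr (- q)) (c powr (1 - q) / (1 - q))"
    and "q > 1 \<Longrightarrow> has_bochner_integral lborel (\<lambda>r. indicator {c..} r * r powr (- q)) (c powr (1 - q) / (q - 1))"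
proof -
  have *: "has_bochner_integral lborel (\<lambda>r. indicator A r * r powr (- q)) I"
    if "((\<lambda>r. r powr (- q)) has_integral I) A" "I \<ge> 0" "A \<in> sets borel" for A I
    using that nn_integral_has_integral_lebesgue[OF _ that(1)]
    by (intro has_bochner_integral_nn_integral) auto
  show "has_bochner_integral lborel (\<lambda>r. indicator {0..c} r * r powr (- q)) (c powr (1 - q) / (1 - q))" if "q < 1"
    using has_integral_powr_from_0[of "- q" c] assms that by (intro *) auto
  show "has_bochner_integral lborel (\<lambda>r. indicator {c..} r * r powr (- q)) (c powr (1 - q) / (q - 1))" if "q > 1"
  proof (rule *)
    have "- (c powr (- q + 1)) / (- q + 1) = c powr (1 - q) / (q - 1)"
      using that by (simp add: divide_simps algebra_simps)
    then show "((\<lambda>r. r powr (- q)) has_integral c powr (1 - q) / (q - 1)) {c..}"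
      using has_integral_powr_to_inf[of "- q" c] assms that by simp
  qed (use that in auto)
qed

text \<open>
  The time integral of the second differences is split at \<open>\<eta> powr (1 / \<theta>)\<close>, where the two bounds
  balance; this gives the power \<open>\<eta>\<close> of the Zygmund condition.
\<close>

lemma zygmund_kernel:
  fixes \<theta> \<eta> p q p' q' :: real
  assumes \<theta>: "\<theta> > 0" and \<eta>: "\<eta> > 0" and q: "q < 1" "p + (1 - q) / \<theta> = 1"
    and q': "q' > 1" "p' + (1 - q') / \<theta> = 1"
  shows "\<exists>m. has_bochner_integral lborel m (\<eta> * (1 / (1 - q) + 1 / (q' - 1))) \<and> (\<forall>r. m r \<ge> 0) \<and>
    (\<forall>r>0. min (\<eta> powr p * r powr (- q)) (\<eta> powr p' * r powr (- q')) \<le> m r)"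
proof -
  define \<rho> where "\<rho> = \<eta> powr (1 / \<theta>)"
  have \<rho>: "\<rho> > 0" using \<eta> by (simp add: \<rho>_def)
  define m where "m = (\<lambda>r. \<eta> powr p * (indicator {0..\<rho>} r * r powr (- q)) + \<eta> powr p' * (indicator {\<rho>..} r * r powr (- q')))"
  have "has_bochner_integral lborel m (\<eta> powr p * (\<rho> powr (1 - q) / (1 - q)) + \<eta> powr p' * (\<rho> powr (1 - q') / (q' - 1)))"
    unfolding m_def
    by (intro has_bochner_integral_add has_bochner_integral_mult_right has_bochner_integral_powr \<rho> q q')
  moreover have "\<eta> powr p * \<rho> powr (1 - q) = \<eta>" "\<eta> powr p' * \<rho> powr (1 - q') = \<eta>"
    using q(2) q'(2) \<eta> by (simp_all add: \<rho>_def powr_powr powr_add[symmetric])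
  then have "\<eta> powr p * (\<rho> powr (1 - q) / (1 - q)) + \<eta> powr p' * (\<rho> powr (1 - q') / (q' - 1)) =
      \<eta> * (1 / (1 - q) + 1 / (q' - 1))"
    by (simp add: distrib_left)
  moreover have "m r \<ge> 0" for r by (simp add: m_def)
  moreover have "min (\<eta> powr p * r powr (- q)) (\<eta> powr p' * r powr (- q')) \<le> m r" if "r > 0" for r
  proof (cases "r \<le> \<rho>")
    case True
    then have "\<eta> powr p * r powr (- q) \<le> m r" using that by (simp add: m_def)
    then show ?thesis by simp
  next
    case False
    then have "\<eta> powr p' * r powr (- q') \<le> m r" by (simp add: m_def)
    then show ?thesis by simp
  qed
  ultimately show ?thesis by auto
qed

definition increment :: "('h \<Rightarrow> 'x::real_normed_vector) \<Rightarrow> 'h \<Rightarrow> ('x \<Rightarrow> real) \<Rightarrow> 'x \<Rightarrow> real" where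
  "increment \<iota> h f = (\<lambda>x. f (x + \<iota> h) - f x)"

lemma smooth_along_increment:
  assumes "smooth_along \<iota> n f"
  shows "smooth_along \<iota> n (increment \<iota> h f)"
    "dirds \<iota> n u (increment \<iota> h f) = (\<lambda>x. dirds \<iota> n u f (x + \<iota> h) - dirds \<iota> n u f x)"
  unfolding increment_def
  by (rule smooth_along_diff(1)[OF assms], rule smooth_along_diff(2)[OF assms order_refl])

lemma dirds_increment_twice:
  assumes f: "smooth_along \<iota> n f"
  shows "dirds \<iota> n u (increment \<iota> h (increment \<iota> h f)) x =
    diff2 \<iota> h (dirds \<iota> n u f) x"
  using smooth_along_increment(2)[OF smooth_along_increment(1)[OF f]] smooth_along_increment(2)[OF f]
  by (simp add: scaleR_2 add_ac)

text \<open>The triangle inequality keeps the order and gains nothing; the mean value theorem gains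
  \<open>norm h\<close> at the price of one derivative. Two increments, each treated in one of these
  ways, yield the bounds on either side of the splitting time.\<close>

lemma derivs_bounded_increment:
  assumes "\<And>n. smooth_along \<iota> n f"
  shows "derivs_bounded \<iota> n f B \<Longrightarrow> derivs_bounded \<iota> n (increment \<iota> h f) (2 * B)"
    "derivs_bounded \<iota> (Suc n) f B \<Longrightarrow> derivs_bounded \<iota> n (increment \<iota> h f) (B * norm h)"
  unfolding increment_def
  by (rule derivs_bounded_diff[OF assms], assumption, rule derivs_bounded_diff_Suc[OF assms], assumption)

section \<open>The time integral\<close>

lemma smooth_along_zero:
  "smooth_along \<iota> n (\<lambda>_. 0)" "dirds \<iota> j u (\<lambda>_. 0) = (\<lambda>_. 0)"
proof -
  have d: "dird \<iota> h (\<lambda>_. 0) = (\<lambda>_. 0)" for h by (rule ext, rule dird_eqI) simp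
  show "dirds \<iota> j u (\<lambda>_. 0) = (\<lambda>_. 0)" by (induction j) (simp_all add: d)
  show "smooth_along \<iota> n (\<lambda>_. 0)" by (induction n) (simp_all add: d Cb_def)
qed

lemma Cb_T_slice: "g \<in> Cb_T T \<Longrightarrow> s \<in> {0..T} \<Longrightarrow> g s \<in> Cb"
proof -
  assume g: "g \<in> Cb_T T" and s: "s \<in> {0..T}"
  have "continuous_on UNIV (\<lambda>x. (\<lambda>(t, x). g t x) (s, x))"
    by (rule continuous_on_compose2[of "{0..T} \<times> UNIV"]) (use g s in \<open>auto simp: Cb_T_def intro!: continuous_intros\<close>)
  moreover have "bounded (range (g s))"
    by (rule bounded_subset[of "(\<lambda>(t, x). g t x) ` ({0..T} \<times> UNIV)"]) (use g s in \<open>auto simp: Cb_T_def\<close>)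
  ultimately show "g s \<in> Cb" by (simp add: Cb_def)
qed

context fomin_mehler_semigroup
begin

text \<open>The end point \<open>s = t\<close>, where \<open>Pt 0\<close> does not smooth, is a null
  set and is left out; elsewhere outside the range the slice is 0 as well. Every slice is thereby
  smooth, without exceptional times.\<close>

definition duhamel_slice :: "(real \<Rightarrow> 'x \<Rightarrow> real) \<Rightarrow> real \<Rightarrow> real \<Rightarrow> 'x \<Rightarrow> real" where
  "duhamel_slice g t s = (if 0 \<le> s \<and> s < t then Pt (t - s) (g s) else (\<lambda>_. 0))"

definition duhamel :: "(real \<Rightarrow> 'x \<Rightarrow> real) \<Rightarrow> real \<Rightarrow> 'x \<Rightarrow> real" where
  "duhamel g t x = (LINT s|lborel. duhamel_slice g t s x)"

lemma continuous_on_mehler_time: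
  assumes g: "g \<in> Cb_T T" and t: "t \<le> T"
  shows "continuous_on {0..t} (\<lambda>s. Pt (t - s) (g s) x)"
  unfolding continuous_on_sequentially comp_def
proof (intro allI ballI impI, elim conjE)
  fix s s' assume s: "\<forall>n. s n \<in> {0..t}" "s \<longlonglongrightarrow> s'"
  show "(\<lambda>n. Pt (t - s n) (g (s n)) x) \<longlonglongrightarrow> Pt (t - s') (g s') x"
  proof (rule mehler_tendsto[OF g])
    show "t - s n \<ge> 0" "s n \<in> {0..T}" for n using s(1)[rule_format, of n] t by auto
    show "(\<lambda>n. t - s n) \<longlonglongrightarrow> t - s'" by (intro tendsto_intros s(2))
  qed (rule s(2), rule tendsto_const)
qed

lemma duhamel_slice_measurable:
  assumes "g \<in> Cb_T T" "t \<le> T"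
  shows "(\<lambda>s. duhamel_slice g t s x) \<in> borel_measurable lborel"
proof -
  have "(\<lambda>s. indicator {0..<t} s *\<^sub>R Pt (t - s) (g s) x) \<in> borel_measurable borel"
    by (intro borel_measurable_continuous_on_indicator continuous_on_subset[OF continuous_on_mehler_time[OF assms]]) auto
  moreover have "(\<lambda>s. indicator {0..<t} s *\<^sub>R Pt (t - s) (g s) x) = (\<lambda>s. duhamel_slice g t s x)"
    by (auto simp: duhamel_slice_def indicator_def)
  ultimately show ?thesis by simp
qed

lemma mild_solution_eq:
  assumes "g \<in> Cb_T T" "t \<le> T"
  shows "mild_solution S \<mu> f g t x = Pt t f x + duhamel g t x"
proof -
  have "(\<lambda>s. indicator {0..t} s *\<^sub>R Pt (t - s) (g s) x) \<in> borel_measurable borel"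
    by (intro borel_measurable_continuous_on_indicator continuous_on_mehler_time[OF assms]) auto
  moreover have "AE s in lborel. indicator {0..t} s *\<^sub>R Pt (t - s) (g s) x = duhamel_slice g t s x"
    using AE_lborel_singleton[of t] by eventually_elim (auto simp: duhamel_slice_def indicator_def)
  ultimately have "(LINT s:{0..t}|lborel. Pt (t - s) (g s) x) = duhamel g t x"
    unfolding duhamel_def set_lebesgue_integral_def
    by (intro integral_cong_AE duhamel_slice_measurable[OF assms]) auto
  then show ?thesis by (simp add: mild_solution_def)
qed

lemma duhamel_slice_bound:
  assumes g: "g \<in> Cb_T T" and b: "\<And>s x. s \<in> {0..T} \<Longrightarrow> \<bar>g s x\<bar> \<le> b" and t: "t \<in> {0..T}"
  shows "\<bar>duhamel_slice g t s x\<bar> \<le> b * indicator {0..T} s"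
proof (cases "0 \<le> s \<and> s < t")
  case True
  then have s: "s \<in> {0..T}" using t by auto
  have "\<bar>Pt (t - s) (g s) x\<bar> \<le> b"
    by (rule mehler_bound[OF _ Cb_T_slice[OF g s] b[OF s]]) (use True in simp)
  then show ?thesis using True s by (simp add: duhamel_slice_def)
next
  case False
  have "T \<ge> 0" using t by simp
  then have "b \<ge> 0" using b[of 0 0] by simp
  then show ?thesis using False by (auto simp: duhamel_slice_def)
qed

text \<open>The interval of integration moves with \<open>t\<close>, but the slices converge at
  every \<open>s\<close> other than the limit time and are dominated by \<open>b\<close> on
  \<open>{0..T}\<close>.\<close>

lemma duhamel_continuous:
  assumes g: "g \<in> Cb_T T" and b: "\<And>s x. s \<in> {0..T} \<Longrightarrow> \<bar>g s x\<bar> \<le> b"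
  shows "continuous_on ({0..T} \<times> UNIV) (\<lambda>(t, x). duhamel g t x)"
  unfolding continuous_on_sequentially comp_def
proof (intro allI ballI impI, elim conjE)
  fix p :: "nat \<Rightarrow> real \<times> 'x" and a
  assume a: "a \<in> {0..T} \<times> (UNIV :: 'x set)" and p: "\<forall>n. p n \<in> {0..T} \<times> (UNIV :: 'x set)" "p \<longlonglongrightarrow> a"
  define t x t' x' where "t = (\<lambda>n. fst (p n))" and "x = (\<lambda>n. snd (p n))" and "t' = fst a" and "x' = snd a"
  have lim: "t \<longlonglongrightarrow> t'" "x \<longlonglongrightarrow> x'"
    unfolding t_def x_def t'_def x'_def by (intro tendsto_intros p(2))+
  have t: "t n \<in> {0..T}" for n using p(1)[rule_format, of n] by (auto simp: t_def)
  have t': "t' \<in> {0..T}" using a by (auto simp: t'_def)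
  have "(\<lambda>n. LINT s|lborel. duhamel_slice g (t n) s (x n)) \<longlonglongrightarrow> (LINT s|lborel. duhamel_slice g t' s x')"
  proof (rule integral_dominated_convergence[where w="\<lambda>s. b * indicator {0..T} s"])
    show "(\<lambda>s. duhamel_slice g t' s x') \<in> borel_measurable lborel"
      "\<And>n. (\<lambda>s. duhamel_slice g (t n) s (x n)) \<in> borel_measurable lborel"
      using t t' by (intro duhamel_slice_measurable[OF g]; simp)+
    show "AE s in lborel. norm (duhamel_slice g (t n) s (x n)) \<le> b * indicator {0..T} s" for n
      using duhamel_slice_bound[OF g b t] by simp
    show "AE s in lborel. (\<lambda>n. duhamel_slice g (t n) s (x n)) \<longlonglongrightarrow> duhamel_slice g t' s x'"
      using AE_lborel_singleton[of t']
    proof eventually_elim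
      case (elim s)
      consider "s < 0" | "s > t'" | "0 \<le> s" "s < t'" using elim by linarith
      then show ?case
      proof cases
        case 1
        then show ?thesis by (simp add: duhamel_slice_def)
      next
        case 2
        have "\<forall>\<^sub>F n in sequentially. duhamel_slice g (t n) s (x n) = 0"
          using order_tendstoD(2)[OF lim(1) 2] by eventually_elim (simp add: duhamel_slice_def)
        moreover have "duhamel_slice g t' s x' = 0" using 2 by (simp add: duhamel_slice_def)
        ultimately show ?thesis by (simp add: tendsto_eventually)
      next
        case 3
        \<comment> \<open>Truncation at 0 keeps all times admissible for
          \<open>mehler_tendsto\<close>; since \<open>s < t'\<close>, it has no effect for large
          \<open>n\<close>.\<close>
        have "(\<lambda>n. max 0 (t n - s)) \<longlonglongrightarrow> max 0 (t' - s)" by (intro tendsto_intros lim)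
        then have r: "(\<lambda>n. max 0 (t n - s)) \<longlonglongrightarrow> t' - s" using 3 by simp
        have "s \<in> {0..T}" using 3 t' by auto
        then have "(\<lambda>n. Pt (max 0 (t n - s)) (g s) (x n)) \<longlonglongrightarrow> Pt (t' - s) (g s) x'"
          by (rule mehler_tendsto[OF g max.cobounded1 r _ tendsto_const lim(2)])
        moreover have "\<forall>\<^sub>F n in sequentially. Pt (max 0 (t n - s)) (g s) (x n) = duhamel_slice g (t n) s (x n)"
          using order_tendstoD(1)[OF lim(1) 3(2)] by eventually_elim (use 3 in \<open>simp add: duhamel_slice_def\<close>)
        ultimately have "(\<lambda>n. duhamel_slice g (t n) s (x n)) \<longlonglongrightarrow> Pt (t' - s) (g s) x'"
          by (rule Lim_transform_eventually)
        then show ?thesis using 3 by (simp add: duhamel_slice_def)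
      qed
    qed
    show "integrable lborel (\<lambda>s. b * indicator {0..T} s)"
      by (intro integrable_mult_right integrable_real_indicator) (auto simp: emeasure_lborel_Icc_eq)
  qed
  then show "(\<lambda>n. case p n of (t, x) \<Rightarrow> duhamel g t x) \<longlonglongrightarrow> (case a of (t, x) \<Rightarrow> duhamel g t x)"
    by (simp add: duhamel_def case_prod_unfold t_def x_def t'_def x'_def)
qed

text \<open>Two competing bounds for the same second difference, to be used with
  \<open>q < 1\<close> for small \<open>r\<close> and \<open>q' > 1\<close> for large
  \<open>r\<close>. The two parts of the theorem differ only in the four exponents and in the norm
  of \<open>g\<close>.\<close>

abbreviation increments_bounded ::
  "real \<Rightarrow> nat \<Rightarrow> (real \<Rightarrow> 'x \<Rightarrow> real) \<Rightarrow> real \<Rightarrow> real \<Rightarrow> real \<Rightarrow> real \<Rightarrow> real \<Rightarrow> bool" where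
  "increments_bounded T n g A p q p' q' \<equiv> \<forall>r s h. 0 < r \<longrightarrow> r \<le> T \<longrightarrow> s \<in> {0..T} \<longrightarrow> h \<noteq> 0 \<longrightarrow>
    derivs_bounded \<iota> n (increment \<iota> h (increment \<iota> h (Pt r (g s)))) (A * (norm h powr p * r powr (- q))) \<and>
    derivs_bounded \<iota> n (increment \<iota> h (increment \<iota> h (Pt r (g s)))) (A * (norm h powr p' * r powr (- q')))"

text \<open>Common to both parts. All estimates scale linearly in \<open>b\<close>, which is why
  \<open>A * b\<close> stands in the hypothesis while \<open>K\<close> is fixed before
  \<open>g\<close>, \<open>b\<close> and \<open>t\<close>.\<close>

lemma duhamel_ZH_bounded:
  assumes T: "T > 0" and k: "real (k - 1) * \<theta> < 1" and A: "A \<ge> 0"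
    and q: "q < 1" "p + (1 - q) / \<theta> = 1" and q': "q' > 1" "p' + (1 - q') / \<theta> = 1"
  shows "\<exists>K\<ge>0. \<forall>g b t. t \<in> {0..T} \<longrightarrow> g \<in> Cb_T T \<longrightarrow> (\<forall>s\<in>{0..T}. \<forall>x. \<bar>g s x\<bar> \<le> b) \<longrightarrow>
    (increments_bounded T (k - 1) g (A * b) p q p' q') \<longrightarrow>
    ZH_bounded \<iota> k (duhamel g t) (K * b)"
proof -
  let ?n = "k - 1"
  define Q where "Q = (\<lambda>j c. c \<ge> 0 \<and> (\<forall>t f b. 0 < t \<longrightarrow> t \<le> T \<longrightarrow> f \<in> Cb \<longrightarrow> (\<forall>x. \<bar>f x\<bar> \<le> b) \<longrightarrow>
     smooth_along \<iota> j (Pt t f) \<and>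
     derivs_bounded \<iota> j (Pt t f) (c * t powr (- (real j * \<theta>)) * b)))"
  have "\<exists>c. Q j c" for j unfolding Q_def by (rule mehler_smoothing)
  then obtain c where "\<And>j. Q j (c j)" by metis
  then have c: "\<And>j. c j \<ge> 0" "\<And>j t f b. 0 < t \<Longrightarrow> t \<le> T \<Longrightarrow> f \<in> Cb \<Longrightarrow> (\<And>x. \<bar>f x\<bar> \<le> b) \<Longrightarrow>
     derivs_bounded \<iota> j (Pt t f) (c j * t powr (- (real j * \<theta>)) * b)"
    unfolding Q_def by blast+
  \<comment> \<open>\<open>I j\<close> is the integral of
    \<open>r powr (- (real j * \<theta>))\<close> over \<open>{0..T}\<close>, finite because
    \<open>real j * \<theta> < 1\<close>; \<open>Z\<close> is \<open>A\<close> times the constant of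
    \<open>zygmund_kernel\<close>. Their sum dominates each order and the Zygmund seminorm
    alike.\<close>
  define I where "I = (\<lambda>j. T powr (1 - real j * \<theta>) / (1 - real j * \<theta>))"
  define Z where "Z = A * (1 / (1 - q) + 1 / (q' - 1))"
  define K where "K = (\<Sum>j\<le>?n. c j * I j) + Z"
  have j\<theta>: "real j * \<theta> < 1" if "j \<le> ?n" for j
  proof -
    have "real j * \<theta> \<le> real ?n * \<theta>" using that constants_pos by (intro mult_right_mono) auto
    then show ?thesis using k by simp
  qed
  have I0: "I j \<ge> 0" if "j \<le> ?n" for j using j\<theta>[OF that] by (simp add: I_def)
  have Z0: "Z \<ge> 0" using A q q' by (simp add: Z_def)
  have s0: "(\<Sum>j\<le>?n. c j * I j) \<ge> 0" by (intro sum_nonneg mult_nonneg_nonneg c I0) simp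
  have KI: "c j * I j \<le> K" if "j \<le> ?n" for j
  proof -
    have "c j * I j \<le> (\<Sum>j\<le>?n. c j * I j)"
      by (rule member_le_sum) (use that c I0 in auto)
    then show ?thesis using Z0 by (simp add: K_def)
  qed
  have main: "ZH_bounded \<iota> k (duhamel g t) (K * b)"
    if t: "t \<in> {0..T}" and g: "g \<in> Cb_T T" and b: "\<And>s x. s \<in> {0..T} \<Longrightarrow> \<bar>g s x\<bar> \<le> b"
    and zyg: "\<And>r s h. 0 < r \<Longrightarrow> r \<le> T \<Longrightarrow> s \<in> {0..T} \<Longrightarrow> h \<noteq> 0 \<Longrightarrow>
      derivs_bounded \<iota> ?n (increment \<iota> h (increment \<iota> h (Pt r (g s)))) (A * b * (norm h powr p * r powr (- q))) \<and>
      derivs_bounded \<iota> ?n (increment \<iota> h (increment \<iota> h (Pt r (g s)))) (A * b * (norm h powr p' * r powr (- q')))"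
    for g b t
  proof -
    have b0: "b \<ge> 0" using b[of 0 0] T by simp
    let ?\<Phi> = "duhamel_slice g t"
    have gs: "g s \<in> Cb" if "0 \<le> s" "s < t" for s
      by (rule Cb_T_slice[OF g]) (use that t in auto)
    have sm: "smooth_along \<iota> m (?\<Phi> s)" for m s
      by (auto simp: duhamel_slice_def smooth_along_zero(1) intro!: mehler_smooth gs)
    have nc: "norm_cont \<iota> ?n (?\<Phi> s) x" for s x
    proof (cases "0 \<le> s \<and> s < t")
      case True
      then show ?thesis by (auto simp: duhamel_slice_def intro!: norm_cont_mehler_pos gs)
    next
      case False
      then show ?thesis
        by (auto simp: duhamel_slice_def norm_cont_def smooth_along_zero(2) intro!: mult_nonneg_nonneg prod_nonneg)
    qed
    note meas = duhamel_slice_measurable[OF g, of t]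
    have tT: "t \<le> T" using t by simp
    \<comment> \<open>The indicator is that of all of \<open>{0..T}\<close> in the variable
      \<open>t - s\<close>, so that the integral does not depend on \<open>t\<close>. The spelling
      \<open>t + (-1) * s\<close> fits the rule for affine substitutions.\<close>
    define d where "d = (\<lambda>j s. c j * b * (indicator {0..T} (t + (-1) * s) * (t + (-1) * s) powr (- (real j * \<theta>))))"
    have d_int: "has_bochner_integral lborel (d j) (c j * b * I j)" if "j \<le> ?n" for j
    proof -
      have "has_bochner_integral lborel (\<lambda>s. indicator {0..T} (t + (-1) * s) * (t + (-1) * s) powr (- (real j * \<theta>))) (I j)"
        using has_bochner_integral_powr(1)[OF T j\<theta>[OF that]]
          lborel_has_bochner_integral_real_affine_iff[of "-1" "\<lambda>r. indicator {0..T} r * r powr (- (real j * \<theta>))" "I j" t]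
        by (simp add: I_def)
      then show ?thesis unfolding d_def by (intro has_bochner_integral_mult_right)
    qed
    have d_bound: "derivs_bounded \<iota> j (?\<Phi> s) (d j s)" for j s
    proof (cases "0 \<le> s \<and> s < t")
      case True
      then have "derivs_bounded \<iota> j (Pt (t - s) (g s)) (c j * (t - s) powr (- (real j * \<theta>)) * b)"
        using t by (intro c(2) gs b) auto
      moreover have "d j s = c j * (t - s) powr (- (real j * \<theta>)) * b" using True t by (auto simp: d_def)
      ultimately show ?thesis using True by (simp add: duhamel_slice_def)
    next
      case False
      have "d j s \<ge> 0" using c(1) b0 by (simp add: d_def)
      then show ?thesis using False
        by (auto simp: duhamel_slice_def derivs_bounded_def smooth_along_zero(2) intro!: mult_nonneg_nonneg prod_nonneg)
    qed
    have dom: "\<exists>c. integrable lborel c \<and> (\<forall>s x. \<bar>dirds \<iota> j u (?\<Phi> s) x\<bar> \<le> c s)" if "j \<le> ?n" for j u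
    proof (intro exI[of _ "\<lambda>s. d j s * norm_prod j u"] conjI allI)
      show "integrable lborel (\<lambda>s. d j s * norm_prod j u)"
        using d_int[OF that] by (auto simp: has_bochner_integral_iff)
      show "\<bar>dirds \<iota> j u (?\<Phi> s) x\<bar> \<le> d j s * norm_prod j u" for s x
        using d_bound by (auto simp: derivs_bounded_def)
    qed
    have w: "duhamel g t = (\<lambda>x. LINT s|lborel. ?\<Phi> s x)" by (simp add: duhamel_def[abs_def])
    have smw: "smooth_along \<iota> ?n (duhamel g t)"
      unfolding w by (rule smooth_along_integral(1)[OF sm meas[OF tT] dom])
    have dw: "dirds \<iota> j u (duhamel g t) x = (LINT s|lborel. dirds \<iota> j u (?\<Phi> s) x)" if "j \<le> ?n" for j u x
      unfolding w by (subst smooth_along_integral(2)[OF sm meas[OF tT] dom that]) simp_all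
    have iw: "integrable lborel (\<lambda>s. dirds \<iota> j u (?\<Phi> s) x)" if "j \<le> ?n" for j u x
      by (rule smooth_along_integral(3)[OF sm meas[OF tT] dom that])
    have ncw: "norm_cont \<iota> ?n (duhamel g t) x" for x
      unfolding w
      by (rule norm_cont_integral[OF incl_bounded_linear sm meas[OF tT] dom _ d_bound nc])
        (use d_int[OF order_refl] in \<open>auto simp: has_bochner_integral_iff\<close>)
    have bw: "derivs_bounded \<iota> j (duhamel g t) (K * b)" if j: "j \<le> ?n" for j
      unfolding derivs_bounded_def
    proof (intro allI)
      fix u x
      have "\<bar>dirds \<iota> j u (duhamel g t) x\<bar> \<le> (LINT s|lborel. d j s * norm_prod j u)"
        unfolding dw[OF j]
      proof (rule integrable_real_bound(2))
        show "(\<lambda>s. dirds \<iota> j u (?\<Phi> s) x) \<in> borel_measurable lborel" using iw[OF j] by auto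
        show "integrable lborel (\<lambda>s. d j s * norm_prod j u)"
          using d_int[OF j] by (auto simp: has_bochner_integral_iff)
        show "\<bar>dirds \<iota> j u (?\<Phi> s) x\<bar> \<le> d j s * norm_prod j u" for s
          using d_bound by (auto simp: derivs_bounded_def)
      qed
      also have "\<dots> = c j * I j * b * norm_prod j u"
        using d_int[OF j] by (simp add: has_bochner_integral_iff)
      also have "\<dots> \<le> K * b * norm_prod j u"
        by (intro mult_right_mono KI j b0 prod_nonneg) simp
      finally show "\<bar>dirds \<iota> j u (duhamel g t) x\<bar> \<le> K * b * norm_prod j u" .
    qed
    have zw: "\<bar>diff2 \<iota> h (dirds \<iota> ?n u (duhamel g t)) x\<bar> \<le> K * b * norm h * norm_prod ?n u" for x u h
    proof (cases "h = 0")
      case True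
      then show ?thesis using linear_0[OF bounded_linear.linear[OF incl_bounded_linear]] by simp
    next
      case h: False
      define P where "P = norm_prod ?n u"
      have P: "P \<ge> 0" unfolding P_def by (intro prod_nonneg) simp
      \<comment> \<open>\<open>m\<close> majorises the smaller of the two bounds at every distance
        \<open>r\<close> from the end point, and its integral is proportional to
        \<open>norm h\<close>: this proportionality is the Zygmund condition.\<close>
      obtain m where m: "has_bochner_integral lborel m (norm h * (1 / (1 - q) + 1 / (q' - 1)))"
        "\<And>r. m r \<ge> 0" "\<And>r. r > 0 \<Longrightarrow> min (norm h powr p * r powr (- q)) (norm h powr p' * r powr (- q')) \<le> m r"
        using zygmund_kernel[OF constants_pos(3) _ q q', of "norm h"] h by auto
      define E where "E = (\<lambda>s. dirds \<iota> ?n u (?\<Phi> s) (x + 2 *\<^sub>R \<iota> h) - 2 * dirds \<iota> ?n u (?\<Phi> s) (x + \<iota> h) +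
        dirds \<iota> ?n u (?\<Phi> s) x)"
      have E_int: "integrable lborel E"
        unfolding E_def by (intro Bochner_Integration.integrable_add Bochner_Integration.integrable_diff
            integrable_mult_right iw order_refl)
      have m_int: "has_bochner_integral lborel (\<lambda>s. A * b * P * m (t + (-1) * s)) (A * b * P * (norm h * (1 / (1 - q) + 1 / (q' - 1))))"
        using lborel_has_bochner_integral_real_affine_iff[of "-1" m _ t] m(1)
        by (intro has_bochner_integral_mult_right) simp
      have "\<bar>E s\<bar> \<le> A * b * P * m (t + (-1) * s)" for s
      proof (cases "0 \<le> s \<and> s < t")
        case True
        then have s: "0 < t - s" "t - s \<le> T" "s \<in> {0..T}" using t by auto
        let ?F = "Pt (t - s) (g s)"
        have "smooth_along \<iota> ?n ?F" using True by (intro mehler_smooth gs) auto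
        then have "dirds \<iota> ?n u (increment \<iota> h (increment \<iota> h ?F)) x =
            dirds \<iota> ?n u ?F (x + 2 *\<^sub>R \<iota> h) - 2 * dirds \<iota> ?n u ?F (x + \<iota> h) + dirds \<iota> ?n u ?F x"
          by (rule dirds_increment_twice)
        then have "E s = dirds \<iota> ?n u (increment \<iota> h (increment \<iota> h ?F)) x"
          using True by (simp add: E_def duhamel_slice_def)
        then have 1: "\<bar>E s\<bar> \<le> A * b * (norm h powr p * (t - s) powr (- q)) * P"
          and 2: "\<bar>E s\<bar> \<le> A * b * (norm h powr p' * (t - s) powr (- q')) * P"
          using zyg[OF s h] by (simp_all add: derivs_bounded_def P_def)
        have "\<bar>E s\<bar> \<le> A * b * P * min (norm h powr p * (t - s) powr (- q)) (norm h powr p' * (t - s) powr (- q'))"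
          using 1 2 by (simp add: min_def mult_ac)
        also have "\<dots> \<le> A * b * P * m (t - s)"
          using A b0 P by (intro mult_left_mono m(3) s(1)) auto
        finally show ?thesis by simp
      next
        case False
        then have "E s = 0" by (auto simp: E_def duhamel_slice_def smooth_along_zero(2))
        then show ?thesis using A b0 P m(2) by simp
      qed
      then have "\<bar>LINT s|lborel. E s\<bar> \<le> (LINT s|lborel. A * b * P * m (t + (-1) * s))"
        by (rule integrable_real_bound(2)[rotated 2]) (use E_int m_int in \<open>simp_all add: has_bochner_integral_iff\<close>)
      also have "\<dots> = Z * (b * norm h * P)" using m_int by (simp add: has_bochner_integral_iff Z_def mult_ac)
      also have "\<dots> \<le> K * (b * norm h * P)" using s0 b0 P by (intro mult_right_mono) (simp_all add: K_def)
      also have "(LINT s|lborel. E s) = diff2 \<iota> h (dirds \<iota> ?n u (duhamel g t)) x"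
        unfolding E_def dw[OF order_refl] using iw[OF order_refl] by simp
      finally show ?thesis by (simp add: P_def mult_ac)
    qed
    show ?thesis unfolding ZH_bounded_def by (intro conjI allI impI smw ncw bw zw)
  qed
  show ?thesis
  proof (intro exI[of _ K] conjI allI impI)
    show "K \<ge> 0" using s0 Z0 by (simp add: K_def)
  next
    fix g b t
    assume "t \<in> {0..T}" "g \<in> Cb_T T" "\<forall>s\<in>{0..T}. \<forall>x. \<bar>g s x\<bar> \<le> b"
      and "increments_bounded T ?n g (A * b) p q p' q'"
    then show "ZH_bounded \<iota> k (duhamel g t) (K * b)"
      by (intro main) simp_all
  qed
qed

text \<open>Each of the \<open>k - 1\<close> directions of the top derivative, and the step of the
  second difference, is moved by \<open>S_on_H t\<close> and costs one factor
  \<open>H_bound T\<close>; hence the exponent \<open>k\<close>. The second difference is taken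
  inside the integral, along the moved step.\<close>

lemma mehler_ZH_bounded:
  assumes t: "t \<in> {0..T}" and k: "k > 0" and f: "ZH_bounded \<iota> k f b"
  shows "ZH_bounded \<iota> k (Pt t f) (H_bound T ^ k * b)"
proof -
  let ?n = "k - 1" and ?H = "H_bound T"
  have t': "t \<ge> 0" "t \<le> T" using t by auto
  note F = ZH_boundedD[OF f]
  have H: "?H \<ge> 1" by (rule H_bound_ge_1)
  have d: "dirds \<iota> j u (Pt t f) = Pt t (dirds \<iota> j (\<lambda>i. S_on_H t (u i)) f)" if "j \<le> ?n" for j u
    by (rule smooth_along_mehler(2)[OF t'(1) F(1) that])
  have Cb: "dirds \<iota> j u f \<in> Cb" if "j \<le> ?n" for j u by (rule dirds_Cb[OF F(1) that])
  show ?thesis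
    unfolding ZH_bounded_def
  proof (intro conjI allI impI)
    show "smooth_along \<iota> ?n (Pt t f)" by (rule smooth_along_mehler(1)[OF t'(1) F(1)])
    show "norm_cont \<iota> ?n (Pt t f) x" for x
      by (rule norm_cont_mehler[OF t'(1) F(1) F(3)[OF order_refl] F(6) F(2)])
    show "derivs_bounded \<iota> j (Pt t f) (?H ^ k * b)" if j: "j \<le> ?n" for j
      unfolding derivs_bounded_def
    proof (intro allI)
      fix u x
      have "\<bar>dirds \<iota> j u (Pt t f) x\<bar> \<le> b * (\<Prod>i<j. norm (S_on_H t (u i)))"
        unfolding d[OF j]
        by (rule mehler_bound[OF t'(1) Cb[OF j]]) (use F(3)[OF j] in \<open>simp add: derivs_bounded_def\<close>)
      also have "\<dots> \<le> b * (?H ^ j * norm_prod j u)"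
        by (intro mult_left_mono prod_S_on_H t' F(6))
      also have "\<dots> \<le> b * (?H ^ k * norm_prod j u)"
        using H j by (intro mult_left_mono mult_right_mono power_increasing F(6) prod_nonneg) auto
      finally show "\<bar>dirds \<iota> j u (Pt t f) x\<bar> \<le> ?H ^ k * b * norm_prod j u"
        by (simp add: mult_ac)
    qed
    fix x u h
    define D where "D = dirds \<iota> ?n (\<lambda>i. S_on_H t (u i)) f"
    define P where "P = norm_prod ?n u"
    have P: "P \<ge> 0" unfolding P_def by (intro prod_nonneg) simp
    have DCb: "D \<in> Cb" unfolding D_def by (rule Cb[OF order_refl])
    let ?z = "\<iota> (S_on_H t h)"
    define E where "E = (\<lambda>y. D (y + 2 *\<^sub>R ?z) - 2 * D (y + ?z) + D y)"
    have ECb: "E \<in> Cb"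
      using Cb_linear[OF Cb_linear[OF Cb_shift(2)[OF DCb, of "2 *\<^sub>R ?z"] Cb_shift(2)[OF DCb, of ?z], of 1 "-2"] DCb, of 1 1]
      by (simp add: E_def)
    have "E (S t x + y) = D (S t (x + 2 *\<^sub>R \<iota> h) + y) - 2 * D (S t (x + \<iota> h) + y) + D (S t x + y)" for y
      by (simp add: E_def \<iota>_S_on_H[OF t'(1)] blinfun.add_right blinfun.scaleR_right add_ac)
    then have "Pt t D (x + 2 *\<^sub>R \<iota> h) - 2 * Pt t D (x + \<iota> h) + Pt t D x = Pt t E x"
      by (simp add: mehler_def mehler_integrable[OF t'(1) DCb])
    also have "\<bar>Pt t E x\<bar> \<le> b * norm (S_on_H t h) * (\<Prod>i<?n. norm (S_on_H t (u i)))"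
      by (rule mehler_bound[OF t'(1) ECb]) (use F(4) in \<open>simp add: E_def D_def\<close>)
    also have "\<dots> \<le> b * (?H * norm h) * (?H ^ ?n * P)"
      unfolding P_def using F(6) H
      by (intro mult_mono norm_S_on_H prod_S_on_H t' mult_nonneg_nonneg prod_nonneg) auto
    also have "\<dots> = b * norm h * P * ?H ^ Suc ?n" by (simp add: mult_ac)
    finally have *: "\<bar>diff2 \<iota> h (dirds \<iota> ?n u (Pt t f)) x\<bar> \<le> b * norm h * P * ?H ^ Suc ?n"
      unfolding d[OF order_refl] D_def .
    show "\<bar>diff2 \<iota> h (dirds \<iota> ?n u (Pt t f)) x\<bar> \<le> ?H ^ k * b * norm h * P"
      using * k by (simp add: mult_ac)
  qed
qed

end

section \<open>The two estimates\<close>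

lemma sup_norm_leD:
  assumes "sup_norm f \<le> ennreal b" "b \<ge> 0"
  shows "\<bar>f x\<bar> \<le> b"
proof -
  have "ennreal \<bar>f x\<bar> \<le> sup_norm f" unfolding sup_norm_def by (rule SUP_upper) simp
  then have "ennreal \<bar>f x\<bar> \<le> ennreal b" using assms(1) by (rule order_trans)
  then show ?thesis using assms(2) by simp
qed

lemma sup_norm_T_leD:
  assumes "sup_norm_T T g \<le> ennreal b" "b \<ge> 0" "s \<in> {0..T}"
  shows "\<bar>g s x\<bar> \<le> b"
proof (rule sup_norm_leD[where f="g s", OF _ assms(2)])
  have "sup_norm (g s) \<le> sup_norm_T T g" unfolding sup_norm_T_def by (rule SUP_upper[OF assms(3)])
  then show "sup_norm (g s) \<le> ennreal b" using assms(1) by (rule order_trans)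
qed

lemma sup_norm_T_finite:
  assumes "g \<in> Cb_T T"
  shows "sup_norm_T T g < \<infinity>"
proof -
  obtain B where "\<And>s x. s \<in> {0..T} \<Longrightarrow> \<bar>g s x\<bar> \<le> B"
    using assms by (fastforce simp: Cb_T_def bounded_iff)
  then have "sup_norm_T T g \<le> ennreal B"
    unfolding sup_norm_T_def sup_norm_def by (intro SUP_least ennreal_leI)
  then show ?thesis by (rule le_less_trans) simp
qed

lemma CHalpha_T_norm_leD:
  assumes "CHalpha_T_norm \<iota> T \<alpha> g \<le> ennreal b" "b \<ge> 0" "s \<in> {0..T}"
  shows "\<bar>g s x\<bar> \<le> b" "h \<noteq> 0 \<Longrightarrow> \<bar>g s (x + \<iota> h) - g s x\<bar> \<le> b * norm h powr \<alpha>"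
proof -
  have "CHalpha_norm \<iota> \<alpha> (g s) \<le> CHalpha_T_norm \<iota> T \<alpha> g"
    unfolding CHalpha_T_norm_def by (rule SUP_upper[OF assms(3)])
  then have le: "CHalpha_norm \<iota> \<alpha> (g s) \<le> ennreal b" using assms(1) by (rule order_trans)
  have "sup_norm (g s) \<le> CHalpha_norm \<iota> \<alpha> (g s)" "CHalpha_seminorm \<iota> \<alpha> (g s) \<le> CHalpha_norm \<iota> \<alpha> (g s)"
    unfolding CHalpha_norm_def by simp_all
  then have b: "sup_norm (g s) \<le> ennreal b" "CHalpha_seminorm \<iota> \<alpha> (g s) \<le> ennreal b"
    using le by (auto intro: order_trans)
  show "\<bar>g s x\<bar> \<le> b" by (rule sup_norm_leD[OF b(1) assms(2)])
  assume h: "h \<noteq> 0"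
  have "ennreal (\<bar>g s (x + \<iota> h) - g s x\<bar> / norm h powr \<alpha>) \<le> CHalpha_seminorm \<iota> \<alpha> (g s)"
    unfolding CHalpha_seminorm_def using h by (intro SUP_upper2[of x] SUP_upper2[of h]) auto
  then have "ennreal (\<bar>g s (x + \<iota> h) - g s x\<bar> / norm h powr \<alpha>) \<le> ennreal b"
    using b(2) by (rule order_trans)
  then show "\<bar>g s (x + \<iota> h) - g s x\<bar> \<le> b * norm h powr \<alpha>"
    using assms(2) h by (simp add: pos_divide_le_eq)
qed

context fomin_mehler_semigroup
begin

lemma mild_solution_ZH_T:
  assumes k: "k > 0" and b: "b \<ge> 0" "K \<ge> 0" and f: "ZH_bounded \<iota> k f b"
    and g: "g \<in> Cb_T T" "\<And>s x. s \<in> {0..T} \<Longrightarrow> \<bar>g s x\<bar> \<le> b"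
    and w: "\<And>t. t \<in> {0..T} \<Longrightarrow> ZH_bounded \<iota> k (duhamel g t) (K * b)"
  shows "mild_solution S \<mu> f g \<in> ZH_T \<iota> T k"
    "ZH_T_norm \<iota> T k (mild_solution S \<mu> f g) \<le> ennreal ((real k + 2) * (H_bound T ^ k + K) * b)"
proof -
  have fCb: "f \<in> Cb" by (rule smooth_along_Cb[OF ZH_boundedD(1)[OF f]])
  have H: "H_bound T ^ k \<ge> 0" using H_bound_ge_1[of T] by simp
  have v: "mild_solution S \<mu> f g t = (\<lambda>x. Pt t f x + duhamel g t x)" if "t \<in> {0..T}" for t
    using mild_solution_eq[OF g(1), of t f] that by auto
  have Z: "ZH_bounded \<iota> k (mild_solution S \<mu> f g t) ((H_bound T ^ k + K) * b)" if t: "t \<in> {0..T}" for t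
    using ZH_bounded_add[OF mehler_ZH_bounded[OF t k f] w[OF t]] by (simp add: v[OF t] distrib_right)
  have "continuous_on ({0..T} \<times> UNIV) (\<lambda>(t, x). Pt t f x)"
    unfolding continuous_on_sequentially comp_def
  proof (intro allI ballI impI, elim conjE)
    fix p :: "nat \<Rightarrow> real \<times> 'x" and a
    assume a: "a \<in> {0..T} \<times> (UNIV :: 'x set)" and p: "\<forall>n. p n \<in> {0..T} \<times> (UNIV :: 'x set)" "p \<longlonglongrightarrow> a"
    \<comment> \<open>The initial datum is viewed as a source that is constant in time; any
      admissible source time will then do.\<close>
    have "(\<lambda>_. f) \<in> Cb_T T"
      using fCb unfolding Cb_T_def Cb_def case_prod_unfold
      by (auto intro!: continuous_on_compose2[of UNIV f _ snd] continuous_intros elim!: bounded_subset)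
    then have "(\<lambda>n. Pt (fst (p n)) f (snd (p n))) \<longlonglongrightarrow> Pt (fst a) f (snd a)"
    proof (rule mehler_tendsto[where g="\<lambda>_. f" and s="\<lambda>_. fst (p 0)"])
      show "fst (p n) \<ge> 0" "fst (p 0) \<in> {0..T}" for n
        using p(1)[rule_format, of n] p(1)[rule_format, of 0] by (auto simp: mem_Times_iff)
      show "(\<lambda>n. fst (p n)) \<longlonglongrightarrow> fst a" "(\<lambda>n. snd (p n)) \<longlonglongrightarrow> snd a"
        by (intro tendsto_intros p(2))+
    qed (rule tendsto_const)
    then show "(\<lambda>n. case p n of (t, x) \<Rightarrow> Pt t f x) \<longlonglongrightarrow> (case a of (t, x) \<Rightarrow> Pt t f x)"
      by (simp add: case_prod_unfold)
  qed
  from continuous_on_add[OF this duhamel_continuous[OF g]]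
  have c: "continuous_on ({0..T} \<times> UNIV) (\<lambda>(t, x). mild_solution S \<mu> f g t x)"
    by (rule continuous_on_eq) (auto simp: v)
  have "(H_bound T ^ k + K) * b \<ge> 0" using H b by simp
  from ZH_TI[OF incl_bounded_linear c Z this]
  show "mild_solution S \<mu> f g \<in> ZH_T \<iota> T k"
    "ZH_T_norm \<iota> T k (mild_solution S \<mu> f g) \<le> ennreal ((real k + 2) * (H_bound T ^ k + K) * b)"
    by (simp_all add: mult.assoc)
qed

text \<open>\<open>N\<close> stands for the norm of \<open>g\<close> in either part. As both norms
  are finite, their sum is a real number \<open>b\<close> that bounds \<open>f\<close> and
  \<open>g\<close> simultaneously, and linearity in \<open>b\<close> gives the inequality.\<close>

lemma mild_solution_estimate:
  assumes k: "k > 0" and K: "K \<ge> 0" and f: "f \<in> ZH \<iota> k" and g: "g \<in> Cb_T T" and N: "N < \<infinity>"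
    and gN: "\<And>b s x. b \<ge> 0 \<Longrightarrow> N \<le> ennreal b \<Longrightarrow> s \<in> {0..T} \<Longrightarrow> \<bar>g s x\<bar> \<le> b"
    and w: "\<And>b t. b \<ge> 0 \<Longrightarrow> N \<le> ennreal b \<Longrightarrow> t \<in> {0..T} \<Longrightarrow> ZH_bounded \<iota> k (duhamel g t) (K * b)"
  shows "mild_solution S \<mu> f g \<in> ZH_T \<iota> T k \<and> ZH_T_norm \<iota> T k (mild_solution S \<mu> f g) \<le>
    ennreal ((real k + 2) * (H_bound T ^ k + K)) * (ZH_norm \<iota> k f + N)"
proof -
  have "ZH_norm \<iota> k f + N < \<infinity>" using ZH_norm_finite[OF f] N by simp
  then obtain b where b: "b \<ge> 0" "ZH_norm \<iota> k f + N = ennreal b"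
    by (cases "ZH_norm \<iota> k f + N") auto
  have fb: "ZH_norm \<iota> k f \<le> ennreal b" and Nb: "N \<le> ennreal b"
    unfolding b(2)[symmetric] by simp_all
  note res = mild_solution_ZH_T[OF k b(1) K ZH_imp_ZH_bounded[OF incl_bounded_linear f fb b(1)] g
      gN[OF b(1) Nb] w[OF b(1) Nb]]
  show ?thesis
    using res b(1) K H_bound_ge_1[of T] unfolding b(2) by (simp add: ennreal_mult)
qed

text \<open>Both increments are treated alike. The triangle inequality twice costs a factor 4 and
  gives no power of \<open>norm h\<close>; the mean value theorem twice gives its square for two
  more derivatives. Hence the exponents 0 and 2, with \<open>q = 1 - \<theta>\<close> and
  \<open>q' = 1 + \<theta>\<close> on either side of 1.\<close>

theorem mild_solution_zygmund:
  assumes T: "T > 0" and k: "1 / \<theta> = real k"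
  shows "\<exists>K>0. \<forall>f g. f \<in> ZH \<iota> k \<and> g \<in> Cb_T T \<longrightarrow>
    mild_solution S \<mu> f g \<in> ZH_T \<iota> T k \<and>
    ZH_T_norm \<iota> T k (mild_solution S \<mu> f g) \<le> ennreal K * (ZH_norm \<iota> k f + sup_norm_T T g)"
proof -
  let ?n = "k - 1"
  have \<theta>: "\<theta> > 0" by (rule constants_pos)
  \<comment> \<open>\<open>1 / \<theta>\<close> is positive, which excludes \<open>k = 0\<close>,
    where \<open>k - 1\<close> would be truncated.\<close>
  have k0: "k > 0" using k \<theta> by (cases k) auto
  have k\<theta>: "real k * \<theta> = 1" using k \<theta> by (simp add: field_simps)
  have n: "real ?n = real k - 1" "real (Suc (Suc ?n)) = real k + 1" using k0 by (simp_all add: of_nat_diff)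
  define q q' where "q = real ?n * \<theta>" and "q' = real (Suc (Suc ?n)) * \<theta>"
  have q: "q = 1 - \<theta>" "q' = 1 + \<theta>"
    unfolding q_def q'_def n using k\<theta> by (simp_all add: algebra_simps)
  obtain c1 where c1: "c1 \<ge> 0" "\<And>t f b. 0 < t \<Longrightarrow> t \<le> T \<Longrightarrow> f \<in> Cb \<Longrightarrow> (\<And>x. \<bar>f x\<bar> \<le> b) \<Longrightarrow>
     derivs_bounded \<iota> ?n (Pt t f) (c1 * t powr (- q) * b)"
    using mehler_smoothing[of T ?n] unfolding q_def by blast
  obtain c2 where c2: "c2 \<ge> 0" "\<And>t f b. 0 < t \<Longrightarrow> t \<le> T \<Longrightarrow> f \<in> Cb \<Longrightarrow> (\<And>x. \<bar>f x\<bar> \<le> b) \<Longrightarrow>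
     derivs_bounded \<iota> (Suc (Suc ?n)) (Pt t f) (c2 * t powr (- q') * b)"
    using mehler_smoothing[of T "Suc (Suc ?n)"] unfolding q'_def by blast
  define A where "A = 4 * c1 + c2"
  have A: "A \<ge> 0" using c1 c2 by (simp add: A_def)
  have q\<theta>: "real ?n * \<theta> < 1" using q(1) \<theta> by (simp add: q_def)
  have q1: "q < 1" "q' > 1" using \<theta> by (simp_all add: q)
  have pq: "0 + (1 - q) / \<theta> = 1" "2 + (1 - q') / \<theta> = 1" using \<theta> by (simp_all add: q)
  from duhamel_ZH_bounded[OF T q\<theta> A q1(1) pq(1) q1(2) pq(2)]
  obtain K where K: "K \<ge> 0" "\<And>g b t. t \<in> {0..T} \<Longrightarrow> g \<in> Cb_T T \<Longrightarrow> (\<forall>s\<in>{0..T}. \<forall>x. \<bar>g s x\<bar> \<le> b) \<Longrightarrow>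
    (increments_bounded T ?n g (A * b) 0 q 2 q') \<Longrightarrow>
    ZH_bounded \<iota> k (duhamel g t) (K * b)"
    by blast
  have w: "ZH_bounded \<iota> k (duhamel g t) (K * b)"
    if g: "g \<in> Cb_T T" and b: "b \<ge> 0" "sup_norm_T T g \<le> ennreal b" and t: "t \<in> {0..T}" for g b t
  proof (rule K(2)[OF t g])
    have gb: "\<bar>g s x\<bar> \<le> b" if "s \<in> {0..T}" for s x by (rule sup_norm_T_leD[OF b(2,1) that])
    then show "\<forall>s\<in>{0..T}. \<forall>x. \<bar>g s x\<bar> \<le> b" by blast
    show "increments_bounded T ?n g (A * b) 0 q 2 q'"
    proof (intro allI impI conjI)
      fix r s :: real and h :: 'h assume r: "0 < r" "r \<le> T" and s: "s \<in> {0..T}" and h: "h \<noteq> 0"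
      let ?F = "Pt r (g s)"
      have gs: "g s \<in> Cb" by (rule Cb_T_slice[OF g s])
      have sm: "smooth_along \<iota> m ?F" for m by (rule mehler_smooth[OF r(1) gs])
      have 1: "derivs_bounded \<iota> ?n ?F (c1 * r powr (- q) * b)" by (rule c1(2)[OF r gs gb[OF s]])
      have 2: "derivs_bounded \<iota> (Suc (Suc ?n)) ?F (c2 * r powr (- q') * b)" by (rule c2(2)[OF r gs gb[OF s]])
      have rb: "r powr a * b \<ge> 0" for a using b by simp
      have "derivs_bounded \<iota> ?n (increment \<iota> h (increment \<iota> h ?F)) (2 * (2 * (c1 * r powr (- q) * b)))"
        by (intro derivs_bounded_increment(1) smooth_along_increment(1) sm 1)
      then show "derivs_bounded \<iota> ?n (increment \<iota> h (increment \<iota> h ?F)) (A * b * (norm h powr 0 * r powr (- q)))"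
      proof (rule derivs_bounded_nonneg_const)
        have "4 * c1 * (r powr (- q) * b) \<le> A * (r powr (- q) * b)"
          using c2 by (intro mult_right_mono rb) (simp add: A_def)
        then show "2 * (2 * (c1 * r powr (- q) * b)) \<le> A * b * (norm h powr 0 * r powr (- q))"
          using h by (simp add: mult_ac)
      qed
      have "derivs_bounded \<iota> ?n (increment \<iota> h (increment \<iota> h ?F)) (c2 * r powr (- q') * b * norm h * norm h)"
        by (intro derivs_bounded_increment(2) smooth_along_increment(1) sm 2)
      then show "derivs_bounded \<iota> ?n (increment \<iota> h (increment \<iota> h ?F)) (A * b * (norm h powr 2 * r powr (- q')))"
      proof (rule derivs_bounded_nonneg_const)
        have "c2 * (r powr (- q') * b * (norm h)\<^sup>2) \<le> A * (r powr (- q') * b * (norm h)\<^sup>2)"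
          using c1 b by (intro mult_right_mono) (simp_all add: A_def)
        then show "c2 * r powr (- q') * b * norm h * norm h \<le> A * b * (norm h powr 2 * r powr (- q'))"
          using h by (simp add: mult_ac power2_eq_square powr_numeral)
      qed
    qed
  qed
  show ?thesis
  proof (rule exI[of _ "(real k + 2) * (H_bound T ^ k + K)"], rule conjI)
    have "1 \<le> H_bound T ^ k" by (intro one_le_power H_bound_ge_1)
    then have "H_bound T ^ k + K > 0" using K(1) by linarith
    then show "(real k + 2) * (H_bound T ^ k + K) > 0" by simp
    show "\<forall>f g. f \<in> ZH \<iota> k \<and> g \<in> Cb_T T \<longrightarrow> mild_solution S \<mu> f g \<in> ZH_T \<iota> T k \<and>
      ZH_T_norm \<iota> T k (mild_solution S \<mu> f g) \<le>
        ennreal ((real k + 2) * (H_bound T ^ k + K)) * (ZH_norm \<iota> k f + sup_norm_T T g)"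
    proof (intro allI impI, elim conjE)
      fix f and g :: "real \<Rightarrow> 'x \<Rightarrow> real" assume f: "f \<in> ZH \<iota> k" and g': "g \<in> Cb_T T"
      have g: "g \<in> Cb_T T" and N: "sup_norm_T T g < \<infinity>" using g' sup_norm_T_finite by auto
      show "mild_solution S \<mu> f g \<in> ZH_T \<iota> T k \<and> ZH_T_norm \<iota> T k (mild_solution S \<mu> f g) \<le>
        ennreal ((real k + 2) * (H_bound T ^ k + K)) * (ZH_norm \<iota> k f + sup_norm_T T g)"
      proof (rule mild_solution_estimate[OF k0 K(1) f g N])
        show "\<bar>g s x\<bar> \<le> b" if "b \<ge> 0" "sup_norm_T T g \<le> ennreal b" "s \<in> {0..T}" for b s x
          by (rule sup_norm_T_leD[OF that(2,1,3)])
        show "ZH_bounded \<iota> k (duhamel g t) (K * b)"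
          if "b \<ge> 0" "sup_norm_T T g \<le> ennreal b" "t \<in> {0..T}" for b t
          by (rule w[OF g that])
      qed
    qed
  qed
qed

text \<open>One increment is spent on the Hoelder bound and yields
  \<open>norm h powr \<alpha>\<close> at once. The other one is estimated by the triangle inequality
  or by the mean value theorem, so the exponents are \<open>\<alpha>\<close> and
  \<open>1 + \<alpha>\<close>, and a single additional derivative is enough.\<close>

theorem mild_solution_hoelder:
  assumes T: "T > 0" and \<alpha>: "0 < \<alpha>" "\<alpha> < 1" and k: "\<alpha> + 1 / \<theta> = real k"
  shows "\<exists>K>0. \<forall>f g. f \<in> ZH \<iota> k \<and> g \<in> CHalpha_T \<iota> T \<alpha> \<longrightarrow>
    mild_solution S \<mu> f g \<in> ZH_T \<iota> T k \<and>
    ZH_T_norm \<iota> T k (mild_solution S \<mu> f g) \<le> ennreal K * (ZH_norm \<iota> k f + CHalpha_T_norm \<iota> T \<alpha> g)"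
proof -
  let ?n = "k - 1" and ?H = "H_bound T"
  have \<theta>: "\<theta> > 0" by (rule constants_pos)
  have "real k > 0" using k \<theta> \<alpha> by (simp add: add_pos_pos flip: k)
  then have k0: "k > 0" by simp
  have k\<theta>: "real k * \<theta> = 1 + \<alpha> * \<theta>" using \<theta> by (simp add: k[symmetric] field_simps)
  have n: "real ?n = real k - 1" "real (Suc ?n) = real k" using k0 by (simp_all add: of_nat_diff)
  have H: "?H \<ge> 1" by (rule H_bound_ge_1)
  define q q' where "q = real ?n * \<theta>" and "q' = real (Suc ?n) * \<theta>"
  have q: "q = 1 - (1 - \<alpha>) * \<theta>" "q' = 1 + \<alpha> * \<theta>"
    unfolding q_def q'_def n using k\<theta> by (simp_all add: algebra_simps)
  have q1: "q < 1" "q' > 1" using \<alpha> \<theta> by (simp_all add: q)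
  have pq: "\<alpha> + (1 - q) / \<theta> = 1" "(1 + \<alpha>) + (1 - q') / \<theta> = 1" using \<theta> by (simp_all add: q field_simps)
  obtain c1 where c1: "c1 \<ge> 0" "\<And>t f b. 0 < t \<Longrightarrow> t \<le> T \<Longrightarrow> f \<in> Cb \<Longrightarrow> (\<And>x. \<bar>f x\<bar> \<le> b) \<Longrightarrow>
     derivs_bounded \<iota> ?n (Pt t f) (c1 * t powr (- q) * b)"
    using mehler_smoothing[of T ?n] unfolding q_def by blast
  obtain c2 where c2: "c2 \<ge> 0" "\<And>t f b. 0 < t \<Longrightarrow> t \<le> T \<Longrightarrow> f \<in> Cb \<Longrightarrow> (\<And>x. \<bar>f x\<bar> \<le> b) \<Longrightarrow>
     derivs_bounded \<iota> (Suc ?n) (Pt t f) (c2 * t powr (- q') * b)"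
    using mehler_smoothing[of T "Suc ?n"] unfolding q'_def by blast
  \<comment> \<open>\<open>?H powr \<alpha>\<close> arises because the increment of
    \<open>g s\<close> is taken along \<open>S_on_H r h\<close> instead of \<open>h\<close>; the 2
    is the triangle inequality for the remaining increment.\<close>
  define A where "A = (2 * c1 + c2) * ?H powr \<alpha>"
  have A: "A \<ge> 0" using c1 c2 by (simp add: A_def)
  have q\<theta>: "real ?n * \<theta> < 1" using q1(1) by (simp add: q_def)
  from duhamel_ZH_bounded[OF T q\<theta> A q1(1) pq(1) q1(2) pq(2)]
  obtain K where K: "K \<ge> 0" "\<And>g b t. t \<in> {0..T} \<Longrightarrow> g \<in> Cb_T T \<Longrightarrow> (\<forall>s\<in>{0..T}. \<forall>x. \<bar>g s x\<bar> \<le> b) \<Longrightarrow>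
    (increments_bounded T ?n g (A * b) \<alpha> q (1 + \<alpha>) q') \<Longrightarrow>
    ZH_bounded \<iota> k (duhamel g t) (K * b)"
    by blast
  have w: "ZH_bounded \<iota> k (duhamel g t) (K * b)"
    if g: "g \<in> Cb_T T" and b: "b \<ge> 0" "CHalpha_T_norm \<iota> T \<alpha> g \<le> ennreal b" and t: "t \<in> {0..T}" for g b t
  proof (rule K(2)[OF t g])
    note gb = CHalpha_T_norm_leD[OF b(2,1)]
    show "\<forall>s\<in>{0..T}. \<forall>x. \<bar>g s x\<bar> \<le> b" using gb(1) by blast
    show "increments_bounded T ?n g (A * b) \<alpha> q (1 + \<alpha>) q'"
    proof (intro allI impI conjI)
      fix r s :: real and h :: 'h assume r: "0 < r" "r \<le> T" and s: "s \<in> {0..T}" and h: "h \<noteq> 0"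
      have r0: "r \<ge> 0" using r by simp
      let ?h = "S_on_H r h"
      define G where "G = (\<lambda>x. g s (x + \<iota> ?h) - g s x)"
      define B where "B = b * (?H powr \<alpha> * norm h powr \<alpha>)"
      have B0: "B \<ge> 0" using b by (simp add: B_def)
      have gs: "g s \<in> Cb" by (rule Cb_T_slice[OF g s])
      have G: "G \<in> Cb"
        using Cb_linear[OF Cb_shift(2)[OF gs, of "\<iota> ?h"] gs, of 1 "-1"] by (simp add: G_def)
      have GB: "\<bar>G x\<bar> \<le> B" for x
      \<comment> \<open>The Hoelder seminorm speaks of nonzero steps, and \<open>S_on_H r h\<close>
        may vanish although \<open>h\<close> does not.\<close>
      proof (cases "?h = 0")
        case True
        then show ?thesis
          using B0 linear_0[OF bounded_linear.linear[OF incl_bounded_linear]] by (simp add: G_def)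
      next
        case False
        have "\<bar>G x\<bar> \<le> b * norm ?h powr \<alpha>" unfolding G_def by (rule gb(2)[OF s False])
        also have "\<dots> \<le> b * (?H * norm h) powr \<alpha>"
          using \<alpha> by (intro mult_left_mono powr_mono2 norm_S_on_H r0 r b) auto
        also have "\<dots> = B" using H by (simp add: B_def powr_mult)
        finally show ?thesis .
      qed
      have FG: "increment \<iota> h (Pt r (g s)) = Pt r G"
        using mehler_shift[OF r0 gs, of "\<iota> h"] by (simp add: increment_def G_def \<iota>_S_on_H[OF r0] fun_eq_iff)
      have sm: "smooth_along \<iota> m (Pt r G)" for m by (rule mehler_smooth[OF r(1) G])
      have 1: "derivs_bounded \<iota> ?n (Pt r G) (c1 * r powr (- q) * B)" by (rule c1(2)[OF r G GB])
      have 2: "derivs_bounded \<iota> (Suc ?n) (Pt r G) (c2 * r powr (- q') * B)" by (rule c2(2)[OF r G GB])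
      have "derivs_bounded \<iota> ?n (increment \<iota> h (Pt r G)) (2 * (c1 * r powr (- q) * B))"
        by (intro derivs_bounded_increment(1) sm 1)
      then show "derivs_bounded \<iota> ?n (increment \<iota> h (increment \<iota> h (Pt r (g s)))) (A * b * (norm h powr \<alpha> * r powr (- q)))"
        unfolding FG
      proof (rule derivs_bounded_nonneg_const)
        have "2 * c1 * (r powr (- q) * B) \<le> (2 * c1 + c2) * (r powr (- q) * B)"
          using c2 B0 by (intro mult_right_mono) simp_all
        then show "2 * (c1 * r powr (- q) * B) \<le> A * b * (norm h powr \<alpha> * r powr (- q))"
          by (simp add: A_def B_def mult_ac)
      qed
      have "derivs_bounded \<iota> ?n (increment \<iota> h (Pt r G)) (c2 * r powr (- q') * B * norm h)"
        by (intro derivs_bounded_increment(2) sm 2)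
      then show "derivs_bounded \<iota> ?n (increment \<iota> h (increment \<iota> h (Pt r (g s)))) (A * b * (norm h powr (1 + \<alpha>) * r powr (- q')))"
        unfolding FG
      proof (rule derivs_bounded_nonneg_const)
        have "c2 * (r powr (- q') * B * norm h) \<le> (2 * c1 + c2) * (r powr (- q') * B * norm h)"
          using c1 B0 by (intro mult_right_mono) simp_all
        then show "c2 * r powr (- q') * B * norm h \<le> A * b * (norm h powr (1 + \<alpha>) * r powr (- q'))"
          using h by (simp add: A_def B_def powr_add mult_ac)
      qed
    qed
  qed
  show ?thesis
  proof (rule exI[of _ "(real k + 2) * (?H ^ k + K)"], rule conjI)
    have "1 \<le> H_bound T ^ k" by (intro one_le_power H_bound_ge_1)
    then have "H_bound T ^ k + K > 0" using K(1) by linarith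
    then show "(real k + 2) * (?H ^ k + K) > 0" by simp
    show "\<forall>f g. f \<in> ZH \<iota> k \<and> g \<in> CHalpha_T \<iota> T \<alpha> \<longrightarrow> mild_solution S \<mu> f g \<in> ZH_T \<iota> T k \<and>
      ZH_T_norm \<iota> T k (mild_solution S \<mu> f g) \<le>
        ennreal ((real k + 2) * (?H ^ k + K)) * (ZH_norm \<iota> k f + CHalpha_T_norm \<iota> T \<alpha> g)"
    proof (intro allI impI, elim conjE)
      fix f and g :: "real \<Rightarrow> 'x \<Rightarrow> real" assume f: "f \<in> ZH \<iota> k" and g': "g \<in> CHalpha_T \<iota> T \<alpha>"
      have g: "g \<in> Cb_T T" and N: "CHalpha_T_norm \<iota> T \<alpha> g < \<infinity>" using g' unfolding CHalpha_T_def by auto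
      show "mild_solution S \<mu> f g \<in> ZH_T \<iota> T k \<and> ZH_T_norm \<iota> T k (mild_solution S \<mu> f g) \<le>
        ennreal ((real k + 2) * (?H ^ k + K)) * (ZH_norm \<iota> k f + CHalpha_T_norm \<iota> T \<alpha> g)"
      proof (rule mild_solution_estimate[OF k0 K(1) f g N])
        show "\<bar>g s x\<bar> \<le> b" if "b \<ge> 0" "CHalpha_T_norm \<iota> T \<alpha> g \<le> ennreal b" "s \<in> {0..T}" for b s x
          by (rule CHalpha_T_norm_leD(1)[OF that(2,1,3)])
        show "ZH_bounded \<iota> k (duhamel g t) (K * b)"
          if "b \<ge> 0" "CHalpha_T_norm \<iota> T \<alpha> g \<le> ennreal b" "t \<in> {0..T}" for b t
          by (rule w[OF g that])
      qed
    qed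
  qed
qed

end

theorem theorem3p13:
  fixes S :: "real \<Rightarrow> ('x::{banach, second_countable_topology}) \<Rightarrow>\<^sub>L 'x"
    and \<mu> :: "real \<Rightarrow> 'x measure"
    and \<iota> :: "'h::banach \<Rightarrow> 'x"
    and Ht :: "real \<Rightarrow> 'x set"
    and M C \<theta> \<omega> T :: real
  assumes setting: "fomin_mehler_semigroup S \<mu> \<iota> Ht M C \<theta> \<omega>"
    and T_pos: "T > 0"
  shows "(\<forall>k::nat. 1 / \<theta> = real k \<longrightarrow>
      (\<exists>K::real. K > 0 \<and>
        (\<forall>f g. f \<in> ZH \<iota> k \<and> g \<in> Cb_T T \<longrightarrow>
          mild_solution S \<mu> f g \<in> ZH_T \<iota> T k \<and>
          ZH_T_norm \<iota> T k (mild_solution S \<mu> f g)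
            \<le> ennreal K * (ZH_norm \<iota> k f + sup_norm_T T g))))
    \<and> (\<forall>(\<alpha>::real) (k::nat). 0 < \<alpha> \<and> \<alpha> < 1 \<and> \<alpha> + 1 / \<theta> = real k \<longrightarrow>
      (\<exists>K::real. K > 0 \<and>
        (\<forall>f g. f \<in> ZH \<iota> k \<and> g \<in> CHalpha_T \<iota> T \<alpha> \<longrightarrow>
          mild_solution S \<mu> f g \<in> ZH_T \<iota> T k \<and>
          ZH_T_norm \<iota> T k (mild_solution S \<mu> f g)
            \<le> ennreal K * (ZH_norm \<iota> k f + CHalpha_T_norm \<iota> T \<alpha> g))))"
proof -
  interpret fomin_mehler_semigroup S \<mu> \<iota> Ht M C \<theta> \<omega> by (rule setting)
  show ?thesis
    using mild_solution_zygmund[OF T_pos] mild_solution_hoelder[OF T_pos] by blast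
qed

end
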